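(* Let $\mathbb{X},\mathbb{Y}$ be lcscH spaces, $k\ge1$ and $f_t:\mathbb{X}^k\to\mathbb{Y}$, $t\ge1$, symmetric measurable maps. Let $\mu_t$ be either a Poisson process $\eta_t$ on $\mathbb{X}$ with intensity measure $\mathbb{K}_t:=t\mathbb{K}$ ($\mathbb{K}$ a fixed $\sigma$-finite measure), or a binomial process $\beta_t$ of $\lceil t\rceil$ i.i.d. points with distribution a fixed probability measure $\mathbb{K}_1$, with $\mathbb{K}_t:=\lceil t\rceil\mathbb{K}_1$. For a measurable $B\subset\mathbb{Y}$ let $$S_t(B):=\frac1{k!}\sum_{(x_1,\dots,x_k)\in\mu^k_{t,\neq}}\mathbf{1}(f_t(x_1,\dots,x_k)\in B).$$ Let $Z$ be Poisson distributed with mean $\lambda\in[0,\infty)$ and suppose $\mathbb{E}S_t(B)^2<\infty$. In the Poisson case ($\mu_t=\eta_t$, $t\ge1$), $$\mathbf{d}_{\mathbf{W}}(S_t(B),Z)\le|\mathbb{E}S_t(B)-\lambda|+2\big(\mathbb{E}S_t(B)^2-\mathbb{E}S_t(B)-(\mathbb{E}S_t(B))^2\big)\le|\mathbb{E}S_t(B)-\lambda|+\frac{2^{k+1}}{k!}r_t(B).$$ In the binomial case ($\mu_t=\beta_t$, $t\ge1$), $$\mathbf{d}_{\mathbf{W}}(S_t(B),Z)\le|\mathbb{E}S_t(B)-\lambda|+2\Big(\mathbb{E}S_t(B)^2-\mathbb{E}S_t(B)-\frac{(\lceil t\rceil-k)_k}{(\lceil t\rceil)_k}(\mathbb{E}S_t(B))^2\Big)+\frac{6^kk!}{t}(\mathbb{E}S_t(B))^2$$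 $$\le|\mathbb{E}S_t(B)-\lambda|+\frac{2^{k+1}}{k!}r_t(B)+\frac{6^kk!}{t}(\mathbb{E}S_t(B))^2.$$
   Context: $\mu^k_{t,\neq}$: $k$-tuples of distinct points of $\mu_t$. $(n)_k=n(n-1)\cdots(n-k+1)$, with $(n-k)_k/(n)_k:=0$ if $n<k$. $\mathbf{d}_{\mathbf{W}}(Y_1,Y_2):=\sup_h|\mathbb{E}h(Y_1)-\mathbb{E}h(Y_2)|$ over all $h:\mathbb{R}\to\mathbb{R}$ with Lipschitz constant at most one. For $k\ge2$, $$r_t(B):=\max_{1\le\ell\le k-1}\int_{\mathbb{X}^\ell}\Big(\int_{\mathbb{X}^{k-\ell}}\mathbf{1}(f_t(x_1,\dots,x_k)\in B)\,\mathbb{K}_t^{k-\ell}(d(x_{\ell+1},\dots,x_k))\Big)^2\mathbb{K}_t^\ell(d(x_1,\dots,x_\ell)),$$ and $r_t(B):=0$ if $k=1$. lcscH: locally compact Hausdorff with countable base. *)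

theory Defs
  imports "HOL-Probability.Probability"
begin

definition lcscH :: "'a::topological_space itself \<Rightarrow> bool" where
  "lcscH _ \<longleftrightarrow> locally_compact_space (euclidean :: 'a topology) \<and>
     Hausdorff_space (euclidean :: 'a topology) \<and> second_countable (euclidean :: 'a topology)"

definition po :: "real \<Rightarrow> nat pmf" where
  "po c = (if c = 0 then return_pmf 0 else poisson_pmf c)"

text \<open>A (proper) point process is represented as \<open>\<mu> = \<Sum>_{i<\<kappa>} \<delta>_{X i}\<close>.
  Number of points in A (possibly infinite).\<close>
definition pcount :: "('w \<Rightarrow> enat) \<Rightarrow> ('w \<Rightarrow> nat \<Rightarrow> 'a) \<Rightarrow> 'a set \<Rightarrow> 'w \<Rightarrow> enat" where
  "pcount \<kappa> X A \<omega> =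
     (let S = {i. enat i < \<kappa> \<omega> \<and> X \<omega> i \<in> A} in if finite S then enat (card S) else \<infinity>)"

definition point_process :: "'w measure \<Rightarrow> ('w \<Rightarrow> enat) \<Rightarrow> ('w \<Rightarrow> nat \<Rightarrow> 'a::topological_space) \<Rightarrow> bool" where
  "point_process M \<kappa> X \<longleftrightarrow> prob_space M \<and> \<kappa> \<in> M \<rightarrow>\<^sub>M count_space UNIV \<and>
     (\<forall>i. (\<lambda>\<omega>. X \<omega> i) \<in> M \<rightarrow>\<^sub>M borel)"

text \<open>Poisson process with intensity measure L (Last--Penrose, Def. 3.1).\<close>
definition poisson_process :: "'w measure \<Rightarrow> ('w \<Rightarrow> enat) \<Rightarrow> ('w \<Rightarrow> nat \<Rightarrow> 'a::topological_space) \<Rightarrow> 'a measure \<Rightarrow> bool" where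
  "poisson_process M \<kappa> X L \<longleftrightarrow> point_process M \<kappa> X \<and>
     (\<forall>A \<in> sets borel.
        (emeasure L A < \<infinity> \<longrightarrow> distr M (count_space UNIV) (pcount \<kappa> X A)
                                 = measure_pmf (map_pmf enat (po (enn2real (emeasure L A))))) \<and>
        (emeasure L A = \<infinity> \<longrightarrow> (AE \<omega> in M. pcount \<kappa> X A \<omega> = \<infinity>))) \<and>
     (\<forall>(I::nat set) A. finite I \<longrightarrow> (\<forall>i\<in>I. A i \<in> sets borel) \<longrightarrow> disjoint_family_on A I \<longrightarrow>
        prob_space.indep_vars M (\<lambda>_. count_space UNIV) (\<lambda>i. pcount \<kappa> X (A i)) I)"

definition binomial_process :: "'w measure \<Rightarrow> ('w \<Rightarrow> enat) \<Rightarrow> ('w \<Rightarrow> nat \<Rightarrow> 'a::topological_space) \<Rightarrow> nat \<Rightarrow> 'a measure \<Rightarrow> bool" where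
  "binomial_process M \<kappa> X n Q \<longleftrightarrow> point_process M \<kappa> X \<and>
     (\<forall>\<omega>\<in>space M. \<kappa> \<omega> = enat n) \<and>
     prob_space.indep_vars M (\<lambda>_. Q) (\<lambda>i \<omega>. X \<omega> i) {..<n} \<and>
     (\<forall>i<n. distr M Q (\<lambda>\<omega>. X \<omega> i) = Q)"

definition hit_tuples :: "nat \<Rightarrow> ((nat \<Rightarrow> 'a) \<Rightarrow> 'b) \<Rightarrow> 'b set \<Rightarrow> ('w \<Rightarrow> enat) \<Rightarrow> ('w \<Rightarrow> nat \<Rightarrow> 'a) \<Rightarrow> 'w \<Rightarrow> (nat \<Rightarrow> nat) set" where
  "hit_tuples k f B \<kappa> X \<omega> =
     {i \<in> {..<k} \<rightarrow>\<^sub>E {j. enat j < \<kappa> \<omega>}. inj_on i {..<k} \<and> f (\<lambda>j\<in>{..<k}. X \<omega> (i j)) \<in> B}"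

definition Sstat :: "nat \<Rightarrow> ((nat \<Rightarrow> 'a) \<Rightarrow> 'b) \<Rightarrow> 'b set \<Rightarrow> ('w \<Rightarrow> enat) \<Rightarrow> ('w \<Rightarrow> nat \<Rightarrow> 'a) \<Rightarrow> 'w \<Rightarrow> ennreal" where
  "Sstat k f B \<kappa> X \<omega> =
     (if finite (hit_tuples k f B \<kappa> X \<omega>) then ennreal (real (card (hit_tuples k f B \<kappa> X \<omega>)) / fact k)
      else \<infinity>)"

text \<open>Real-valued version (finite a.s. under a finite second moment).\<close>
definition Sreal :: "nat \<Rightarrow> ((nat \<Rightarrow> 'a) \<Rightarrow> 'b) \<Rightarrow> 'b set \<Rightarrow> ('w \<Rightarrow> enat) \<Rightarrow> ('w \<Rightarrow> nat \<Rightarrow> 'a) \<Rightarrow> 'w \<Rightarrow> real" where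
  "Sreal k f B \<kappa> X \<omega> = enn2real (Sstat k f B \<kappa> X \<omega>)"

definition dW :: "real measure \<Rightarrow> real measure \<Rightarrow> ereal" where
  "dW P Q = (SUP h \<in> {h. 1-lipschitz_on UNIV h}. ereal \<bar>integral\<^sup>L P h - integral\<^sup>L Q h\<bar>)"

definition symmetric_map :: "nat \<Rightarrow> ((nat \<Rightarrow> 'a) \<Rightarrow> 'b) \<Rightarrow> bool" where
  "symmetric_map k f \<longleftrightarrow> (\<forall>x \<in> {..<k} \<rightarrow>\<^sub>E UNIV. \<forall>\<sigma>. \<sigma> permutes {..<k} \<longrightarrow>
      f (\<lambda>j\<in>{..<k}. x (\<sigma> j)) = f x)"

definition join_tuple :: "nat \<Rightarrow> nat \<Rightarrow> (nat \<Rightarrow> 'a) \<Rightarrow> (nat \<Rightarrow> 'a) \<Rightarrow> nat \<Rightarrow> 'a" where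
  "join_tuple k l x y = (\<lambda>j\<in>{..<k}. if j < l then x j else y (j - l))"

definition r_term :: "nat \<Rightarrow> ((nat \<Rightarrow> 'a) \<Rightarrow> 'b::topological_space) \<Rightarrow> 'b set \<Rightarrow> 'a measure \<Rightarrow> ennreal" where
  "r_term k f B L = (if k = 1 then 0 else
     Max ((\<lambda>l. \<integral>\<^sup>+ x. (\<integral>\<^sup>+ y. indicator B (f (join_tuple k l x y)) \<partial>(PiM {..<k-l} (\<lambda>_. L)))\<^sup>2
                    \<partial>(PiM {..<l} (\<lambda>_. L))) ` {1..k-1}))"

definition ffact_ratio :: "nat \<Rightarrow> nat \<Rightarrow> real" where
  "ffact_ratio n k = (if n < k then 0 else
     (\<Prod>i<k. real (n - k - i)) / (\<Prod>i<k. real (n - i)))"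

end

theory Submission
  imports Defs
begin

text \<open>
  Let \<open>m = E S\<close>. Stein's equation \<open>lam g(n+1) - n g(n) = h(n) - E h(Z)\<close> has a solution with
  \<open>|g| \<le> 1\<close> for 1-Lipschitz \<open>h\<close>, so everything reduces to bounding
  \<open>|E[S \<phi>(S)] - m E[\<phi>(S+1)]|\<close> for \<open>0 \<le> \<phi> \<le> 2\<close>. By exchangeability \<open>E[S \<phi>(S)]\<close> is an
  integral over hitting tuples \<open>x\<close> of \<open>\<phi>\<close> at the value of \<open>S\<close> after the points \<open>x\<close> have been added. That
  value is at least one plus \<open>S\<close> of the remaining points, and \<open>|\<phi>(i) - \<phi>(j)| \<le> 2 |i - j|\<close>, so the
  error is at most twice an expected difference of counts, which is computed by inserting
  \<open>\<phi> = id\<close> and gives the second-moment bound. Expanding \<open>E S\<^sup>2\<close> over pairs of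
  \<open>k\<close>-sets according to their overlap yields the bound by \<open>r_term\<close>.

  The Poisson case is reduced to fixed numbers of points: on a set of finite intensity, the process
  conditioned on its number of points is determined by factorial moments of independent Poisson
  counts (its Janossy measures), and general intensities follow by exhaustion.
\<close>

section \<open>Stein's method for the Poisson distribution\<close>

text \<open>A Poisson process is given through its counts on disjoint sets; nothing is known about
  the order in which \<open>X\<close> lists its points. Hence the sums over all injective index
  tuples: they forget the order, and on cells they are polynomials in the counts. Hits are sets of
  indices rather than of points, so coinciding points cause no trouble.

  The shift \<phi> = g + 1 makes \<phi> nonnegative, so that comparisons run in
  \<open>ennreal\<close> without integrability conditions. Its range has length 2, which is the
  factor 2 in front of the second-moment term; 2^k / k! comes from a binomial row sum over the
  overlaps.

  The two cases differ in the points left after removing a hit. The Poisson weights e^(-c) / n!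
  shift, so the rest has the full law again and (E S)^2 is subtracted exactly. Of n points only n -
  k remain: their mean count is \<rho> m with \<rho> = \<open>ffact_ratio n k\<close>, and refilling
  them to n points costs 2 m (m - \<rho> m), which is the summand with 6^k k! / t.\<close>

lemma integrable_poisson_real:
  assumes "0 < c"
  shows "integrable (measure_pmf (poisson_pmf c)) real" 
    and "measure_pmf.expectation (poisson_pmf c) real = c"
proof -
  let ?f = "\<lambda>n. pmf (poisson_pmf c) n * real n"
  have s1: "(\<lambda>n. c ^ n / fact n) sums exp c"
    using exp_converges[of c] by (simp add: scaleR_conv_of_real divide_inverse mult.commute)
  have Suc: "?f (Suc n) = c * exp (-c) * (c ^ n / fact n)" for n
    using assms by (simp add: field_simps del: of_nat_Suc)
  have "(\<lambda>n. ?f (Suc n)) sums (c * exp (-c) * exp c)"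
    unfolding Suc by (rule sums_mult[OF s1])
  moreover have "c * exp (-c) * exp c = c" by (simp add: exp_minus)
  ultimately have "(\<lambda>n. ?f (Suc n)) sums c" by (simp only:)
  then have sums: "?f sums c" using sums_Suc_iff[of ?f c] by simp
  have nn: "\<And>n. 0 \<le> ?f n" using assms by simp
  have i: "integrable (count_space UNIV) ?f"
    by (rule integrable_count_space_nat_iff[THEN iffD2]) (use sums nn in \<open>simp add: sums_iff\<close>)
  then show "integrable (measure_pmf (poisson_pmf c)) real"
    by (simp add: measure_pmf_eq_density integrable_density)
  show "measure_pmf.expectation (poisson_pmf c) real = c"
    using sums i by (simp add: measure_pmf_eq_density integral_density integral_count_space_nat sums_iff)
qed

lemma integrable_poisson_lipschitz:
  assumes "0 < c" and h: "\<And>i j. \<bar>h i - h j\<bar> \<le> \<bar>real i - real j\<bar>"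
  shows "integrable (measure_pmf (poisson_pmf c)) h"
proof (rule Bochner_Integration.integrable_bound)
  show "integrable (measure_pmf (poisson_pmf c)) (\<lambda>n. \<bar>h 0\<bar> + real n)"
    using integrable_poisson_real[OF assms(1)] by simp
  show "AE n in measure_pmf (poisson_pmf c). norm (h n) \<le> norm (\<bar>h 0\<bar> + real n)"
  proof (intro AE_I2)
    fix n show "norm (h n) \<le> norm (\<bar>h 0\<bar> + real n)" using h[of n 0] by simp
  qed
qed simp

text \<open>Covariance of \<open>1(Z \<le> n)\<close> and a nondecreasing function of \<open>Z\<close> is nonpositive.\<close>
lemma truncated_mean_le:
  fixes p :: "nat pmf" and w :: "nat \<Rightarrow> real"
  assumes w: "mono w" and i: "integrable (measure_pmf p) w"
  shows "(\<Sum>i\<le>n. pmf p i * (w i - measure_pmf.expectation p w)) \<le> 0"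
proof -
  let ?m = "measure_pmf.expectation p w"
  let ?v = "\<lambda>i. w i - ?m"
  have iv: "integrable (measure_pmf p) ?v" using i by simp
  have z: "measure_pmf.expectation p ?v = 0" using i by simp
  have S: "(\<Sum>i\<le>n. pmf p i * ?v i) = measure_pmf.expectation p (\<lambda>i. indicator {..n} i * ?v i)"
    by (subst integral_measure_pmf_real[of "{..n}"]) (auto simp: indicator_def mult.commute split: if_splits)
  show ?thesis
  \<comment> \<open>If \<open>w n\<close> is below the mean, every summand is nonpositive. Otherwise
    the omitted terms i > n are all positive, so the partial sum is at most the full sum, which is
    0.\<close>
  proof (cases "w n \<le> ?m")
    case True
    then show ?thesis
      using monoD[OF w] by (intro sum_nonpos mult_nonneg_nonpos) (auto intro: order_trans)
  next
    case False
    have "measure_pmf.expectation p (\<lambda>i. indicator {..n} i * ?v i) \<le> measure_pmf.expectation p ?v"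
    proof (rule integral_mono[OF _ iv])
      show "integrable (measure_pmf p) (\<lambda>i. indicator {..n} i * ?v i)"
        using integrable_mult_indicator[of "{..n}" "measure_pmf p" ?v] iv by simp
      fix i show "indicator {..n} i * ?v i \<le> ?v i"
        using False monoD[OF w, of n i] by (cases "i \<le> n") auto
    qed
    then show ?thesis using S z by simp
  qed
qed

text \<open>Applying the previous lemma to \<open>id \<plusminus> h\<close> reduces the bound to the explicit case \<open>h = id\<close>.\<close>
lemma poisson_stein_solution:
  fixes h :: "nat \<Rightarrow> real"
  assumes c: "0 < c" and h: "\<And>i j. \<bar>h i - h j\<bar> \<le> \<bar>real i - real j\<bar>"
  obtains g where "\<And>n. \<bar>g n\<bar> \<le> 1"
    and "\<And>n. c * g (Suc n) - real n * g n = h n - measure_pmf.expectation (poisson_pmf c) h"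
proof -
  let ?p = "poisson_pmf c"
  let ?q = "pmf ?p"
  let ?E = "measure_pmf.expectation ?p"
  have q0: "0 < ?q n" for n using c by simp
  have qS: "real (Suc n) * ?q (Suc n) = c * ?q n" for n
    using c by (simp add: field_simps del: of_nat_Suc)
  have ih: "integrable (measure_pmf ?p) h" by (rule integrable_poisson_lipschitz[OF c h])
  note ir = integrable_poisson_real[OF c]
  \<comment> \<open>The explicit case: the sum telescopes by the recursion \<open>qS\<close> of the
    Poisson weights, and its value -c q(n) is what makes the bound on g exactly 1.\<close>
  have idsum: "(\<Sum>i\<le>n. ?q i * (real i - c)) = - c * ?q n" for n
  proof (induction n)
    case (Suc n)
    have "(\<Sum>i\<le>Suc n. ?q i * (real i - c)) = - c * ?q n + ?q (Suc n) * (real (Suc n) - c)"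
      using Suc by simp
    also have "\<dots> = - c * ?q (Suc n)" using qS[of n] by (simp add: algebra_simps)
    finally show ?case .
  qed simp
  \<comment> \<open>Multiplying Stein's equation by the weights q(i) and summing over i \<le> n
    telescopes the left side to c q(n) g(n+1); so this sum must equal c q(n) g(n+1).\<close>
  define R where "R n = (\<Sum>i\<le>n. ?q i * (h i - ?E h))" for n
  have R1: "R n \<le> c * ?q n" for n
  proof -
    have "(\<Sum>i\<le>n. ?q i * ((real i + h i) - ?E (\<lambda>i. real i + h i))) \<le> 0"
    proof (rule truncated_mean_le)
      show "mono (\<lambda>i. real i + h i)"
        using h by (intro monoI) (smt (verit) of_nat_le_iff)
    qed (use ih ir in simp)
    moreover have "?E (\<lambda>i. real i + h i) = c + ?E h" using ih ir by simp
    moreover have "(\<Sum>i\<le>n. ?q i * ((real i + h i) - (c + ?E h))) = (\<Sum>i\<le>n. ?q i * (real i - c)) + R n"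
      unfolding R_def sum.distrib[symmetric] by (rule sum.cong) (simp_all add: algebra_simps del: pmf_poisson)
    ultimately show ?thesis using idsum[of n] by simp
  qed
  have R2: "- R n \<le> c * ?q n" for n
  proof -
    have "(\<Sum>i\<le>n. ?q i * ((real i - h i) - ?E (\<lambda>i. real i - h i))) \<le> 0"
    proof (rule truncated_mean_le)
      show "mono (\<lambda>i. real i - h i)"
        using h by (intro monoI) (smt (verit) of_nat_le_iff)
    qed (use ih ir in simp)
    moreover have "?E (\<lambda>i. real i - h i) = c - ?E h" using ih ir by simp
    moreover have "(\<Sum>i\<le>n. ?q i * ((real i - h i) - (c - ?E h))) = (\<Sum>i\<le>n. ?q i * (real i - c)) - R n"
      unfolding R_def sum_subtractf[symmetric] by (rule sum.cong) (simp_all add: algebra_simps del: pmf_poisson)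
    ultimately show ?thesis using idsum[of n] by simp
  qed
  \<comment> \<open>The equation at n = 0 multiplies g(0) by 0, so g(0) is free; the value 0
    respects the bound.\<close>
  define g where "g n = (case n of 0 \<Rightarrow> 0 | Suc m \<Rightarrow> R m / (c * ?q m))" for n
  show thesis
  proof
    show "\<bar>g n\<bar> \<le> 1" for n
    proof (cases n)
      case (Suc m)
      have pos: "0 < c * ?q m" using c q0[of m] by (simp del: pmf_poisson)
      have "\<bar>R m\<bar> \<le> c * ?q m" using R1[of m] R2[of m] by linarith
      then show ?thesis using Suc pos
        by (simp add: g_def abs_divide divide_le_eq_1 del: pmf_poisson)
    qed (simp add: g_def)
    show "c * g (Suc n) - real n * g n = h n - ?E h" for n
    proof (cases n)
      case 0
      then show ?thesis using c q0[of 0] by (simp add: g_def R_def)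
    next
      case (Suc m)
      have a: "c * g (Suc n) = R n / ?q n" using c by (simp add: g_def del: pmf_poisson)
      have b: "real n * g n = R m / ?q n"
        using qS[of m] q0[of m] q0[of n] c Suc
        by (simp add: g_def field_simps del: pmf_poisson of_nat_Suc)
      have "R n = R m + ?q n * (h n - ?E h)" by (simp add: R_def Suc)
      then show ?thesis unfolding a b using q0[of n] by (simp add: field_simps del: pmf_poisson)
    qed
  qed
qed

text \<open>Stein's equation is used with parameter \<open>lam\<close> rather than \<open>E s\<close>; since \<open>|g| \<le> 1\<close> this costs
  \<open>|E s - lam|\<close>, and \<open>\<phi> = g + 1\<close> may replace \<open>g\<close> because both sides of the hypothesis agree on constants.\<close>
lemma (in prob_space) stein_bound:
  fixes s :: "'a \<Rightarrow> nat" and h :: "nat \<Rightarrow> real" and lam D :: real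
  assumes s[measurable]: "s \<in> M \<rightarrow>\<^sub>M count_space UNIV"
    and int_s: "integrable M (\<lambda>\<omega>. real (s \<omega>))"
    and D: "\<And>\<phi>. (\<And>n. 0 \<le> \<phi> n) \<Longrightarrow> (\<And>n. \<phi> n \<le> 2) \<Longrightarrow>
      \<bar>expectation (\<lambda>\<omega>. real (s \<omega>) * \<phi> (s \<omega>)) - expectation (\<lambda>\<omega>. real (s \<omega>)) * expectation (\<lambda>\<omega>. \<phi> (Suc (s \<omega>)))\<bar> \<le> D"
    and h: "\<And>i j. \<bar>h i - h j\<bar> \<le> \<bar>real i - real j\<bar>" and lam: "0 \<le> lam"
  shows "\<bar>expectation (\<lambda>\<omega>. h (s \<omega>)) - measure_pmf.expectation (po lam) h\<bar>
    \<le> \<bar>expectation (\<lambda>\<omega>. real (s \<omega>)) - lam\<bar> + D"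
proof -
  let ?m = "expectation (\<lambda>\<omega>. real (s \<omega>))"
  have ih: "integrable M (\<lambda>\<omega>. h (s \<omega>))"
  proof (rule Bochner_Integration.integrable_bound)
    show "integrable M (\<lambda>\<omega>. \<bar>h 0\<bar> + real (s \<omega>))" using int_s by simp
    show "AE \<omega> in M. norm (h (s \<omega>)) \<le> norm (\<bar>h 0\<bar> + real (s \<omega>))"
    proof (intro AE_I2)
      fix \<omega> show "norm (h (s \<omega>)) \<le> norm (\<bar>h 0\<bar> + real (s \<omega>))" using h[of "s \<omega>" 0] by simp
    qed
  qed simp
  show ?thesis
  \<comment> \<open>For mean 0 the law \<open>po 0\<close> is a point mass at 0 and dividing by
    \<open>lam\<close> is impossible; there |h(s) - h(0)| \<le> s suffices.\<close>
  proof (cases "lam = 0")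
    case True
    have D0: "0 \<le> D" using D[of "\<lambda>_. 0"] by simp
    have m0: "0 \<le> ?m" by simp
    have "\<bar>expectation (\<lambda>\<omega>. h (s \<omega>) - h 0)\<bar> \<le> expectation (\<lambda>\<omega>. \<bar>h (s \<omega>) - h 0\<bar>)"
      by (rule integral_abs_bound)
    also have "\<dots> \<le> ?m"
    proof (rule integral_mono)
      fix \<omega> show "\<bar>h (s \<omega>) - h 0\<bar> \<le> real (s \<omega>)" using h[of "s \<omega>" 0] by simp
    qed (use ih int_s in auto)
    finally have "\<bar>expectation (\<lambda>\<omega>. h (s \<omega>)) - h 0\<bar> \<le> ?m" using ih by (simp add: prob_space)
    then show ?thesis using True D0 m0 by (simp add: po_def)
  next
    case False
    then have lam': "0 < lam" using lam by simp
    obtain g where g: "\<And>n. \<bar>g n\<bar> \<le> 1"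
      and eq: "\<And>n. lam * g (Suc n) - real n * g n = h n - measure_pmf.expectation (poisson_pmf lam) h"
      using poisson_stein_solution[OF lam' h] by blast
    have ig: "integrable M (\<lambda>\<omega>. g (Suc (s \<omega>)))"
      by (rule integrable_const_bound[where B=1]) (use g in auto)
    have isg: "integrable M (\<lambda>\<omega>. real (s \<omega>) * g (s \<omega>))"
    proof (rule Bochner_Integration.integrable_bound[OF int_s])
      show "AE \<omega> in M. norm (real (s \<omega>) * g (s \<omega>)) \<le> norm (real (s \<omega>))"
        using g by (intro AE_I2) (simp add: abs_mult mult_left_le)
    qed simp
    let ?A = "expectation (\<lambda>\<omega>. g (Suc (s \<omega>)))"
    let ?C = "expectation (\<lambda>\<omega>. real (s \<omega>) * g (s \<omega>))"
    have A: "\<bar>?A\<bar> \<le> 1"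
    proof -
      have "\<bar>?A\<bar> \<le> expectation (\<lambda>\<omega>. \<bar>g (Suc (s \<omega>))\<bar>)" by (rule integral_abs_bound)
      also have "\<dots> \<le> expectation (\<lambda>_. 1)" by (rule integral_mono) (use ig g in auto)
      finally show ?thesis by (simp add: prob_space)
    qed
    have D': "\<bar>?C - ?m * ?A\<bar> \<le> D"
    proof -
      have "\<bar>expectation (\<lambda>\<omega>. real (s \<omega>) * (g (s \<omega>) + 1)) - ?m * expectation (\<lambda>\<omega>. g (Suc (s \<omega>)) + 1)\<bar> \<le> D"
        by (rule D[of "\<lambda>n. g n + 1"]) (use g in \<open>smt (verit)\<close>)+
      moreover have "expectation (\<lambda>\<omega>. real (s \<omega>) * (g (s \<omega>) + 1)) = ?C + ?m"
        using isg int_s by (simp add: distrib_left)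
      moreover have "expectation (\<lambda>\<omega>. g (Suc (s \<omega>)) + 1) = ?A + 1"
        using ig by (simp add: prob_space)
      ultimately show ?thesis by (simp add: algebra_simps)
    qed
    have "expectation (\<lambda>\<omega>. h (s \<omega>)) - measure_pmf.expectation (poisson_pmf lam) h
        = expectation (\<lambda>\<omega>. h (s \<omega>) - measure_pmf.expectation (poisson_pmf lam) h)"
      using ih by (simp add: prob_space)
    also have "\<dots> = expectation (\<lambda>\<omega>. lam * g (Suc (s \<omega>)) - real (s \<omega>) * g (s \<omega>))"
      by (simp add: eq)
    also have "\<dots> = lam * ?A - ?C" using ig isg by simp
    finally have "\<bar>expectation (\<lambda>\<omega>. h (s \<omega>)) - measure_pmf.expectation (poisson_pmf lam) h\<bar>
        = \<bar>(lam - ?m) * ?A - (?C - ?m * ?A)\<bar>" by (simp add: algebra_simps)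
    also have "\<dots> \<le> \<bar>(lam - ?m) * ?A\<bar> + \<bar>?C - ?m * ?A\<bar>" by (rule abs_triangle_ineq4)
    also have "\<bar>(lam - ?m) * ?A\<bar> \<le> \<bar>?m - lam\<bar>"
      using A by (simp add: abs_mult mult_left_le abs_minus_commute)
    finally show ?thesis using D' False by (simp add: po_def)
  qed
qed

section \<open>Counting hits\<close>

definition sym_set :: "nat \<Rightarrow> (nat \<Rightarrow> 'a) set \<Rightarrow> bool" where
  "sym_set k H \<longleftrightarrow> (\<forall>x \<sigma>. \<sigma> permutes {..<k} \<longrightarrow> (\<lambda>j\<in>{..<k}. x j) \<in> H \<longrightarrow> (\<lambda>j\<in>{..<k}. x (\<sigma> j)) \<in> H)"

text \<open>Attached to a set of indices, not to a tuple: the k! orderings of a tuple are merged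
  here, which absorbs the factor 1/k! of the statistic.\<close>

definition hit :: "nat \<Rightarrow> (nat \<Rightarrow> 'a) set \<Rightarrow> ('i \<Rightarrow> 'a) \<Rightarrow> 'i set \<Rightarrow> bool" where
  "hit k H x a \<longleftrightarrow> (\<exists>e. bij_betw e {..<k} a \<and> (\<lambda>j\<in>{..<k}. x (e j)) \<in> H)"

definition hits :: "nat \<Rightarrow> (nat \<Rightarrow> 'a) set \<Rightarrow> 'i set \<Rightarrow> ('i \<Rightarrow> 'a) \<Rightarrow> 'i set set" where
  "hits k H P x = {a. a \<subseteq> P \<and> hit k H x a}"

text \<open>\<open>P\<close> may be infinite. With infinitely many hits the value is 0, in agreement
  with \<open>enn2real \<infinity> = 0\<close> in \<open>Sreal\<close>.\<close>

definition ucount :: "nat \<Rightarrow> (nat \<Rightarrow> 'a) set \<Rightarrow> 'i set \<Rightarrow> ('i \<Rightarrow> 'a) \<Rightarrow> nat" where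
  "ucount k H P x = card (hits k H P x)"

text \<open>Two enumerations of the same set differ by a permutation of the positions, here the
  inverse of \<open>e'\<close> after \<open>e\<close>, extended by the identity. So the existential
  in \<open>hit\<close> may be read off along any fixed enumeration.\<close>

lemma hit_iff:
  assumes "sym_set k H" and e: "bij_betw e {..<k} a"
  shows "hit k H x a \<longleftrightarrow> (\<lambda>j\<in>{..<k}. x (e j)) \<in> H"
proof
  assume "hit k H x a"
  then obtain e' where e': "bij_betw e' {..<k} a" "(\<lambda>j\<in>{..<k}. x (e' j)) \<in> H"
    unfolding hit_def by blast
  define \<sigma> where "\<sigma> j = (if j < k then inv_into {..<k} e' (e j) else j)" for j
  have b: "bij_betw (inv_into {..<k} e' \<circ> e) {..<k} {..<k}"
    by (rule bij_betw_trans[OF e bij_betw_inv_into[OF e'(1)]])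
  have "bij_betw \<sigma> {..<k} {..<k}"
    by (rule bij_betw_cong[THEN iffD1, OF _ b]) (simp add: \<sigma>_def)
  then have "\<sigma> permutes {..<k}" by (rule bij_imp_permutes) (simp add: \<sigma>_def)
  then have "(\<lambda>j\<in>{..<k}. x (e' (\<sigma> j))) \<in> H"
    using assms(1)[unfolded sym_set_def, rule_format, of \<sigma> "\<lambda>j. x (e' j)"] e'(2) by simp
  moreover have "e' (\<sigma> j) = e j" if "j < k" for j
  proof -
    have "e j \<in> e' ` {..<k}" using that e e'(1) by (auto simp: bij_betw_def)
    then show ?thesis using that by (simp add: \<sigma>_def f_inv_into_f)
  qed
  ultimately show "(\<lambda>j\<in>{..<k}. x (e j)) \<in> H" by (simp cong: restrict_cong)
qed (use e in \<open>auto simp: hit_def\<close>)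

lemma hit_card: "hit k H x a \<Longrightarrow> card a = k"
  unfolding hit_def using bij_betw_same_card by fastforce

lemma hit_finite: "hit k H x a \<Longrightarrow> finite a"
  unfolding hit_def using bij_betw_finite by blast

lemma hit_cong:
  assumes "\<And>i. i \<in> a \<Longrightarrow> x i = y i"
  shows "hit k H x a \<longleftrightarrow> hit k H y a"
proof -
  have "(\<lambda>j\<in>{..<k}. x (e j)) = (\<lambda>j\<in>{..<k}. y (e j))" if "bij_betw e {..<k} a" for e
    using that assms by (intro restrict_ext) (auto simp: bij_betw_def)
  then show ?thesis unfolding hit_def by metis
qed

lemma hit_image:
  assumes "inj_on i a"
  shows "hit k H (\<lambda>j. x (i j)) a \<longleftrightarrow> hit k H x (i ` a)"
proof
  assume "hit k H (\<lambda>j. x (i j)) a"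
  then obtain e where "bij_betw e {..<k} a" "(\<lambda>j\<in>{..<k}. x (i (e j))) \<in> H"
    unfolding hit_def by blast
  then show "hit k H x (i ` a)"
    unfolding hit_def using assms
    by (intro exI[of _ "i \<circ> e"]) (auto intro: bij_betw_trans simp: inj_on_imp_bij_betw)
next
  assume "hit k H x (i ` a)"
  then obtain e where e: "bij_betw e {..<k} (i ` a)" "(\<lambda>j\<in>{..<k}. x (e j)) \<in> H"
    unfolding hit_def by blast
  have "bij_betw (inv_into a i \<circ> e) {..<k} a"
    using e(1) assms by (intro bij_betw_trans[OF e(1)] bij_betw_inv_into) (simp add: inj_on_imp_bij_betw)
  moreover have "i (inv_into a i (e j)) = e j" if "j < k" for j
    using that e(1) by (intro f_inv_into_f) (auto simp: bij_betw_def)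
  ultimately show "hit k H (\<lambda>j. x (i j)) a"
    unfolding hit_def using e(2) by (intro exI[of _ "inv_into a i \<circ> e"]) (simp cong: restrict_cong)
qed

lemma finite_hits: "finite P \<Longrightarrow> finite (hits k H P x)"
  unfolding hits_def by (rule finite_subset[of _ "Pow P"]) auto

lemma ucount_cong: "(\<And>i. i \<in> P \<Longrightarrow> x i = y i) \<Longrightarrow> ucount k H P x = ucount k H P y"
  unfolding ucount_def hits_def
  by (intro arg_cong[where f=card] Collect_cong conj_cong hit_cong) auto

lemma ucount_image:
  assumes "inj_on i P"
  shows "ucount k H P (\<lambda>j. x (i j)) = ucount k H (i ` P) x"
proof -
  have "bij_betw ((`) i) (hits k H P (\<lambda>j. x (i j))) (hits k H (i ` P) x)"
    unfolding bij_betw_def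
  proof
    show "inj_on ((`) i) (hits k H P (\<lambda>j. x (i j)))"
      by (rule inj_on_subset[OF inj_on_image_Pow[OF assms]]) (auto simp: hits_def)
    show "(`) i ` hits k H P (\<lambda>j. x (i j)) = hits k H (i ` P) x"
    proof (intro equalityI subsetI)
      fix b assume "b \<in> hits k H (i ` P) x"
      then have "b \<subseteq> i ` P" "hit k H x b" by (auto simp: hits_def)
      then obtain a where a: "a \<subseteq> P" "b = i ` a" by (auto simp: subset_image_iff)
      then have "a \<in> hits k H P (\<lambda>j. x (i j))"
        using \<open>hit k H x b\<close> hit_image[OF inj_on_subset[OF assms a(1)], of k H x] by (simp add: hits_def)
      then show "b \<in> (`) i ` hits k H P (\<lambda>j. x (i j))" using a(2) by blast
    next
      fix b assume "b \<in> (`) i ` hits k H P (\<lambda>j. x (i j))"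
      then obtain a where "a \<subseteq> P" "b = i ` a" "hit k H (\<lambda>j. x (i j)) a" by (auto simp: hits_def)
      then show "b \<in> hits k H (i ` P) x"
        using hit_image[OF inj_on_subset[OF assms \<open>a \<subseteq> P\<close>]] by (auto simp: hits_def)
    qed
  qed
  then show ?thesis unfolding ucount_def by (rule bij_betw_same_card)
qed

text \<open>Writes the count as a finite sum of indicators, to be integrated term by term.
  Restricting to \<open>card a = k\<close> loses nothing, since other sets cannot be hits.\<close>

lemma ucount_eq_sum:
  assumes "finite P"
  shows "ucount k H P x = (\<Sum>a | a \<subseteq> P \<and> card a = k. of_bool (hit k H x a))"
proof -
  have "hits k H P x = {a \<in> {a. a \<subseteq> P \<and> card a = k}. hit k H x a}"
    by (auto simp: hits_def dest: hit_card)
  moreover have "finite {a. a \<subseteq> P \<and> card a = k}"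
    by (rule finite_subset[of _ "Pow P"]) (use assms in auto)
  ultimately show ?thesis by (simp add: ucount_def of_bool_def sum.If_cases Int_def)
qed

text \<open>The map from a tuple to its set of indices has as fibre over each hit all k!
  enumerations of that hit. This links ordered tuples, in which the statistic is defined, with
  hits.\<close>

lemma card_inj_tuples:
  fixes P :: "'i set" and x :: "'i \<Rightarrow> 'a"
  assumes sym: "sym_set k H"
  defines "T \<equiv> {i \<in> {..<k} \<rightarrow>\<^sub>E P. inj_on i {..<k} \<and> (\<lambda>j\<in>{..<k}. x (i j)) \<in> H}"
  shows "finite T \<longleftrightarrow> finite (hits k H P x)" and "card T = fact k * ucount k H P x"
proof -
  define F where "F a = {e \<in> {..<k} \<rightarrow>\<^sub>E a. inj_on e {..<k}}" for a :: "'i set"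
  have bijF: "bij_betw e {..<k} a" if "e \<in> F a" "finite a" "card a = k" for e a
  proof -
    have "e ` {..<k} \<subseteq> a" "inj_on e {..<k}" using that by (auto simp: F_def)
    then have "e ` {..<k} = a" using that by (intro card_subset_eq) (auto simp: card_image)
    with \<open>inj_on e {..<k}\<close> show ?thesis by (simp add: bij_betw_def)
  qed
  have cardF: "card (F a) = fact k" "finite (F a)" if "finite a" "card a = k" for a
  proof -
    have "card (F a) = (\<Prod>i = 0..<k. k - i)"
      unfolding F_def using card_inj_on_subset_funcset[of "{..<k}" a "{..<k}"] that by simp
    then show "card (F a) = fact k" by (simp add: fact_prod_rev)
    show "finite (F a)" unfolding F_def using that by (intro finite_subset[OF _ finite_PiE[of "{..<k}" "\<lambda>_. a"]]) auto
  qed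
  have hitsD: "finite a" "card a = k" "a \<subseteq> P" if "a \<in> hits k H P x" for a
    using that by (auto simp: hits_def dest: hit_card hit_finite)
  have T: "T = (\<Union>a\<in>hits k H P x. F a)"
  proof (intro equalityI subsetI)
    fix i assume i: "i \<in> T"
    then have "bij_betw i {..<k} (i ` {..<k})" by (simp add: T_def inj_on_imp_bij_betw)
    then have "i ` {..<k} \<in> hits k H P x" "i \<in> F (i ` {..<k})"
      using i by (auto simp: T_def hits_def hit_def F_def)
    then show "i \<in> (\<Union>a\<in>hits k H P x. F a)" by blast
  next
    fix i assume "i \<in> (\<Union>a\<in>hits k H P x. F a)"
    then obtain a where a: "a \<in> hits k H P x" "i \<in> F a" by blast
    then show "i \<in> T"
      using hit_iff[OF sym bijF[OF a(2)]] hitsD[OF a(1)] by (auto simp: T_def hits_def F_def)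
  qed
  show iff: "finite T \<longleftrightarrow> finite (hits k H P x)"
  proof
    assume "finite T"
    have "hits k H P x \<subseteq> (\<lambda>e. e ` {..<k}) ` T"
    proof
      fix a assume a: "a \<in> hits k H P x"
      have "card (F a) \<noteq> 0" using cardF(1)[OF hitsD(1,2)[OF a]] by simp
      then obtain e where "e \<in> F a" by (metis card.empty ex_in_conv)
      moreover from this have "e ` {..<k} = a"
        using bijF[OF _ hitsD(1,2)[OF a]] by (simp add: bij_betw_def)
      ultimately show "a \<in> (\<lambda>e. e ` {..<k}) ` T" using a unfolding T by blast
    qed
    then show "finite (hits k H P x)" using \<open>finite T\<close> by (meson finite_imageI finite_subset)
  next
    assume "finite (hits k H P x)"
    then show "finite T" unfolding T using cardF hitsD by auto
  qed
  show "card T = fact k * ucount k H P x"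
  proof (cases "finite T")
    case True
    have "card T = (\<Sum>a\<in>hits k H P x. card (F a))"
      unfolding T
    proof (rule card_UN_disjoint)
      show "\<forall>a\<in>hits k H P x. \<forall>b\<in>hits k H P x. a \<noteq> b \<longrightarrow> F a \<inter> F b = {}"
        using bijF hitsD by (metis (no_types, lifting) bij_betw_imp_surj_on disjoint_iff)
    qed (use True iff cardF hitsD in auto)
    also have "\<dots> = (\<Sum>a\<in>hits k H P x. fact k)"
      by (intro sum.cong cardF) (auto dest: hitsD)
    finally show ?thesis by (simp add: ucount_def)
  next
    case False
    then show ?thesis using iff by (simp add: ucount_def)
  qed
qed

text \<open>By symmetry one fixed enumeration decides the event; if no enumeration by
  \<open>{..<k}\<close> exists, the event is empty.\<close>

lemma measurable_hit:
  assumes sym: "sym_set k H" and H: "H \<in> sets (PiM {..<k} (\<lambda>_. N))"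
    and X: "\<And>i. i \<in> a \<Longrightarrow> (\<lambda>\<omega>. X \<omega> i) \<in> M \<rightarrow>\<^sub>M N"
  shows "Measurable.pred M (\<lambda>\<omega>. hit k H (X \<omega>) a)"
proof (cases "\<exists>e. bij_betw e {..<k} a")
  case True
  then obtain e where e: "bij_betw e {..<k} a" ..
  have [measurable]: "(\<lambda>\<omega>. \<lambda>j\<in>{..<k}. X \<omega> (e j)) \<in> M \<rightarrow>\<^sub>M PiM {..<k} (\<lambda>_. N)"
    using e by (intro measurable_restrict X) (auto simp: bij_betw_def)
  show ?thesis unfolding hit_iff[OF sym e] using H by measurable
next
  case False
  then show ?thesis by (simp add: hit_def)
qed

lemma measurable_ucount:
  assumes "finite P" and sym: "sym_set k H" and H: "H \<in> sets (PiM {..<k} (\<lambda>_. N))"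
    and X: "\<And>i. i \<in> P \<Longrightarrow> (\<lambda>\<omega>. X \<omega> i) \<in> M \<rightarrow>\<^sub>M N"
  shows "(\<lambda>\<omega>. ucount k H P (X \<omega>)) \<in> M \<rightarrow>\<^sub>M count_space UNIV"
proof -
  have "(\<lambda>\<omega>. of_bool (hit k H (X \<omega>) a) :: nat) \<in> M \<rightarrow>\<^sub>M count_space UNIV" if "a \<subseteq> P" for a
  proof -
    have [measurable]: "Measurable.pred M (\<lambda>\<omega>. hit k H (X \<omega>) a)"
      using that by (intro measurable_hit[OF sym H] X) auto
    show ?thesis unfolding of_bool_def by measurable
  qed
  then show ?thesis
    unfolding ucount_eq_sum[OF assms(1)] by (intro measurable_sum_nat) auto
qed

section \<open>Palm calculus for a fixed number of points\<close>

text \<open>Distinct integers differ by at least one, so twice their distance already exceeds the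
  range [0,2]. Both directions are stated additively to avoid subtraction in
  \<open>ennreal\<close>.\<close>

lemma bounded_by_two_close:
  fixes \<phi> :: "nat \<Rightarrow> ennreal"
  assumes \<phi>: "\<And>n. \<phi> n \<le> 2" and "j \<le> i"
  shows "\<phi> i \<le> \<phi> j + 2 * of_nat (i - j)" and "\<phi> j \<le> \<phi> i + 2 * of_nat (i - j)"
proof -
  have "\<phi> i \<le> \<phi> j + 2 * of_nat (i - j) \<and> \<phi> j \<le> \<phi> i + 2 * of_nat (i - j)"
  proof (cases "i = j")
    case False
    then have "of_nat 1 \<le> (of_nat (i - j) :: ennreal)" using assms(2) by (intro of_nat_mono) simp
    then have two: "2 \<le> 2 * (of_nat (i - j) :: ennreal)" using mult_left_mono[of "of_nat 1" "of_nat (i - j)" "2::ennreal"] by simp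
    show ?thesis
      using order_trans[OF order_trans[OF \<phi>[of i] two] add_increasing[OF zero_le order_refl]]
        order_trans[OF order_trans[OF \<phi>[of j] two] add_increasing[OF zero_le order_refl]] by blast
  qed simp
  then show "\<phi> i \<le> \<phi> j + 2 * of_nat (i - j)" "\<phi> j \<le> \<phi> i + 2 * of_nat (i - j)" by blast+
qed

lemma (in product_sigma_finite) nn_integral_indep:
  assumes IJ: "I \<inter> J = {}" "finite I" "finite J"
    and F[measurable]: "F \<in> borel_measurable (PiM I M)" and G[measurable]: "G \<in> borel_measurable (PiM J M)"
  shows "(\<integral>\<^sup>+x. F (restrict x I) * G (restrict x J) \<partial>PiM (I \<union> J) M) = (\<integral>\<^sup>+x. F x \<partial>PiM I M) * (\<integral>\<^sup>+x. G x \<partial>PiM J M)"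
proof -
  have "(\<integral>\<^sup>+x. F (restrict x I) * G (restrict x J) \<partial>PiM (I \<union> J) M)
    = (\<integral>\<^sup>+x. (\<integral>\<^sup>+y. F (restrict x I) * G (restrict y J) \<partial>PiM J M) \<partial>PiM I M)"
    using IJ(1) by (subst product_nn_integral_fold[OF IJ]) (auto simp: measurable_restrict_subset)
  also have "\<dots> = (\<integral>\<^sup>+x. (\<integral>\<^sup>+y. F x * G y \<partial>PiM J M) \<partial>PiM I M)"
    by (intro nn_integral_cong arg_cong2[where f="(*)"] arg_cong[where f=F] arg_cong[where f=G])
       (auto simp: space_PiM)
  also have "\<dots> = (\<integral>\<^sup>+x. F x * (\<integral>\<^sup>+y. G y \<partial>PiM J M) \<partial>PiM I M)"
    by (intro nn_integral_cong nn_integral_cmult G)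
  finally show ?thesis by (simp add: nn_integral_multc)
qed

text \<open>The relabelling map sends the product measure to a product measure, as seen on
  rectangles. For J = I this is exchangeability; for different index sets it moves a window of
  coordinates.\<close>

lemma (in sigma_finite_measure) nn_integral_PiM_reindex:
  assumes e: "bij_betw e J I" and J: "finite J"
    and F: "F \<in> borel_measurable (PiM J (\<lambda>_. M))"
  shows "(\<integral>\<^sup>+x. F (\<lambda>j\<in>J. x (e j)) \<partial>PiM I (\<lambda>_. M)) = (\<integral>\<^sup>+x. F x \<partial>PiM J (\<lambda>_. M))"
proof -
  interpret product_sigma_finite "\<lambda>_. M" ..
  have I: "finite I" using e J bij_betw_finite by blast
  have eI: "e j \<in> I" if "j \<in> J" for j using e that by (auto simp: bij_betw_def)
  let ?r = "\<lambda>x. \<lambda>j\<in>J. x (e j)"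
  have r: "?r \<in> PiM I (\<lambda>_. M) \<rightarrow>\<^sub>M PiM J (\<lambda>_. M)"
    by (intro measurable_restrict measurable_component_singleton eI)
  have "distr (PiM I (\<lambda>_. M)) (PiM J (\<lambda>_. M)) ?r = PiM J (\<lambda>_. M)"
  proof (rule PiM_eqI[OF J])
    fix A assume A: "\<And>j. j \<in> J \<Longrightarrow> A j \<in> sets M"
    let ?A = "\<lambda>i. A (inv_into J e i)"
    have inv: "inv_into J e (e j) = j" if "j \<in> J" for j
      using e that by (auto simp: bij_betw_def)
    have invJ: "inv_into J e i \<in> J" if "i \<in> I" for i
      using e that by (auto simp: bij_betw_def inv_into_into)
    have "?r -` PiE J A \<inter> space (PiM I (\<lambda>_. M)) = PiE I ?A"
    proof (intro equalityI subsetI)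
      fix x assume x: "x \<in> ?r -` PiE J A \<inter> space (PiM I (\<lambda>_. M))"
      have "x i \<in> ?A i" if "i \<in> I" for i
      proof -
        have "e (inv_into J e i) = i" using e that by (auto simp: bij_betw_def f_inv_into_f)
        moreover have "?r x (inv_into J e i) \<in> ?A i" using x invJ[OF that] by (intro PiE_mem[of _ J A]) auto
        ultimately show ?thesis using invJ[OF that] by simp
      qed
      then show "x \<in> PiE I ?A" using x by (auto simp: space_PiM)
    next
      fix x assume x: "x \<in> PiE I ?A"
      have "x i \<in> space M" if "i \<in> I" for i
        using x that A[OF invJ[OF that]] sets.sets_into_space by (auto dest: PiE_mem[of x I ?A i])
      moreover have "x (e j) \<in> A j" if "j \<in> J" for j
        using PiE_mem[OF x eI[OF that]] inv[OF that] by simp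
      ultimately show "x \<in> ?r -` PiE J A \<inter> space (PiM I (\<lambda>_. M))"
        using x by (auto simp: space_PiM PiE_iff)
    qed
    then have "emeasure (distr (PiM I (\<lambda>_. M)) (PiM J (\<lambda>_. M)) ?r) (PiE J A) = emeasure (PiM I (\<lambda>_. M)) (PiE I ?A)"
      using A J by (subst emeasure_distr[OF r]) (auto intro!: sets_PiM_I_finite)
    also have "\<dots> = (\<Prod>i\<in>I. emeasure M (?A i))"
      using I A invJ by (subst emeasure_PiM) auto
    also have "\<dots> = (\<Prod>j\<in>J. emeasure M (?A (e j)))"
      by (rule prod.reindex_bij_betw[OF e, symmetric])
    finally show "emeasure (distr (PiM I (\<lambda>_. M)) (PiM J (\<lambda>_. M)) ?r) (PiE J A) = (\<Prod>j\<in>J. emeasure M (A j))"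
      using inv by (simp cong: prod.cong)
  qed simp
  then show ?thesis using nn_integral_distr[OF r, of F] F by simp
qed

lemma measurable_of_bool_ennreal [measurable (raw)]:
  "Measurable.pred M P \<Longrightarrow> (\<lambda>x. of_bool (P x) :: ennreal) \<in> borel_measurable M"
  unfolding of_bool_def by measurable

lemma ex_bij_betw_image:
  assumes "finite S" "a \<subseteq> S" "b \<subseteq> S" "card a = card b"
  obtains \<sigma> where "bij_betw \<sigma> S S" "\<sigma> ` a = b"
proof -
  have fin: "finite a" "finite b" using assms finite_subset by auto
  obtain f where f: "bij_betw f a b" using finite_same_card_bij[OF fin assms(4)] by blast
  have "card (S - a) = card (S - b)" using assms fin by (simp add: card_Diff_subset)
  then obtain g where g: "bij_betw g (S - a) (S - b)"
    using finite_same_card_bij[of "S - a" "S - b"] assms(1) by blast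
  have "bij_betw (\<lambda>x. if x \<in> a then f x else g x) (a \<union> (S - a)) (b \<union> (S - b))"
    by (rule bij_betw_disjoint_Un[OF f g]) auto
  moreover have "a \<union> (S - a) = S" "b \<union> (S - b) = S" using assms by auto
  moreover have "(\<lambda>x. if x \<in> a then f x else g x) ` a = b" using f by (auto simp: bij_betw_def)
  ultimately show thesis using that by metis
qed

text \<open>The overlap integrals whose maximum over \<open>1 \<le> l < k\<close> is \<open>r_term\<close>.\<close>
definition overlap :: "nat \<Rightarrow> (nat \<Rightarrow> 'a) set \<Rightarrow> 'a measure \<Rightarrow> nat \<Rightarrow> ennreal" where
  "overlap k H L l = (\<integral>\<^sup>+x. (\<integral>\<^sup>+y. indicator H (join_tuple k l x y) \<partial>PiM {..<k-l} (\<lambda>_. L))\<^sup>2 \<partial>PiM {..<l} (\<lambda>_. L))"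

text \<open>The measure is finite but not normalised, so the same calculus serves an intensity
  measure restricted to a set of finite mass and the distribution of the points of a binomial
  process.\<close>

locale ustat = finite_measure L for L :: "'a measure" +
  fixes k :: nat and H :: "(nat \<Rightarrow> 'a) set"
  assumes k: "1 \<le> k" and sym: "sym_set k H" and H: "H \<in> sets (PiM {..<k} (\<lambda>_. L))"
begin

sublocale product_sigma_finite "\<lambda>_::nat. L" ..

abbreviation PL :: "nat set \<Rightarrow> (nat \<Rightarrow> 'a) measure" where "PL I \<equiv> PiM I (\<lambda>_. L)"

definition mass :: ennreal where "mass = emeasure L (space L)"

definition hitprob :: ennreal where "hitprob = emeasure (PL {..<k}) H"

text \<open>For a probability measure this is the expectation of \<psi>(S) with n points. For a
  restricted intensity of mass c it is, up to the factor e^(-c) / n!, the contribution of the event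
  that exactly n points fall into the set.\<close>

definition J :: "nat \<Rightarrow> (nat \<Rightarrow> ennreal) \<Rightarrow> ennreal" where
  "J n \<psi> = (\<integral>\<^sup>+x. \<psi> (ucount k H {..<n} x) \<partial>PL {..<n})"

lemma measurable_hit_PL [measurable]: "a \<subseteq> I \<Longrightarrow> Measurable.pred (PL I) (\<lambda>x. hit k H x a)"
  by (intro measurable_hit[OF sym H]) auto

lemma measurable_ucount_PL [measurable]:
  "finite P \<Longrightarrow> P \<subseteq> I \<Longrightarrow> (\<lambda>x. ucount k H P x) \<in> PL I \<rightarrow>\<^sub>M count_space UNIV"
  by (intro measurable_ucount[OF _ sym H]) auto

lemma nn_integral_PL_subset:
  assumes "I \<subseteq> K" "finite K" and F: "F \<in> borel_measurable (PL I)"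
  shows "(\<integral>\<^sup>+x. F (restrict x I) \<partial>PL K) = (\<integral>\<^sup>+x. F x \<partial>PL I) * mass ^ card (K - I)"
proof -
  have fin: "finite I" "finite (K - I)" using assms finite_subset by auto
  have "emeasure (PL (K - I)) (space (PL (K - I))) = mass ^ card (K - I)"
    unfolding mass_def space_PiM using fin by (subst emeasure_PiM) auto
  moreover have "I \<union> (K - I) = K" using assms by auto
  ultimately show ?thesis
    using nn_integral_indep[of I "K - I" F "\<lambda>_. 1"] fin F by simp
qed

lemma nn_integral_hit: "(\<integral>\<^sup>+x. of_bool (hit k H x {..<k}) \<partial>PL {..<k}) = hitprob"
proof -
  have "(\<integral>\<^sup>+x. of_bool (hit k H x {..<k}) \<partial>PL {..<k}) = (\<integral>\<^sup>+x. indicator H x \<partial>PL {..<k})"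
  proof (rule nn_integral_cong)
    fix x assume "x \<in> space (PL {..<k})"
    then have "restrict x {..<k} = x" by (simp add: space_PiM)
    then show "of_bool (hit k H x {..<k}) = (indicator H x :: ennreal)"
      using hit_iff[OF sym, of id "{..<k}" x] by (simp add: indicator_def of_bool_def)
  qed
  then show ?thesis using H by (simp add: hitprob_def)
qed

lemma nn_integral_ucount_image:
  fixes \<psi> :: "nat \<Rightarrow> ennreal"
  shows "(\<integral>\<^sup>+x. \<psi> (ucount k H {m..<m+n} x) \<partial>PL {m..<m+n}) = J n \<psi>"
proof -
  have b: "bij_betw (\<lambda>j. j + m) {..<n} {m..<m+n}"
    by (rule bij_betw_byWitness[where f'="\<lambda>j. j - m"]) auto
  have eq: "ucount k H {..<n} (\<lambda>j\<in>{..<n}. x (j + m)) = ucount k H {m..<m+n} x" for x :: "nat \<Rightarrow> 'a"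
  proof -
    have "ucount k H {..<n} (\<lambda>j\<in>{..<n}. x (j + m)) = ucount k H {..<n} (\<lambda>j. x (j + m))"
      by (rule ucount_cong) simp
    also have "\<dots> = ucount k H ((\<lambda>j. j + m) ` {..<n}) x" by (rule ucount_image) simp
    finally show ?thesis using b by (simp add: bij_betw_def)
  qed
  have "J n \<psi> = (\<integral>\<^sup>+x. \<psi> (ucount k H {..<n} (\<lambda>j\<in>{..<n}. x (j + m))) \<partial>PL {m..<m+n})"
    unfolding J_def by (rule nn_integral_PiM_reindex[OF b, symmetric]) auto
  then show ?thesis unfolding eq ..
qed

text \<open>The hit depends on the first k coordinates only and the count on the other n - k, so the
  integral factors; a count over a window of coordinates depends only on the length of the
  window.\<close>

lemma nn_integral_hit_indep:
  fixes \<psi> :: "nat \<Rightarrow> ennreal"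
  assumes "k \<le> n"
  shows "(\<integral>\<^sup>+x. of_bool (hit k H x {..<k}) * \<psi> (ucount k H {k..<n} x) \<partial>PL {..<n}) = hitprob * J (n - k) \<psi>"
proof -
  have un: "{..<k} \<union> {k..<n} = {..<n}" using assms by auto
  have "(\<integral>\<^sup>+x. of_bool (hit k H x {..<k}) * \<psi> (ucount k H {k..<n} x) \<partial>PL {..<n})
    = (\<integral>\<^sup>+x. of_bool (hit k H (restrict x {..<k}) {..<k}) * \<psi> (ucount k H {k..<n} (restrict x {k..<n})) \<partial>PL ({..<k} \<union> {k..<n}))"
    unfolding un
    by (intro nn_integral_cong arg_cong2[where f="(*)"] arg_cong[where f=of_bool] arg_cong[where f=\<psi>] hit_cong ucount_cong) auto
  also have "\<dots> = hitprob * (\<integral>\<^sup>+x. \<psi> (ucount k H {k..<n} x) \<partial>PL {k..<n})"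
    by (subst nn_integral_indep) (auto simp: nn_integral_hit)
  also have "(\<integral>\<^sup>+x. \<psi> (ucount k H {k..<n} x) \<partial>PL {k..<n}) = J (n - k) \<psi>"
    using nn_integral_ucount_image[where \<psi>=\<psi> and m=k and n="n - k"] assms by simp
  finally show ?thesis .
qed

text \<open>The factor s is expanded as a sum over k-subsets. A permutation of the coordinates
  carrying \<open>{..<k}\<close> to a given subset preserves both the measure and the total count,
  so all subsets contribute equally.\<close>

lemma nn_integral_ucount_mult:
  fixes \<phi> :: "nat \<Rightarrow> ennreal"
  shows "J n (\<lambda>s. of_nat s * \<phi> s)
    = of_nat (n choose k) * (\<integral>\<^sup>+x. of_bool (hit k H x {..<k}) * \<phi> (ucount k H {..<n} x) \<partial>PL {..<n})"
proof -
  let ?S = "{a. a \<subseteq> {..<n} \<and> card a = k}"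
  let ?T = "\<lambda>a. \<integral>\<^sup>+x. of_bool (hit k H x a) * \<phi> (ucount k H {..<n} x) \<partial>PL {..<n}"
  have T: "?T a = ?T {..<k}" if a: "a \<in> ?S" for a
  proof -
    have "k \<le> n" using a card_mono[of "{..<n}" a] by auto
    then obtain \<sigma> where \<sigma>: "bij_betw \<sigma> {..<n} {..<n}" "\<sigma> ` {..<k} = a"
      using ex_bij_betw_image[of "{..<n}" "{..<k}" a] a by auto
    have inj: "inj_on \<sigma> {..<n}" and img: "\<sigma> ` {..<n} = {..<n}" using \<sigma>(1) by (auto simp: bij_betw_def)
    have "?T {..<k} = (\<integral>\<^sup>+x. of_bool (hit k H (\<lambda>j\<in>{..<n}. x (\<sigma> j)) {..<k}) * \<phi> (ucount k H {..<n} (\<lambda>j\<in>{..<n}. x (\<sigma> j))) \<partial>PL {..<n})"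
      using \<open>k \<le> n\<close> by (intro nn_integral_PiM_reindex[OF \<sigma>(1), symmetric]) auto
    also have "\<dots> = ?T a"
    proof (intro nn_integral_cong arg_cong2[where f="(*)"] arg_cong[where f=of_bool] arg_cong[where f=\<phi>])
      fix x :: "nat \<Rightarrow> 'a"
      have "hit k H (\<lambda>j\<in>{..<n}. x (\<sigma> j)) {..<k} = hit k H (\<lambda>j. x (\<sigma> j)) {..<k}"
        using \<open>k \<le> n\<close> by (intro hit_cong) auto
      also have "\<dots> = hit k H x a"
        using hit_image[of \<sigma> "{..<k}" k H x] inj_on_subset[OF inj, of "{..<k}"] \<open>k \<le> n\<close> \<sigma>(2) by auto
      finally show "hit k H (\<lambda>j\<in>{..<n}. x (\<sigma> j)) {..<k} = hit k H x a" .
      have "ucount k H {..<n} (\<lambda>j\<in>{..<n}. x (\<sigma> j)) = ucount k H {..<n} (\<lambda>j. x (\<sigma> j))"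
        by (intro ucount_cong) auto
      also have "\<dots> = ucount k H {..<n} x" using ucount_image[OF inj, of k H x] img by simp
      finally show "ucount k H {..<n} (\<lambda>j\<in>{..<n}. x (\<sigma> j)) = ucount k H {..<n} x" .
    qed
    finally show ?thesis ..
  qed
  have finS: "finite ?S" by (rule finite_subset[of _ "Pow {..<n}"]) auto
  have "J n (\<lambda>s. of_nat s * \<phi> s) = (\<integral>\<^sup>+x. (\<Sum>a\<in>?S. of_bool (hit k H x a) * \<phi> (ucount k H {..<n} x)) \<partial>PL {..<n})"
    unfolding J_def
    by (intro nn_integral_cong) (simp add: ucount_eq_sum sum_distrib_right of_nat_of_bool)
  also have "\<dots> = (\<Sum>a\<in>?S. ?T a)" by (rule nn_integral_sum) auto
  also have "\<dots> = (\<Sum>a\<in>?S. ?T {..<k})" by (intro sum.cong T) auto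
  also have "\<dots> = of_nat (n choose k) * ?T {..<k}" using n_subsets[of "{..<n}" k] by simp
  finally show ?thesis .
qed

lemma ucount_hit_le:
  assumes "k \<le> n" "hit k H x {..<k}"
  shows "Suc (ucount k H {k..<n} x) \<le> ucount k H {..<n} x"
proof -
  \<comment> \<open>Here \<open>1 \<le> k\<close> enters: the empty set would be a subset of
    \<open>{k..<n}\<close> and thus already be counted there.\<close>
  have "0 \<in> {..<k}" "0 \<notin> {k..<n}" using k by auto
  then have "\<not> {..<k} \<subseteq> {k..<n}" by blast
  then have "{..<k} \<notin> hits k H {k..<n} x" by (simp add: hits_def)
  then have "Suc (ucount k H {k..<n} x) = card (insert {..<k} (hits k H {k..<n} x))"
    by (simp add: ucount_def finite_hits)
  also have "\<dots> \<le> ucount k H {..<n} x"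
    unfolding ucount_def using assms by (intro card_mono finite_hits) (auto simp: hits_def)
  finally show ?thesis .
qed

text \<open>The mass of additional tuples created by forcing the first \<open>k\<close> points to be a hit.\<close>
definition excess :: "nat \<Rightarrow> ennreal" where
  "excess n = of_nat (n choose k) * (\<integral>\<^sup>+x. of_bool (hit k H x {..<k}) *
     of_nat (ucount k H {..<n} x - Suc (ucount k H {k..<n} x)) \<partial>PL {..<n})"

text \<open>On the event that the first k points form a hit, \<open>Suc ?v\<close> is a lower bound
  for \<open>?s\<close>, and the two are exchanged inside \<phi> at a cost of twice their
  difference. For \<phi> = id the exchange is an identity, which later expresses
  \<open>excess\<close> through the first two moments.\<close>

lemma size_bias:
  fixes \<phi> :: "nat \<Rightarrow> ennreal"
  assumes \<phi>: "\<And>n. \<phi> n \<le> 2"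
  shows size_bias_le: "J n (\<lambda>s. of_nat s * \<phi> s) \<le> of_nat (n choose k) * (hitprob * J (n - k) (\<lambda>s. \<phi> (Suc s))) + 2 * excess n"
    and size_bias_ge: "of_nat (n choose k) * (hitprob * J (n - k) (\<lambda>s. \<phi> (Suc s))) \<le> J n (\<lambda>s. of_nat s * \<phi> s) + 2 * excess n"
    and size_bias_eq: "J n (\<lambda>s. of_nat s * of_nat s) = of_nat (n choose k) * (hitprob * J (n - k) (\<lambda>s. of_nat (Suc s))) + excess n"
proof -
  let ?c = "of_nat (n choose k) :: ennreal"
  let ?h = "\<lambda>x. of_bool (hit k H x {..<k}) :: ennreal"
  let ?s = "\<lambda>x. ucount k H {..<n} x" and ?v = "\<lambda>x. ucount k H {k..<n} x"
  have all: "J n (\<lambda>s. of_nat s * \<phi> s) \<le> ?c * (hitprob * J (n - k) (\<lambda>s. \<phi> (Suc s))) + 2 * excess n \<and>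
    ?c * (hitprob * J (n - k) (\<lambda>s. \<phi> (Suc s))) \<le> J n (\<lambda>s. of_nat s * \<phi> s) + 2 * excess n \<and>
    J n (\<lambda>s. of_nat s * of_nat s) = ?c * (hitprob * J (n - k) (\<lambda>s. of_nat (Suc s))) + excess n"
  \<comment> \<open>For n < k every term carries the factor \<open>n choose k\<close> = 0.\<close>
  proof (cases "k \<le> n")
    case False
    then have "n choose k = 0" by simp
    then have "of_nat (n choose k) = (0 :: ennreal)" by (simp only: of_nat_0)
    then show ?thesis unfolding nn_integral_ucount_mult excess_def by (simp only: mult_zero_left mult_zero_right add_0_left) simp
  next
    case True
    let ?A = "\<lambda>\<phi>. \<integral>\<^sup>+x. ?h x * \<phi> (?s x) \<partial>PL {..<n}"
    let ?B = "\<lambda>\<phi>. \<integral>\<^sup>+x. ?h x * \<phi> (Suc (?v x)) \<partial>PL {..<n}"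
    let ?D = "\<integral>\<^sup>+x. ?h x * of_nat (?s x - Suc (?v x)) \<partial>PL {..<n}"
    have [measurable]: "Measurable.pred (PL {..<n}) (\<lambda>x. hit k H x {..<k})"
      using True by (intro measurable_hit_PL) auto
    have [measurable]: "?s \<in> PL {..<n} \<rightarrow>\<^sub>M count_space UNIV" "?v \<in> PL {..<n} \<rightarrow>\<^sub>M count_space UNIV"
      by (intro measurable_ucount_PL; auto)+
    have B: "?B \<psi> = hitprob * J (n - k) (\<lambda>s. \<psi> (Suc s))" for \<psi> :: "nat \<Rightarrow> ennreal"
      using nn_integral_hit_indep[OF True, of "\<lambda>s. \<psi> (Suc s)"] by simp
    have p1: "?h x * \<phi> (?s x) \<le> ?h x * \<phi> (Suc (?v x)) + 2 * (?h x * of_nat (?s x - Suc (?v x)))" for x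
      using bounded_by_two_close[of \<phi>, OF \<phi> ucount_hit_le[OF True, of x]] by (cases "hit k H x {..<k}") (simp_all only: of_bool_eq mult_1_left mult_zero_left mult_zero_right add_0_left order_refl)
    have p2: "?h x * \<phi> (Suc (?v x)) \<le> ?h x * \<phi> (?s x) + 2 * (?h x * of_nat (?s x - Suc (?v x)))" for x
      using bounded_by_two_close[of \<phi>, OF \<phi> ucount_hit_le[OF True, of x]] by (cases "hit k H x {..<k}") (simp_all only: of_bool_eq mult_1_left mult_zero_left mult_zero_right add_0_left order_refl)
    have p3: "?h x * of_nat (?s x) = ?h x * of_nat (Suc (?v x)) + ?h x * of_nat (?s x - Suc (?v x))" for x
    proof (cases "hit k H x {..<k}")
      case hx: True
      have "of_nat (?s x) = (of_nat (Suc (?v x) + (?s x - Suc (?v x))) :: ennreal)"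
        using ucount_hit_le[OF True hx] by (intro arg_cong[where f=of_nat]) simp
      then show ?thesis using hx by (simp only: of_bool_eq mult_1_left of_nat_add)
    qed (simp only: of_bool_eq mult_zero_left add_0_left)
    have q1: "?A \<phi> \<le> ?B \<phi> + 2 * ?D"
    proof -
      have "?A \<phi> \<le> (\<integral>\<^sup>+x. ?h x * \<phi> (Suc (?v x)) + 2 * (?h x * of_nat (?s x - Suc (?v x))) \<partial>PL {..<n})"
        by (intro nn_integral_mono p1)
      also have "\<dots> = ?B \<phi> + (\<integral>\<^sup>+x. 2 * (?h x * of_nat (?s x - Suc (?v x))) \<partial>PL {..<n})"
        by (rule nn_integral_add) measurable
      also have "(\<integral>\<^sup>+x. 2 * (?h x * of_nat (?s x - Suc (?v x))) \<partial>PL {..<n}) = 2 * ?D"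
        by (rule nn_integral_cmult) measurable
      finally show ?thesis .
    qed
    have q2: "?B \<phi> \<le> ?A \<phi> + 2 * ?D"
    proof -
      have "?B \<phi> \<le> (\<integral>\<^sup>+x. ?h x * \<phi> (?s x) + 2 * (?h x * of_nat (?s x - Suc (?v x))) \<partial>PL {..<n})"
        by (intro nn_integral_mono p2)
      also have "\<dots> = ?A \<phi> + (\<integral>\<^sup>+x. 2 * (?h x * of_nat (?s x - Suc (?v x))) \<partial>PL {..<n})"
        by (rule nn_integral_add) measurable
      also have "(\<integral>\<^sup>+x. 2 * (?h x * of_nat (?s x - Suc (?v x))) \<partial>PL {..<n}) = 2 * ?D"
        by (rule nn_integral_cmult) measurable
      finally show ?thesis .
    qed
    have q3: "?A of_nat = ?B of_nat + ?D"
    proof -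
      have "?A of_nat = (\<integral>\<^sup>+x. ?h x * of_nat (Suc (?v x)) + ?h x * of_nat (?s x - Suc (?v x)) \<partial>PL {..<n})"
        by (intro nn_integral_cong p3)
      also have "\<dots> = ?B of_nat + ?D"
        by (rule nn_integral_add) measurable
      finally show ?thesis .
    qed
    show ?thesis
      unfolding nn_integral_ucount_mult excess_def B[symmetric]
    proof (intro conjI)
      show "?c * ?A \<phi> \<le> ?c * ?B \<phi> + 2 * (?c * ?D)"
        using mult_left_mono[OF q1, of ?c] by (simp only: distrib_left mult.left_commute zero_le simp_thms)
      show "?c * ?B \<phi> \<le> ?c * ?A \<phi> + 2 * (?c * ?D)"
        using mult_left_mono[OF q2, of ?c] by (simp only: distrib_left mult.left_commute zero_le simp_thms)
      show "?c * ?A of_nat = ?c * ?B of_nat + ?c * ?D"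
        unfolding q3 by (rule distrib_left)
    qed
  qed
  then show "J n (\<lambda>s. of_nat s * \<phi> s) \<le> ?c * (hitprob * J (n - k) (\<lambda>s. \<phi> (Suc s))) + 2 * excess n"
    "?c * (hitprob * J (n - k) (\<lambda>s. \<phi> (Suc s))) \<le> J n (\<lambda>s. of_nat s * \<phi> s) + 2 * excess n"
    "J n (\<lambda>s. of_nat s * of_nat s) = ?c * (hitprob * J (n - k) (\<lambda>s. of_nat (Suc s))) + excess n" by blast+
qed

end

section \<open>Second moments\<close>

context ustat begin

lemma J_const: "J n (\<lambda>_. c) = c * mass ^ n"
  unfolding J_def mass_def by (simp add: space_PiM emeasure_PiM)

lemma J_of_nat: "J n of_nat = of_nat (n choose k) * (hitprob * mass ^ (n - k))"
proof (cases "k \<le> n")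
  case True
  then show ?thesis
    using nn_integral_ucount_mult[of n "\<lambda>_. 1"] nn_integral_hit_indep[OF True, of "\<lambda>_. 1"]
    by (simp add: J_const)
next
  case False
  then have "n choose k = 0" by simp
  then show ?thesis using nn_integral_ucount_mult[of n "\<lambda>_. 1"] by (simp only: of_nat_0 mult_zero_left mult_1_right)
qed

section \<open>Integrals of two overlapping hits\<close>

lemma measurable_join_tuple:
  assumes "x \<in> space (PL {..<l})" "l \<le> k"
  shows "join_tuple k l x \<in> PL {..<k-l} \<rightarrow>\<^sub>M PL {..<k}"
  unfolding join_tuple_def
proof (rule measurable_restrict)
  fix j assume "j \<in> {..<k}"
  then show "(\<lambda>y. if j < l then x j else y (j - l)) \<in> PL {..<k-l} \<rightarrow>\<^sub>M L"
    using assms by (cases "j < l") (auto simp: space_PiM PiE_iff intro!: measurable_component_singleton)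
qed

text \<open>The k - l new coordinates sit in a block starting at an offset m \<ge> l; the
  enumeration \<open>e\<close> jumps over the gap. Both m = l and m = k are needed, one for each of
  two hits sharing the first l coordinates.\<close>

lemma nn_integral_join_tuple:
  assumes x: "x \<in> space (PL {..<l})" and l: "l \<le> k" "l \<le> m"
  defines "A \<equiv> {m..<m+(k-l)}"
  shows "(\<integral>\<^sup>+y. of_bool (hit k H (merge {..<l} A (x, y)) ({..<l} \<union> A)) \<partial>PL A)
    = (\<integral>\<^sup>+y. indicator H (join_tuple k l x y) \<partial>PL {..<k-l})"
proof -
  have b: "bij_betw (\<lambda>j. j + m) {..<k-l} A"
    unfolding A_def by (rule bij_betw_byWitness[where f'="\<lambda>j. j - m"]) auto
  have e: "bij_betw (\<lambda>j. if j < l then j else j - l + m) {..<k} ({..<l} \<union> A)"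
    unfolding A_def by (rule bij_betw_byWitness[where f'="\<lambda>j. if j < l then j else j - m + l"]) (use l in auto)
  have "of_bool (hit k H (merge {..<l} A (x, y)) ({..<l} \<union> A))
      = (indicator H (join_tuple k l x (\<lambda>j\<in>{..<k-l}. y (j + m))) :: ennreal)" for y
  proof -
    have "merge {..<l} A (x, y) (if j < l then j else j - l + m) = (if j < l then x j else y (j - l + m))"
      if "j < k" for j
      using that l unfolding A_def merge_def by auto
    then have "(\<lambda>j\<in>{..<k}. merge {..<l} A (x, y) (if j < l then j else j - l + m))
        = join_tuple k l x (\<lambda>j\<in>{..<k-l}. y (j + m))"
      unfolding join_tuple_def by (intro restrict_ext) (auto)
    then show ?thesis unfolding hit_iff[OF sym e] by (simp add: indicator_def)
  qed
  then show ?thesis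
    using nn_integral_PiM_reindex[OF b finite_lessThan, of "\<lambda>y. indicator H (join_tuple k l x y)"]
      measurable_join_tuple[OF x l(1)] H by simp
qed

text \<open>Once the shared l coordinates are fixed, the two hits involve disjoint blocks, so the
  inner integral factors. Both factors are the same function of the shared coordinates: this is
  where the square in \<open>overlap\<close> comes from.\<close>

lemma nn_integral_overlap_standard:
  assumes l: "l \<le> k"
  shows "(\<integral>\<^sup>+x. of_bool (hit k H x {..<k}) * of_bool (hit k H x ({..<l} \<union> {k..<2*k-l})) \<partial>PL {..<2*k-l}) = overlap k H L l"
proof -
  let ?I = "{..<l}" and ?A = "{l..<k}" and ?B = "{k..<2*k-l}"
  let ?F = "\<lambda>x. of_bool (hit k H x {..<k}) * of_bool (hit k H x (?I \<union> ?B)) :: ennreal"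
  have sets: "?I \<union> (?A \<union> ?B) = {..<2*k-l}" "?I \<union> ?A = {..<k}" and A: "?A = {l..<l+(k-l)}" and B: "?B = {k..<k+(k-l)}"
    using l by auto
  have inner: "(\<integral>\<^sup>+y. ?F (merge ?I (?A \<union> ?B) (x, y)) \<partial>PL (?A \<union> ?B))
      = (\<integral>\<^sup>+y. indicator H (join_tuple k l x y) \<partial>PL {..<k-l})\<^sup>2" if x: "x \<in> space (PL ?I)" for x
  proof -
    have m: "(\<lambda>y. merge ?I C (x, y)) \<in> PL C \<rightarrow>\<^sub>M PL (?I \<union> C)" for C
      using x by simp
    have "(\<integral>\<^sup>+y. ?F (merge ?I (?A \<union> ?B) (x, y)) \<partial>PL (?A \<union> ?B))
      = (\<integral>\<^sup>+y. of_bool (hit k H (merge ?I ?A (x, restrict y ?A)) (?I \<union> ?A))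
            * of_bool (hit k H (merge ?I ?B (x, restrict y ?B)) (?I \<union> ?B)) \<partial>PL (?A \<union> ?B))"
      unfolding sets(2)
      by (intro nn_integral_cong arg_cong2[where f="(*)"] arg_cong[where f=of_bool] hit_cong)
         (use l in \<open>auto simp: merge_def\<close>)
    also have "\<dots> = (\<integral>\<^sup>+y. of_bool (hit k H (merge ?I ?A (x, y)) (?I \<union> ?A)) \<partial>PL ?A)
        * (\<integral>\<^sup>+y. of_bool (hit k H (merge ?I ?B (x, y)) (?I \<union> ?B)) \<partial>PL ?B)"
      by (rule nn_integral_indep)
         (auto intro!: measurable_of_bool_ennreal measurable_compose[OF m measurable_hit_PL])
    also have "\<dots> = (\<integral>\<^sup>+y. indicator H (join_tuple k l x y) \<partial>PL {..<k-l})\<^sup>2"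
      unfolding A B using nn_integral_join_tuple[OF x l, of l] nn_integral_join_tuple[OF x l l]
      by (simp add: power2_eq_square)
    finally show ?thesis .
  qed
  have "(\<integral>\<^sup>+x. ?F x \<partial>PL (?I \<union> (?A \<union> ?B))) = (\<integral>\<^sup>+x. (\<integral>\<^sup>+y. ?F (merge ?I (?A \<union> ?B) (x, y)) \<partial>PL (?A \<union> ?B)) \<partial>PL ?I)"
  proof (rule product_nn_integral_fold)
    have "?F \<in> borel_measurable (PL {..<2*k-l})"
      using l by (intro borel_measurable_times_ennreal measurable_of_bool_ennreal measurable_hit_PL) auto
    then show "?F \<in> borel_measurable (PL (?I \<union> (?A \<union> ?B)))" unfolding sets .
  qed auto
  also have "\<dots> = overlap k H L l" unfolding overlap_def by (intro nn_integral_cong inner)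
  finally show ?thesis unfolding sets .
qed

text \<open>Three bijections, for the common part, the rest of \<open>{..<k}\<close> and the rest of
  \<open>b\<close>, glue to a relabelling that brings the pair into the standard position.
  Coordinates in neither set integrate to a power of \<open>mass\<close>.\<close>

lemma nn_integral_overlap:
  assumes b: "b \<subseteq> {..<n}" "card b = k" and n: "k \<le> n" and l: "card (b \<inter> {..<k}) = l"
  shows "(\<integral>\<^sup>+x. of_bool (hit k H x {..<k}) * of_bool (hit k H x b) \<partial>PL {..<n}) = overlap k H L l * mass ^ (n + l - 2*k)"
proof -
  let ?S = "{..<k} \<union> b" and ?b0 = "{..<l} \<union> {k..<2*k-l}"
  have finb: "finite b" using b finite_subset by auto
  have lk: "l \<le> k" using l card_mono[of b "b \<inter> {..<k}"] finb b by auto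
  have cb: "card (b - {..<k}) = k - l" and ca: "card ({..<k} - b) = k - l"
    using card_Diff_subset_Int[of b "{..<k}"] card_Diff_subset_Int[of "{..<k}" b] finb b l
    by (auto simp: Int_commute)
  obtain e1 where e1: "bij_betw e1 {..<l} (b \<inter> {..<k})"
    using finite_same_card_bij[of "{..<l}" "b \<inter> {..<k}"] finb l by auto
  obtain e2 where e2: "bij_betw e2 {l..<k} ({..<k} - b)"
    using finite_same_card_bij[of "{l..<k}" "{..<k} - b"] ca by auto
  obtain e3 where e3: "bij_betw e3 {k..<2*k-l} (b - {..<k})"
    using finite_same_card_bij[of "{k..<2*k-l}" "b - {..<k}"] finb cb lk by auto
  define e where "e j = (if j \<in> {..<l} then e1 j else if j \<in> {l..<k} then e2 j else e3 j)" for j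
  have e23: "bij_betw (\<lambda>j. if j \<in> {l..<k} then e2 j else e3 j) ({l..<k} \<union> {k..<2*k-l}) (({..<k} - b) \<union> (b - {..<k}))"
    by (rule bij_betw_disjoint_Un[OF e2 e3]) auto
  have "bij_betw e ({..<l} \<union> ({l..<k} \<union> {k..<2*k-l})) ((b \<inter> {..<k}) \<union> (({..<k} - b) \<union> (b - {..<k})))"
    unfolding e_def by (rule bij_betw_disjoint_Un[OF e1 e23]) auto
  moreover have "{..<l} \<union> ({l..<k} \<union> {k..<2*k-l}) = {..<2*k-l}" using lk by auto
  moreover have "(b \<inter> {..<k}) \<union> (({..<k} - b) \<union> (b - {..<k})) = ?S" by auto
  ultimately have e: "bij_betw e {..<2*k-l} ?S" by simp
  then have inj: "inj_on e {..<2*k-l}" and cS: "card ?S = 2*k-l"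
    using bij_betw_same_card[OF e] by (auto simp: bij_betw_def)
  have i1: "e ` {..<l} = b \<inter> {..<k}" using e1 by (auto simp: e_def bij_betw_def)
  have i2: "e ` {l..<k} = {..<k} - b" using e2 by (auto simp: e_def bij_betw_def)
  have i3: "e ` {k..<2*k-l} = b - {..<k}" 
  proof -
    have "e ` {k..<2*k-l} = e3 ` {k..<2*k-l}" using lk by (intro image_cong) (auto simp: e_def)
    then show ?thesis using e3 by (simp add: bij_betw_def)
  qed
  have "{..<k} = {..<l} \<union> {l..<k}" using lk by auto
  then have ia: "e ` {..<k} = {..<k}" using i1 i2 by (simp add: image_Un) blast
  have ib: "e ` ?b0 = b" using i1 i3 by (auto simp: image_Un)
  let ?F = "\<lambda>x. of_bool (hit k H x {..<k}) * of_bool (hit k H x b) :: ennreal"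
  let ?G = "\<lambda>x. of_bool (hit k H x {..<k}) * of_bool (hit k H x ?b0) :: ennreal"
  have m: "?F \<in> borel_measurable (PL ?S)" "?G \<in> borel_measurable (PL {..<2*k-l})"
    using lk by (auto intro!: borel_measurable_times_ennreal measurable_of_bool_ennreal measurable_hit_PL)
  have F: "?F (restrict x ?S) = ?F x" for x
    by (intro arg_cong2[where f="(*)"] arg_cong[where f=of_bool] hit_cong) auto
  have F0: "?G (\<lambda>j\<in>{..<2*k-l}. x (e j)) = ?F x" for x
  proof (intro arg_cong2[where f="(*)"] arg_cong[where f=of_bool])
    have "hit k H (\<lambda>j\<in>{..<2*k-l}. x (e j)) a = hit k H x (e ` a)" if "a \<subseteq> {..<2*k-l}" for a
    proof -
      have "hit k H (\<lambda>j\<in>{..<2*k-l}. x (e j)) a = hit k H (\<lambda>j. x (e j)) a"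
        using that by (intro hit_cong) auto
      also have "\<dots> = hit k H x (e ` a)" by (rule hit_image[OF inj_on_subset[OF inj that]])
      finally show ?thesis .
    qed
    moreover have "{..<k} \<subseteq> {..<2*k-l}" "?b0 \<subseteq> {..<2*k-l}" using lk by auto
    ultimately
    show "hit k H (\<lambda>j\<in>{..<2*k-l}. x (e j)) {..<k} = hit k H x {..<k}"
      "hit k H (\<lambda>j\<in>{..<2*k-l}. x (e j)) ?b0 = hit k H x b"
      unfolding ia ib by (simp_all only: ia ib)
  qed
  have S: "?S \<subseteq> {..<n}" using b n by auto
  have "(\<integral>\<^sup>+x. ?F x \<partial>PL {..<n}) = (\<integral>\<^sup>+x. ?F x \<partial>PL ?S) * mass ^ card ({..<n} - ?S)"
    using nn_integral_PL_subset[OF S finite_lessThan m(1)] unfolding F .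
  also have "(\<integral>\<^sup>+x. ?F x \<partial>PL ?S) = (\<integral>\<^sup>+x. ?G x \<partial>PL {..<2*k-l})"
    using nn_integral_PiM_reindex[OF e finite_lessThan m(2)] unfolding F0 .
  \<comment> \<open>The subtraction is not truncated here: \<open>?S\<close> has 2k - l elements and
    lies in \<open>{..<n}\<close>.\<close>
  also have "card ({..<n} - ?S) = n + l - 2*k"
    using card_Diff_subset[of ?S "{..<n}"] S finb cS lk card_mono[OF finite_lessThan S] by auto
  finally show ?thesis unfolding nn_integral_overlap_standard[OF lk] .
qed

end

lemma card_overlap_subsets:
  assumes "k \<le> n"
  shows "card {b. b \<subseteq> {..<n} \<and> card b = k \<and> card (b \<inter> {..<k}) = l} = (k choose l) * ((n - k) choose (k - l))" (is "card ?X = _")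
proof (cases "l \<le> k")
  case True
  let ?U = "{u. u \<subseteq> {..<k} \<and> card u = l}" and ?V = "{v. v \<subseteq> {k..<n} \<and> card v = k - l}"
  have "bij_betw (\<lambda>(u, v). u \<union> v) (?U \<times> ?V) ?X"
  proof (rule bij_betw_byWitness[where f'="\<lambda>b. (b \<inter> {..<k}, b \<inter> {k..<n})"])
    have cut: "u \<inter> v = {} \<and> (u \<union> v) \<inter> A = u \<and> (u \<union> v) \<inter> B = v"
      if "A \<inter> B = {}" "u \<subseteq> A" "v \<subseteq> B" for A B u v :: "nat set" using that by blast
    have cover: "b \<inter> A \<union> b \<inter> B = b" if "b \<subseteq> A \<union> B" for A B b :: "nat set" using that by blast
    have AB: "{..<k} \<inter> {k..<n} = {}" "{..<k} \<union> {k..<n} = {..<n}" using assms by auto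
    have disj: "u \<inter> v = {}" "(u \<union> v) \<inter> {..<k} = u" "(u \<union> v) \<inter> {k..<n} = v"
      if "u \<subseteq> {..<k}" "v \<subseteq> {k..<n}" for u v :: "nat set"
      using cut[OF AB(1) that] by (simp_all only:)
    show "\<forall>a\<in>?U \<times> ?V. (\<lambda>b. (b \<inter> {..<k}, b \<inter> {k..<n})) ((\<lambda>(u, v). u \<union> v) a) = a"
    proof
      fix p assume "p \<in> ?U \<times> ?V"
      then obtain u v where p: "p = (u, v)" and uv: "u \<subseteq> {..<k}" "v \<subseteq> {k..<n}" by auto
      show "(\<lambda>b. (b \<inter> {..<k}, b \<inter> {k..<n})) ((\<lambda>(u, v). u \<union> v) p) = p"
        unfolding p prod.case disj(2)[OF uv] disj(3)[OF uv] ..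
    qed
    show "\<forall>b\<in>?X. (\<lambda>(u, v). u \<union> v) (b \<inter> {..<k}, b \<inter> {k..<n}) = b"
    proof
      fix b assume "b \<in> ?X"
      then have "b \<subseteq> {..<k} \<union> {k..<n}" unfolding AB by (simp only: mem_Collect_eq)
      then show "(\<lambda>(u, v). u \<union> v) (b \<inter> {..<k}, b \<inter> {k..<n}) = b" using cover by (simp only: prod.case)
    qed
    show "(\<lambda>(u, v). u \<union> v) ` (?U \<times> ?V) \<subseteq> ?X"
    proof (rule image_subsetI)
      fix p assume "p \<in> ?U \<times> ?V"
      then obtain u v where p: "p = (u, v)" and uv: "u \<subseteq> {..<k}" "v \<subseteq> {k..<n}" "card v = k - card u" "l = card u"
        by auto
      have "finite u" "finite v" using finite_subset[OF uv(1)] finite_subset[OF uv(2)] by auto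
      then have "card (u \<union> v) = card u + card v" by (rule card_Un_disjoint[OF _ _ disj(1)[OF uv(1,2)]])
      then have "card (u \<union> v) = k" using uv(3,4) True by linarith
      moreover have "u \<union> v \<subseteq> {..<n}" using Un_mono[OF uv(1,2)] unfolding AB .
      ultimately show "(\<lambda>(u, v). u \<union> v) p \<in> ?X"
        unfolding p prod.case mem_Collect_eq disj(2)[OF uv(1,2)] using uv(4) by blast
    qed
    show "(\<lambda>b. (b \<inter> {..<k}, b \<inter> {k..<n})) ` ?X \<subseteq> ?U \<times> ?V"
    proof (rule image_subsetI)
      fix b assume "b \<in> ?X"
      then have b: "b \<subseteq> {..<n}" "card b = k" "l = card (b \<inter> {..<k})" by auto
      have "finite b" using finite_subset[OF b(1)] by auto
      have "b \<inter> {k..<n} = b - (b \<inter> {..<k})" using b(1) by auto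
      then have "card (b \<inter> {k..<n}) = k - l"
        using card_Diff_subset[of "b \<inter> {..<k}" b] \<open>finite b\<close> b(2,3) by (simp only: finite_Int Int_lower1 simp_thms)
      then show "(b \<inter> {..<k}, b \<inter> {k..<n}) \<in> ?U \<times> ?V"
        by (intro SigmaI CollectI conjI Int_lower2 b(3)[symmetric])
    qed
  qed
  then have "card ?X = card (?U \<times> ?V)" by (rule bij_betw_same_card[symmetric])
  also have "\<dots> = (k choose l) * ((n - k) choose (k - l))"
    unfolding card_cartesian_product using n_subsets[of "{..<k}" l] n_subsets[of "{k..<n}" "k - l"] by simp
  finally show ?thesis .
next
  case False
  have "card (b \<inter> {..<k}) \<le> k" for b using card_mono[of "{..<k}" "b \<inter> {..<k}"] by simp
  then have "?X = {}" using False by blast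
  then have "card ?X = 0" by (simp only: card.empty)
  moreover have "k choose l = 0" using False by simp
  ultimately show ?thesis by (simp only: mult_zero_left)
qed

context ustat begin

text \<open>One of the two hits is moved to \<open>{..<k}\<close>; the other is classified by the
  size l of its overlap with it. If the exponent n + l - 2k is truncated, the coefficient
  \<open>(n - k) choose (k - l)\<close> vanishes.\<close>

lemma second_moment:
  "J n (\<lambda>s. of_nat s * of_nat s)
    = (\<Sum>l\<le>k. of_nat ((n choose k) * (k choose l) * ((n - k) choose (k - l))) * (overlap k H L l * mass ^ (n + l - 2*k)))"
proof (cases "k \<le> n")
  case False
  then have "n choose k = 0" by simp
  then show ?thesis unfolding nn_integral_ucount_mult by (simp only: mult_zero_left of_nat_0 sum.neutral_const)
next
  case True
  let ?S = "{b. b \<subseteq> {..<n} \<and> card b = k}"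
  let ?T = "\<lambda>b. \<integral>\<^sup>+x. of_bool (hit k H x {..<k}) * of_bool (hit k H x b) \<partial>PL {..<n}"
  let ?I = "\<lambda>l. overlap k H L l * mass ^ (n + l - 2*k)"
  have finS: "finite ?S" by (rule finite_subset[of _ "Pow {..<n}"]) auto
  have "(\<integral>\<^sup>+x. of_bool (hit k H x {..<k}) * of_nat (ucount k H {..<n} x) \<partial>PL {..<n})
      = (\<integral>\<^sup>+x. (\<Sum>b\<in>?S. of_bool (hit k H x {..<k}) * of_bool (hit k H x b)) \<partial>PL {..<n})"
    by (intro nn_integral_cong) (simp add: ucount_eq_sum sum_distrib_left)
  also have "\<dots> = (\<Sum>b\<in>?S. ?T b)"
    using True by (intro nn_integral_sum) auto
  also have "\<dots> = (\<Sum>l\<le>k. \<Sum>b | b \<in> ?S \<and> card (b \<inter> {..<k}) = l. ?T b)"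
  proof (rule sum.group[symmetric, OF finS])
    show "(\<lambda>b. card (b \<inter> {..<k})) ` ?S \<subseteq> {..k}"
      using card_mono[of "{..<k}"] by auto
  qed simp
  also have "\<dots> = (\<Sum>l\<le>k. of_nat ((k choose l) * ((n - k) choose (k - l))) * ?I l)"
  proof (rule sum.cong[OF refl])
    fix l
    have "(\<Sum>b | b \<in> ?S \<and> card (b \<inter> {..<k}) = l. ?T b) = (\<Sum>b | b \<in> ?S \<and> card (b \<inter> {..<k}) = l. ?I l)"
      by (rule sum.cong[OF refl], rule nn_integral_overlap) (use True in auto)
    then show "(\<Sum>b | b \<in> ?S \<and> card (b \<inter> {..<k}) = l. ?T b) = of_nat ((k choose l) * ((n - k) choose (k - l))) * ?I l"
      using card_overlap_subsets[OF True, of l] by (simp add: conj_assoc)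
  qed
  finally show ?thesis
    unfolding nn_integral_ucount_mult by (simp add: sum_distrib_left mult.assoc)
qed

text \<open>The extreme overlaps supply the terms subtracted from the second moment in the bound: l
  = 0 yields the product of means, l = k the diagonal and hence the mean itself. Only 1 \<le> l < k
  is left for \<open>r_term\<close>.\<close>

lemma overlap_0: "overlap k H L 0 = hitprob\<^sup>2"
proof -
  have "(\<integral>\<^sup>+y. indicator H (join_tuple k 0 x y) \<partial>PL {..<k}) = hitprob" for x
  proof -
    have "(\<integral>\<^sup>+y. indicator H (join_tuple k 0 x y) \<partial>PL {..<k}) = (\<integral>\<^sup>+y. indicator H y \<partial>PL {..<k})"
      by (intro nn_integral_cong arg_cong[where f="indicator H"]) (simp add: join_tuple_def space_PiM)
    then show ?thesis using H by (simp add: hitprob_def)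
  qed
  then show ?thesis unfolding overlap_def by (simp add: space_PiM emeasure_PiM PiM_empty)
qed

lemma overlap_k: "overlap k H L k = hitprob"
proof -
  have "overlap k H L k = (\<integral>\<^sup>+x. indicator H x \<partial>PL {..<k})"
    unfolding overlap_def
  proof (rule nn_integral_cong)
    fix x assume "x \<in> space (PL {..<k})"
    then have "join_tuple k k x y = x" for y
      by (auto simp: join_tuple_def space_PiM fun_eq_iff PiE_iff extensional_def)
    then show "(\<integral>\<^sup>+y. indicator H (join_tuple k k x y) \<partial>PL {..<k-k})\<^sup>2 = (indicator H x :: ennreal)"
      by (simp add: space_PiM emeasure_PiM indicator_def)
  qed
  then show ?thesis using H by (simp add: hitprob_def)
qed

end

section \<open>Factorial moments of independent Poisson counts\<close>

lemma pmf_po_Suc: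
  assumes "0 \<le> c"
  shows "pmf (po c) (Suc n) * real (Suc n) = c * pmf (po c) n"
  using assms by (cases "c = 0") (simp_all add: po_def field_simps indicator_def del: of_nat_Suc)

text \<open>The Stein-Chen identity, by shifting the series with the recursion of the weights; the
  term at 0 carries the factor 0. It is the one-cell Mecke formula.\<close>

lemma nn_integral_po_shift:
  fixes \<psi> :: "nat \<Rightarrow> ennreal"
  assumes c: "0 \<le> c"
  shows "(\<integral>\<^sup>+n. of_nat n * \<psi> n \<partial>measure_pmf (po c)) = ennreal c * (\<integral>\<^sup>+n. \<psi> (Suc n) \<partial>measure_pmf (po c))"
proof -
  let ?f = "\<lambda>n. ennreal (pmf (po c) n) * (of_nat n * \<psi> n)"
  have S: "?f (Suc n) = ennreal c * (ennreal (pmf (po c) n) * \<psi> (Suc n))" for n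
  proof -
    have "ennreal (pmf (po c) (Suc n)) * of_nat (Suc n) = ennreal c * ennreal (pmf (po c) n)"
      using pmf_po_Suc[OF c, of n] c by (simp add: ennreal_of_nat_eq_real_of_nat flip: ennreal_mult del: of_nat_Suc)
    then show ?thesis by (simp only: mult.assoc[symmetric])
  qed
  have "(\<integral>\<^sup>+n. of_nat n * \<psi> n \<partial>measure_pmf (po c)) = (\<Sum>n. ?f n)"
    by (simp add: nn_integral_measure_pmf nn_integral_count_space_nat)
  also have "\<dots> = (\<Sum>n. ?f (Suc n))"
  proof -
    have "(\<lambda>n. ?f (Suc n)) sums (\<Sum>n. ?f (Suc n))" by (rule summable_sums[OF summableI])
    then have "?f sums ((\<Sum>n. ?f (Suc n)) + ?f 0)" by (rule sums_Suc)
    then have "(\<Sum>n. ?f n) = (\<Sum>n. ?f (Suc n)) + ?f 0" by (rule sums_unique[symmetric])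
    moreover have "?f 0 = 0" by (simp only: of_nat_0 mult_zero_left mult_zero_right)
    ultimately show ?thesis by (simp only: add_0_right)
  qed
  also have "\<dots> = ennreal c * (\<Sum>n. ennreal (pmf (po c) n) * \<psi> (Suc n))"
    unfolding S by (rule ennreal_suminf_cmult)
  finally show ?thesis by (simp add: nn_integral_measure_pmf nn_integral_count_space_nat)
qed

lemma measurable_PiM_fun_upd_Suc:
  assumes "q \<in> I"
  shows "(\<lambda>N. N(q := Suc (N q))) \<in> PiM I (\<lambda>_. count_space UNIV) \<rightarrow>\<^sub>M PiM I (\<lambda>_. count_space (UNIV :: nat set))"
proof (rule measurable_PiM_single')
  fix i assume "i \<in> I"
  then show "(\<lambda>N. (N(q := Suc (N q))) i) \<in> PiM I (\<lambda>_. count_space UNIV) \<rightarrow>\<^sub>M count_space UNIV"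
    using assms by (cases "i = q") simp_all
qed (use assms in \<open>auto simp: space_PiM PiE_iff extensional_def\<close>)

lemma nn_integral_PiM_po_shift:
  fixes \<psi> :: "('i \<Rightarrow> nat) \<Rightarrow> ennreal"
  assumes c: "\<And>i. 0 \<le> c i" and I: "finite I" "q \<in> I"
    and \<psi>: "\<psi> \<in> borel_measurable (PiM I (\<lambda>_. count_space UNIV))"
  defines "P \<equiv> PiM I (\<lambda>i. measure_pmf (po (c i)))"
  shows "(\<integral>\<^sup>+N. of_nat (N q) * \<psi> N \<partial>P) = ennreal (c q) * (\<integral>\<^sup>+N. \<psi> (N(q := Suc (N q))) \<partial>P)"
proof -
  interpret product_sigma_finite "\<lambda>i. measure_pmf (po (c i))" ..
  let ?J = "I - {q}"
  have IJ: "insert q ?J = I" "finite ?J" "q \<notin> ?J" using I by auto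
  have sets: "sets (PiM I (\<lambda>i. measure_pmf (po (c i)))) = sets (PiM I (\<lambda>_. count_space UNIV))"
    by (intro sets_PiM_cong) auto
  have \<psi>': "\<psi> \<in> borel_measurable (PiM I (\<lambda>i. measure_pmf (po (c i))))"
    using \<psi> by (simp cong: measurable_cong_sets add: measurable_cong_sets[OF sets refl])
  have u: "(\<lambda>N. \<psi> (N(q := Suc (N q)))) \<in> borel_measurable (PiM I (\<lambda>i. measure_pmf (po (c i))))"
    using measurable_compose[OF measurable_PiM_fun_upd_Suc[OF I(2)] \<psi>] by (simp add: measurable_cong_sets[OF sets refl])
  have Nq: "(\<lambda>N. of_nat (N q) :: ennreal) \<in> borel_measurable (PiM I (\<lambda>i. measure_pmf (po (c i))))"
    using I(2) by (intro measurable_compose[OF measurable_component_singleton[OF I(2)]]) auto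
  have slice: "(\<lambda>x. \<psi> (x(q := y))) \<in> borel_measurable (PiM ?J (\<lambda>i. measure_pmf (po (c i))))" for y
  proof -
    have "(\<lambda>x. x(q := y)) \<in> PiM ?J (\<lambda>i. measure_pmf (po (c i))) \<rightarrow>\<^sub>M PiM (insert q ?J) (\<lambda>i. measure_pmf (po (c i)))"
      by (rule measurable_fun_upd[where J="?J"]) auto
    then show ?thesis unfolding IJ(1) by (rule measurable_compose[OF _ \<psi>'])
  qed
  have "(\<integral>\<^sup>+N. of_nat (N q) * \<psi> N \<partial>P) = (\<integral>\<^sup>+y. (\<integral>\<^sup>+x. of_nat y * \<psi> (x(q := y)) \<partial>PiM ?J (\<lambda>i. measure_pmf (po (c i)))) \<partial>measure_pmf (po (c q)))"
    unfolding P_def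
    using product_nn_integral_insert_rev[OF IJ(2,3), of "\<lambda>N. of_nat (N q) * \<psi> N", unfolded IJ(1)] \<psi>' Nq by simp
  also have "\<dots> = (\<integral>\<^sup>+y. of_nat y * (\<integral>\<^sup>+x. \<psi> (x(q := y)) \<partial>PiM ?J (\<lambda>i. measure_pmf (po (c i)))) \<partial>measure_pmf (po (c q)))"
    by (intro nn_integral_cong nn_integral_cmult slice)
  also have "\<dots> = ennreal (c q) * (\<integral>\<^sup>+y. (\<integral>\<^sup>+x. \<psi> (x(q := Suc y)) \<partial>PiM ?J (\<lambda>i. measure_pmf (po (c i)))) \<partial>measure_pmf (po (c q)))"
    by (rule nn_integral_po_shift[OF c])
  also have "(\<integral>\<^sup>+y. (\<integral>\<^sup>+x. \<psi> (x(q := Suc y)) \<partial>PiM ?J (\<lambda>i. measure_pmf (po (c i)))) \<partial>measure_pmf (po (c q))) = (\<integral>\<^sup>+N. \<psi> (N(q := Suc (N q))) \<partial>P)"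
    unfolding P_def
    using product_nn_integral_insert_rev[OF IJ(2,3), of "\<lambda>N. \<psi> (N(q := Suc (N q)))", unfolded IJ(1)] u by simp
  finally show ?thesis .
qed

text \<open>The number of injective n-tuples whose j-th entry lies in cell \<open>w j\<close>, when
  cell q holds \<open>N q\<close> elements: each position loses the elements already taken from its
  own cell. Truncated subtraction is correct, because a product of falling factors that runs below
  zero already contains the factor 0.\<close>

definition cellcount :: "(nat \<Rightarrow> 'i) \<Rightarrow> nat \<Rightarrow> ('i \<Rightarrow> nat) \<Rightarrow> nat" where
  "cellcount w n N = (\<Prod>j<n. N (w j) - card {i. i < j \<and> w i = w j})"

text \<open>The factor of the last position is moved into \<psi>. After the shift caused by the
  earlier positions its correction \<open>?m\<close> cancels, and what remains is a plain factor
  \<open>N (w n)\<close>, to which the one-coordinate identity applies.\<close>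

lemma discrete_mecke:
  fixes \<psi> :: "('i \<Rightarrow> nat) \<Rightarrow> ennreal"
  assumes c: "\<And>i. 0 \<le> c i" and I: "finite I" and w: "\<And>j. j < n \<Longrightarrow> w j \<in> I"
    and \<psi>: "\<psi> \<in> borel_measurable (PiM I (\<lambda>_. count_space UNIV))"
  defines "P \<equiv> PiM I (\<lambda>i. measure_pmf (po (c i)))"
  shows "(\<integral>\<^sup>+N. of_nat (cellcount w n N) * \<psi> N \<partial>P)
    = (\<Prod>j<n. ennreal (c (w j))) * (\<integral>\<^sup>+N. \<psi> (\<lambda>q\<in>I. N q + card {i. i < n \<and> w i = q}) \<partial>P)"
  using w \<psi>
proof (induction n arbitrary: \<psi>)
  case 0
  have "(\<integral>\<^sup>+N. \<psi> N \<partial>P) = (\<integral>\<^sup>+N. \<psi> (\<lambda>q\<in>I. N q) \<partial>P)"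
    unfolding P_def by (intro nn_integral_cong arg_cong[where f=\<psi>]) (simp add: space_PiM)
  then show ?case by (simp add: cellcount_def restrict_def)
next
  case (Suc n)
  let ?sh = "\<lambda>n N. \<lambda>q\<in>I. N q + card {i. i < n \<and> w i = q}"
  let ?m = "card {i. i < n \<and> w i = w n}"
  have wn: "w n \<in> I" using Suc.prems(1) by simp
  have sh: "?sh n \<in> PiM I (\<lambda>_. count_space UNIV) \<rightarrow>\<^sub>M PiM I (\<lambda>_. count_space (UNIV::nat set))" for n
    by (rule measurable_restrict) simp
  have m1: "(\<lambda>N. of_nat (N (w n) - ?m) * \<psi> N) \<in> borel_measurable (PiM I (\<lambda>_. count_space UNIV))"
    using Suc.prems(2) by (intro borel_measurable_times_ennreal measurable_compose[OF measurable_component_singleton[OF wn]]) auto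
  have step: "?sh n (N(w n := Suc (N (w n)))) = ?sh (Suc n) N" for N
  proof (intro restrict_ext)
    fix q
    have "{i. i < Suc n \<and> w i = q} = (if w n = q then insert n {i. i < n \<and> w i = q} else {i. i < n \<and> w i = q})"
      by (auto simp: less_Suc_eq)
    then show "(N(w n := Suc (N (w n)))) q + card {i. i < n \<and> w i = q} = N q + card {i. i < Suc n \<and> w i = q}"
      by simp
  qed
  have "(\<integral>\<^sup>+N. of_nat (cellcount w (Suc n) N) * \<psi> N \<partial>P) = (\<integral>\<^sup>+N. of_nat (cellcount w n N) * (of_nat (N (w n) - ?m) * \<psi> N) \<partial>P)"
    by (intro nn_integral_cong) (simp add: cellcount_def mult.assoc)
  also have "\<dots> = (\<Prod>j<n. ennreal (c (w j))) * (\<integral>\<^sup>+N. of_nat (?sh n N (w n) - ?m) * \<psi> (?sh n N) \<partial>P)"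
    using Suc.prems(1) by (intro Suc.IH m1) simp
  also have "(\<integral>\<^sup>+N. of_nat (?sh n N (w n) - ?m) * \<psi> (?sh n N) \<partial>P) = (\<integral>\<^sup>+N. of_nat (N (w n)) * \<psi> (?sh n N) \<partial>P)"
    using wn by (intro nn_integral_cong) simp
  also have "\<dots> = ennreal (c (w n)) * (\<integral>\<^sup>+N. \<psi> (?sh n (N(w n := Suc (N (w n))))) \<partial>P)"
    unfolding P_def by (rule nn_integral_PiM_po_shift[OF c I wn measurable_compose[OF sh Suc.prems(2)]])
  finally show ?case unfolding step by (simp only: prod.lessThan_Suc mult.assoc)
qed

text \<open>After the n points of the tuple have been added, a total of n forces all cells of the
  original sample to be empty; the exponential is the probability of that.\<close>

lemma nn_integral_cellcount_total:
  assumes c: "\<And>i. 0 \<le> c i" and I: "finite I" and w: "\<And>j. j < n \<Longrightarrow> w j \<in> I"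
  defines "P \<equiv> PiM I (\<lambda>i. measure_pmf (po (c i)))"
  shows "(\<integral>\<^sup>+N. of_nat (cellcount w n N) * of_bool ((\<Sum>q\<in>I. N q) = n) \<partial>P)
    = (\<Prod>j<n. ennreal (c (w j))) * ennreal (exp (- (\<Sum>q\<in>I. c q)))"
proof -
  interpret product_sigma_finite "\<lambda>i. measure_pmf (po (c i))" ..
  have "(\<lambda>N. \<Sum>q\<in>I. N q) \<in> PiM I (\<lambda>_. count_space UNIV) \<rightarrow>\<^sub>M count_space (UNIV :: nat set)"
    by (intro measurable_sum_nat) simp
  then have m: "(\<lambda>N. of_bool ((\<Sum>q\<in>I. N q) = n) :: ennreal) \<in> borel_measurable (PiM I (\<lambda>_. count_space UNIV))"
    by measurable
  have tot: "(\<Sum>q\<in>I. card {i. i < n \<and> w i = q}) = n"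
  proof -
    have "(\<Sum>q\<in>I. card {i. i < n \<and> w i = q}) = (\<Sum>q\<in>I. \<Sum>i | i \<in> {..<n} \<and> w i = q. 1)" by simp
    also have "\<dots> = (\<Sum>i<n. 1)" by (rule sum.group) (use I w in auto)
    finally show ?thesis by simp
  qed
  have key: "of_bool ((\<Sum>q\<in>I. (\<lambda>q\<in>I. N q + card {i. i < n \<and> w i = q}) q) = n) = (\<Prod>q\<in>I. of_bool (N q = 0) :: ennreal)" for N
  proof -
    have "(\<Sum>q\<in>I. (\<lambda>q\<in>I. N q + card {i. i < n \<and> w i = q}) q) = (\<Sum>q\<in>I. N q) + n"
      by (simp add: sum.distrib tot)
    then have "((\<Sum>q\<in>I. (\<lambda>q\<in>I. N q + card {i. i < n \<and> w i = q}) q) = n) \<longleftrightarrow> (\<forall>q\<in>I. N q = 0)"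
      using I by simp
    moreover have "(\<Prod>q\<in>I. of_bool (N q = 0) :: ennreal) = of_bool (\<forall>q\<in>I. N q = 0)"
      using I by (induction I rule: finite_induct) auto
    ultimately show ?thesis by (simp only:)
  qed
  have "(\<integral>\<^sup>+N. of_nat (cellcount w n N) * of_bool ((\<Sum>q\<in>I. N q) = n) \<partial>P)
    = (\<Prod>j<n. ennreal (c (w j))) *
      (\<integral>\<^sup>+N. of_bool ((\<Sum>q\<in>I. (\<lambda>q\<in>I. N q + card {i. i < n \<and> w i = q}) q) = n) \<partial>P)"
    unfolding P_def using discrete_mecke[of c I n w, OF c I w m] .
  also have "\<dots> = (\<Prod>j<n. ennreal (c (w j))) * (\<integral>\<^sup>+N. (\<Prod>q\<in>I. of_bool (N q = 0)) \<partial>P)"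
    unfolding key ..
  also have "(\<integral>\<^sup>+N. (\<Prod>q\<in>I. of_bool (N q = 0)) \<partial>P) = (\<Prod>q\<in>I. \<integral>\<^sup>+N. of_bool (N = 0) \<partial>measure_pmf (po (c q)))"
    unfolding P_def by (rule product_nn_integral_prod[OF I]) simp
  also have "\<dots> = (\<Prod>q\<in>I. ennreal (exp (- c q)))"
  proof (rule prod.cong[OF refl])
    fix q
    have "(\<integral>\<^sup>+N. of_bool (N = 0) \<partial>measure_pmf (po (c q))) = (\<integral>\<^sup>+N. indicator {0} N \<partial>measure_pmf (po (c q)))"
      by (intro nn_integral_cong) (simp add: indicator_def)
    also have "\<dots> = ennreal (pmf (po (c q)) 0)" by (simp add: emeasure_pmf_single)
    also have "pmf (po (c q)) 0 = exp (- c q)" using c[of q] by (cases "c q = 0") (simp_all add: po_def)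
    finally show "(\<integral>\<^sup>+N. of_bool (N = 0) \<partial>measure_pmf (po (c q))) = ennreal (exp (- c q))" .
  qed
  also have "\<dots> = ennreal (exp (- (\<Sum>q\<in>I. c q)))"
    using I by (simp add: prod_ennreal exp_sum sum_negf[symmetric])
  finally show ?thesis .
qed

text \<open>All index tuples, independently of \<omega>; membership in the random index set goes
  into the integrand. Tuples of naturals thus form a fixed countable set, whose counting measure is
  sigma-finite and admits Tonelli.\<close>

definition inj_tuples :: "nat \<Rightarrow> (nat \<Rightarrow> 'i) set" where
  "inj_tuples n = {i \<in> {..<n} \<rightarrow>\<^sub>E UNIV. inj_on i {..<n}}"

lemma countable_inj_tuples: "countable (inj_tuples n :: (nat \<Rightarrow> 'i::countable) set)"
  unfolding inj_tuples_def by (rule countable_subset[of _ "{..<n} \<rightarrow>\<^sub>E UNIV"]) (auto intro: countable_PiE)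

text \<open>Tuples are extended by one position at a time. Since the cells are disjoint, the
  elements of the new cell that are already taken are exactly those at earlier positions with the
  same cell, so the number of choices depends only on the cell sizes.\<close>

lemma card_cell_tuples:
  fixes E :: "'q \<Rightarrow> 'i set"
  assumes fin: "\<And>q. q \<in> I \<Longrightarrow> finite (E q)" and disj: "disjoint_family_on E I" and w: "\<And>j. j < n \<Longrightarrow> w j \<in> I"
  shows "finite {i \<in> inj_tuples n. \<forall>j<n. i j \<in> E (w j)} \<and>
    card {i \<in> inj_tuples n. \<forall>j<n. i j \<in> E (w j)} = cellcount w n (\<lambda>q. card (E q))"
  using w
proof (induction n)
  case 0
  have "{i \<in> inj_tuples 0. \<forall>j<0. i j \<in> E (w j)} = {\<lambda>_. undefined :: 'i}" by (auto simp: inj_tuples_def)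
  then show ?case by (simp add: cellcount_def)
next
  case (Suc n)
  let ?T = "\<lambda>n. {i \<in> inj_tuples n. \<forall>j<n. i j \<in> E (w j)}"
  let ?S = "Sigma (?T n) (\<lambda>i. E (w n) - i ` {..<n})"
  have wn: "w n \<in> I" and wj: "\<And>j. j < n \<Longrightarrow> w j \<in> I" using Suc.prems by auto
  have IH: "finite (?T n)" "card (?T n) = cellcount w n (\<lambda>q. card (E q))" using Suc.IH[OF wj] by blast+
  have b: "bij_betw (\<lambda>(i, a). i(n := a)) ?S (?T (Suc n))"
  proof (rule bij_betw_byWitness[where f'="\<lambda>i. (restrict i {..<n}, i n)"])
    show "\<forall>p\<in>?S. (\<lambda>i. (restrict i {..<n}, i n)) ((\<lambda>(i, a). i(n := a)) p) = p"
    proof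
      fix p assume pS: "p \<in> ?S"
      obtain i a where p: "p = (i, a)" by (cases p)
      then have "i \<in> inj_tuples n" using pS by simp
      then have "i \<in> extensional {..<n}" by (simp add: inj_tuples_def PiE_def)
      then have "restrict i {..<n} = i" by (rule extensional_restrict)
      moreover have "restrict (i(n := a)) {..<n} = restrict i {..<n}" by (rule restrict_ext) simp
      ultimately have "restrict (i(n := a)) {..<n} = i" by (rule trans[rotated])
      then show "(\<lambda>i. (restrict i {..<n}, i n)) ((\<lambda>(i, a). i(n := a)) p) = p" by (simp add: p)
    qed
    show "\<forall>i\<in>?T (Suc n). (\<lambda>(i, a). i(n := a)) (restrict i {..<n}, i n) = i"
    proof
      fix i assume "i \<in> ?T (Suc n)"
      then have i: "i \<in> extensional {..<Suc n}" by (simp add: inj_tuples_def PiE_def)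
      have "((restrict i {..<n})(n := i n)) x = i x" for x
      proof (cases "x < Suc n")
        case True
        then show ?thesis by (cases "x = n") simp_all
      next
        case False
        then show ?thesis using extensional_arb[OF i, of x] by simp
      qed
      then show "(\<lambda>(i, a). i(n := a)) (restrict i {..<n}, i n) = i" unfolding prod.case by (intro ext)
    qed
    show "(\<lambda>(i, a). i(n := a)) ` ?S \<subseteq> ?T (Suc n)"
    proof (rule image_subsetI)
      fix p assume pS: "p \<in> ?S"
      obtain i a where p: "p = (i, a)" by (cases p)
      then have i: "i \<in> ?T n" and a: "a \<in> E (w n)" "a \<notin> i ` {..<n}" using pS by blast+
      have inj: "inj_on (i(n := a)) {..<Suc n}"
      proof -
        have "inj_on (i(n := a)) {..<n} \<longleftrightarrow> inj_on i {..<n}" by (intro inj_on_cong) simp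
        moreover have "(i(n := a)) ` {..<n} = i ` {..<n}" by (intro image_cong) simp_all
        ultimately show ?thesis using i a(2) unfolding inj_tuples_def lessThan_Suc inj_on_insert by simp
      qed
      have "i \<in> extensional {..<n}" using i by (simp add: inj_tuples_def PiE_def)
      then have ext: "i(n := a) \<in> {..<Suc n} \<rightarrow>\<^sub>E UNIV" by (auto simp: PiE_iff extensional_def)
      have "(i(n := a)) j \<in> E (w j)" if "j < Suc n" for j
        using that i a(1) by (cases "j = n") auto
      with inj ext show "(\<lambda>(i, a). i(n := a)) p \<in> ?T (Suc n)"
        unfolding p prod.case inj_tuples_def by blast
    qed
    show "(\<lambda>i. (restrict i {..<n}, i n)) ` ?T (Suc n) \<subseteq> ?S"
    proof (rule image_subsetI)
      fix i assume i: "i \<in> ?T (Suc n)"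
      then have inj: "inj_on i {..<Suc n}" by (simp add: inj_tuples_def)
      have inj': "inj_on i {..<n}" "i n \<notin> i ` {..<n}"
        using inj unfolding lessThan_Suc inj_on_insert by auto
      moreover have "restrict i {..<n} ` {..<n} = i ` {..<n}" by simp
      moreover have "inj_on (restrict i {..<n}) {..<n}" using inj'(1) by (simp add: inj_on_restrict_eq)
      ultimately show "(restrict i {..<n}, i n) \<in> ?S"
        using i by (auto simp add: inj_tuples_def)
    qed
  qed
  have ext: "finite (E (w n) - i ` {..<n})" "card (E (w n) - i ` {..<n}) = card (E (w n)) - card {j. j < n \<and> w j = w n}"
    if i: "i \<in> ?T n" for i
  proof -
    show "finite (E (w n) - i ` {..<n})" using fin[OF wn] by simp
    have "E (w n) \<inter> i ` {..<n} = i ` {j. j < n \<and> w j = w n}"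
    proof (intro equalityI subsetI)
      fix a assume "a \<in> E (w n) \<inter> i ` {..<n}"
      then obtain j where j: "j < n" "a = i j" "i j \<in> E (w n)" by blast
      moreover have "i j \<in> E (w j)" using i j(1) by simp
      ultimately have "w j = w n" using disjoint_family_onD[OF disj wj[OF j(1)] wn] by (metis disjoint_iff)
      then show "a \<in> i ` {j. j < n \<and> w j = w n}" using j by simp
    next
      fix a assume "a \<in> i ` {j. j < n \<and> w j = w n}"
      then obtain j where j: "j < n" "w j = w n" "a = i j" by blast
      moreover have "i j \<in> E (w j)" using i j(1) by simp
      ultimately show "a \<in> E (w n) \<inter> i ` {..<n}" by simp
    qed
    moreover have "inj_on i {j. j < n \<and> w j = w n}"
      by (rule inj_on_subset[of i "{..<n}"]) (use i in \<open>auto simp: inj_tuples_def\<close>)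
    ultimately have "card (E (w n) \<inter> i ` {..<n}) = card {j. j < n \<and> w j = w n}" by (simp add: card_image)
    then show "card (E (w n) - i ` {..<n}) = card (E (w n)) - card {j. j < n \<and> w j = w n}"
      using card_Diff_subset_Int[of "E (w n)" "i ` {..<n}"] by simp
  qed
  have "finite ?S" using IH(1) ext(1) by (intro finite_SigmaI) auto
  moreover have "card ?S = cellcount w (Suc n) (\<lambda>q. card (E q))"
  proof -
    have "card ?S = (\<Sum>i\<in>?T n. card (E (w n) - i ` {..<n}))" using IH(1) ext(1) by (intro card_SigmaI) auto
    also have "\<dots> = (\<Sum>i\<in>?T n. card (E (w n)) - card {j. j < n \<and> w j = w n})" by (intro sum.cong ext(2)) auto
    finally show ?thesis using IH(2) by (simp add: cellcount_def)
  qed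
  ultimately show ?case using bij_betw_finite[OF b] bij_betw_same_card[OF b] by simp
qed

section \<open>Janossy measures of a Poisson process\<close>

definition pts :: "('w \<Rightarrow> enat) \<Rightarrow> ('w \<Rightarrow> nat \<Rightarrow> 'a) \<Rightarrow> 'a set \<Rightarrow> 'w \<Rightarrow> nat set" where
  "pts \<kappa> X A \<omega> = {j. enat j < \<kappa> \<omega> \<and> X \<omega> j \<in> A}"

lemma pcount_eq: "pcount \<kappa> X A \<omega> = (if finite (pts \<kappa> X A \<omega>) then enat (card (pts \<kappa> X A \<omega>)) else \<infinity>)"
  by (simp add: pcount_def pts_def Let_def)

text \<open>Sending \<infinity> to 0 matches \<open>card\<close> of an infinite set, so the count of
  \<open>pts\<close> is a function of \<open>pcount\<close> without exceptional cases.\<close>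

definition enat_to_nat :: "enat \<Rightarrow> nat" where
  "enat_to_nat e = (case e of enat n \<Rightarrow> n | \<infinity> \<Rightarrow> 0)"

lemma enat_to_nat_pcount: "enat_to_nat (pcount \<kappa> X A \<omega>) = card (pts \<kappa> X A \<omega>)"
  by (simp add: enat_to_nat_def pcount_eq)

locale poisson_pp = prob_space M for M :: "'w measure" +
  fixes \<kappa> :: "'w \<Rightarrow> enat" and X :: "'w \<Rightarrow> nat \<Rightarrow> 'a::topological_space" and L :: "'a measure"
  assumes pp: "poisson_process M \<kappa> X L" and sets_L: "sets L = sets borel"
begin

lemma measurable_kappa [measurable]: "\<kappa> \<in> M \<rightarrow>\<^sub>M count_space UNIV"
  using pp unfolding poisson_process_def point_process_def by blast

lemma measurable_X [measurable]: "(\<lambda>\<omega>. X \<omega> i) \<in> M \<rightarrow>\<^sub>M borel"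
  using pp unfolding poisson_process_def point_process_def by blast

lemma measurable_pts [measurable]: "A \<in> sets borel \<Longrightarrow> Measurable.pred M (\<lambda>\<omega>. j \<in> pts \<kappa> X A \<omega>)"
proof -
  assume [measurable]: "A \<in> sets borel"
  have "Measurable.pred M (\<lambda>\<omega>. enat j < \<kappa> \<omega>)"
    by (rule measurable_compose[OF measurable_kappa]) simp
  then show ?thesis unfolding pts_def mem_Collect_eq by measurable
qed

lemma indep_pcount:
  "finite (I::nat set) \<Longrightarrow> (\<And>i. i \<in> I \<Longrightarrow> A i \<in> sets borel) \<Longrightarrow> disjoint_family_on A I \<Longrightarrow>
    indep_vars (\<lambda>_. count_space UNIV) (\<lambda>i. pcount \<kappa> X (A i)) I"
  using pp unfolding poisson_process_def by blast

text \<open>Measurability is part of \<open>indep_vars\<close>; a one-element family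
  suffices.\<close>

lemma measurable_pcount [measurable]: "A \<in> sets borel \<Longrightarrow> pcount \<kappa> X A \<in> M \<rightarrow>\<^sub>M count_space UNIV"
  using indep_pcount[of "{0}" "\<lambda>_. A"] by (simp add: indep_vars_def disjoint_family_on_def)

lemma distr_pcount:
  "A \<in> sets borel \<Longrightarrow> emeasure L A < \<infinity> \<Longrightarrow>
    distr M (count_space UNIV) (pcount \<kappa> X A) = measure_pmf (map_pmf enat (po (enn2real (emeasure L A))))"
  using pp unfolding poisson_process_def by blast

lemma AE_finite_pts:
  assumes A: "A \<in> sets borel" "emeasure L A < \<infinity>"
  shows "AE \<omega> in M. finite (pts \<kappa> X A \<omega>)"
proof -
  have "AE e in distr M (count_space UNIV) (pcount \<kappa> X A). e \<noteq> \<infinity>"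
    unfolding distr_pcount[OF A] by (auto simp: AE_measure_pmf_iff)
  then have "AE \<omega> in M. pcount \<kappa> X A \<omega> \<noteq> \<infinity>"
    by (subst (asm) AE_distr_iff) (use A in auto)
  then show ?thesis by eventually_elim (simp add: pcount_eq split: if_splits)
qed

lemma distr_counts:
  fixes D :: "nat \<Rightarrow> 'a set"
  assumes p: "0 < p" and D: "\<And>q. q < p \<Longrightarrow> D q \<in> sets borel" "\<And>q. q < p \<Longrightarrow> emeasure L (D q) < \<infinity>"
    and disj: "disjoint_family_on D {..<p}"
  shows "distr M (PiM {..<p} (\<lambda>_. count_space UNIV)) (\<lambda>\<omega>. \<lambda>q\<in>{..<p}. card (pts \<kappa> X (D q) \<omega>))
    = PiM {..<p} (\<lambda>q. measure_pmf (po (enn2real (emeasure L (D q)))))"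
proof -
  have "indep_vars (\<lambda>_. count_space UNIV) (\<lambda>q \<omega>. enat_to_nat (pcount \<kappa> X (D q) \<omega>)) {..<p}"
    by (rule indep_vars_compose2[where X="\<lambda>q. pcount \<kappa> X (D q)" and Y="\<lambda>_. enat_to_nat", OF indep_pcount[where A=D]])
       (use D disj in auto)
  then have "indep_vars (\<lambda>_. count_space UNIV) (\<lambda>q \<omega>. card (pts \<kappa> X (D q) \<omega>)) {..<p}"
    unfolding enat_to_nat_pcount .
  moreover have mc: "(\<lambda>\<omega>. card (pts \<kappa> X (D q) \<omega>)) \<in> M \<rightarrow>\<^sub>M count_space UNIV" if "q < p" for q
    unfolding enat_to_nat_pcount[symmetric] by (rule measurable_compose[OF measurable_pcount[OF D(1)[OF that]]]) simp
  ultimately have "distr M (PiM {..<p} (\<lambda>_. count_space UNIV)) (\<lambda>\<omega>. \<lambda>q\<in>{..<p}. card (pts \<kappa> X (D q) \<omega>))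
    = PiM {..<p} (\<lambda>q. distr M (count_space UNIV) (\<lambda>\<omega>. card (pts \<kappa> X (D q) \<omega>)))"
    by (subst (asm) indep_vars_iff_distr_eq_PiM') (use p in auto)
  also have "\<dots> = PiM {..<p} (\<lambda>q. measure_pmf (po (enn2real (emeasure L (D q)))))"
  proof (rule PiM_cong[OF refl])
    fix q assume "q \<in> {..<p}"
    then have q: "q < p" by simp
    have "distr M (count_space UNIV) (\<lambda>\<omega>. card (pts \<kappa> X (D q) \<omega>))
      = distr (distr M (count_space UNIV) (pcount \<kappa> X (D q))) (count_space UNIV) enat_to_nat"
      using measurable_pcount[OF D(1)[OF q]] by (subst distr_distr) (auto simp: comp_def enat_to_nat_pcount)
    also have "\<dots> = measure_pmf (map_pmf enat_to_nat (map_pmf enat (po (enn2real (emeasure L (D q))))))"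
      unfolding distr_pcount[OF D(1)[OF q] D(2)[OF q]] by (simp add: map_pmf_rep_eq)
    also have "map_pmf enat_to_nat (map_pmf enat (po c)) = po c" for c
      by (simp add: map_pmf_comp enat_to_nat_def)
    finally show "distr M (count_space UNIV) (\<lambda>\<omega>. card (pts \<kappa> X (D q) \<omega>)) = measure_pmf (po (enn2real (emeasure L (D q))))" .
  qed
  finally show ?thesis .
qed

end

text \<open>Counts are independent only over disjoint sets, while the sides of a rectangle may
  overlap. The pieces are the atoms of the algebra generated by the \<open>C j\<close> inside
  \<open>A\<close>, one for each subset of \<open>{..<n}\<close>, recording which of the
  \<open>C j\<close> contain a point; atoms may be empty.\<close>

lemma ex_partition:
  fixes C :: "nat \<Rightarrow> 'a set" and A :: "'a set"
  assumes C: "\<forall>j<n. C j \<in> sets M" and A: "A \<in> sets M"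
  shows "\<exists>p D Q. (0::nat) < p \<and> (\<forall>q. D q \<in> sets M) \<and> disjoint_family_on D {..<p} \<and> A = (\<Union>q<p. D q) \<and>
    (\<forall>j<n. Q j \<subseteq> {..<p}) \<and> (\<forall>j<n. A \<inter> C j = (\<Union>q\<in>Q j. D q))"
proof -
  define p :: nat where "p = 2 ^ n"
  have "card {..<p} = card (Pow {..<n})" by (simp add: p_def card_Pow)
  then obtain h where h: "bij_betw h {..<p} (Pow {..<n})"
    using finite_same_card_bij[of "{..<p}" "Pow {..<n}"] by auto
  define D where "D q = {x \<in> A. {j. j < n \<and> x \<in> C j} = h q}" for q
  define Q where "Q j = {q. q < p \<and> j \<in> h q}" for j
  have cover: "\<exists>q<p. x \<in> D q" if "x \<in> A" for x
  proof -
    have "{j. j < n \<and> x \<in> C j} \<in> h ` {..<p}" using h by (auto simp: bij_betw_def)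
    then show ?thesis using that by (auto simp: D_def)
  qed
  show ?thesis
  proof (intro exI[of _ p] exI[of _ D] exI[of _ Q] conjI allI impI)
    show "0 < p" by (simp add: p_def)
    show "D q \<in> sets M" for q
    proof -
      have "D q = (if h q \<subseteq> {..<n} then {x \<in> A. \<forall>j\<in>{..<n}. x \<in> C j \<longleftrightarrow> j \<in> h q} else {})"
        by (auto simp: D_def)
      moreover have "{x \<in> A. \<forall>j\<in>{..<n}. x \<in> C j \<longleftrightarrow> j \<in> h q} = A \<inter> {x \<in> space M. \<forall>j\<in>{..<n}. x \<in> C j \<longleftrightarrow> j \<in> h q}"
        using sets.sets_into_space[OF A] by auto
      moreover have "{x \<in> space M. \<forall>j\<in>{..<n}. x \<in> C j \<longleftrightarrow> j \<in> h q} \<in> sets M"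
      proof (intro sets.sets_Collect_finite_All)
        fix j assume "j \<in> {..<n}"
        then have [measurable]: "C j \<in> sets M" using C by simp
        show "{x \<in> space M. x \<in> C j \<longleftrightarrow> j \<in> h q} \<in> sets M" by measurable
      qed (auto)
      ultimately show ?thesis using A by auto
    qed
    show "disjoint_family_on D {..<p}"
      unfolding disjoint_family_on_def
    proof (intro ballI impI)
      fix a b assume ab: "a \<in> {..<p}" "b \<in> {..<p}" "a \<noteq> b"
      then have "h a \<noteq> h b" using h unfolding bij_betw_def inj_on_def by blast
      then show "D a \<inter> D b = {}" by (auto simp: D_def)
    qed
    show "A = (\<Union>q<p. D q)" using cover by (auto simp: D_def)
    show "Q j \<subseteq> {..<p}" for j by (auto simp: Q_def)
    show "A \<inter> C j = (\<Union>q\<in>Q j. D q)" if "j < n" for j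
    proof (intro equalityI subsetI)
      fix x assume x: "x \<in> A \<inter> C j"
      then obtain q where q: "q < p" "x \<in> D q" using cover by blast
      then have "j \<in> h q" using x that by (auto simp: D_def)
      then show "x \<in> (\<Union>q\<in>Q j. D q)" using q by (auto simp: Q_def)
    next
      fix x assume "x \<in> (\<Union>q\<in>Q j. D q)"
      then show "x \<in> A \<inter> C j" by (auto simp: Q_def D_def)
    qed
  qed
qed

text \<open>A tuple determines for each position the unique atom containing its entry, so the tuples
  split disjointly according to the assignment \<open>w\<close> of atoms to positions.\<close>

lemma card_cell_tuples_union:
  fixes E :: "nat \<Rightarrow> 'i set"
  assumes fin: "\<And>q. q < p \<Longrightarrow> finite (E q)" and disj: "disjoint_family_on E {..<p}" and Q: "\<And>j. j < n \<Longrightarrow> Q j \<subseteq> {..<p}"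
  shows "finite {i \<in> inj_tuples n. \<forall>j<n. i j \<in> (\<Union>q\<in>Q j. E q)}"
    and "card {i \<in> inj_tuples n. \<forall>j<n. i j \<in> (\<Union>q\<in>Q j. E q)} = (\<Sum>w\<in>PiE {..<n} Q. cellcount w n (\<lambda>q. card (E q)))"
proof -
  let ?W = "\<lambda>w. {i \<in> inj_tuples n. \<forall>j<n. i j \<in> E (w j)}"
  have w: "w j < p" if "w \<in> PiE {..<n} Q" "j < n" for w j
    using PiE_mem[OF that(1), of j] Q[OF that(2)] that(2) by auto
  have cw: "finite (?W w) \<and> card (?W w) = cellcount w n (\<lambda>q. card (E q))" if "w \<in> PiE {..<n} Q" for w
    by (rule card_cell_tuples[of "{..<p}"]) (use fin disj w[OF that] in auto)
  have finPi: "finite (PiE {..<n} Q)"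
    by (rule finite_PiE) (use Q finite_subset[OF _ finite_lessThan] in blast)+
  have un: "{i \<in> inj_tuples n. \<forall>j<n. i j \<in> (\<Union>q\<in>Q j. E q)} = (\<Union>w\<in>PiE {..<n} Q. ?W w)"
  proof (intro equalityI subsetI)
    fix i assume i: "i \<in> {i \<in> inj_tuples n. \<forall>j<n. i j \<in> (\<Union>q\<in>Q j. E q)}"
    define w where "w = (\<lambda>j\<in>{..<n}. SOME q. q \<in> Q j \<and> i j \<in> E q)"
    have "w j \<in> Q j \<and> i j \<in> E (w j)" if "j < n" for j
    proof -
      have "\<exists>q. q \<in> Q j \<and> i j \<in> E q" using i that by blast
      from someI_ex[OF this] show ?thesis using that by (simp add: w_def)
    qed
    then have "w \<in> PiE {..<n} Q" "i \<in> ?W w" using i by (auto simp: w_def)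
    then show "i \<in> (\<Union>w\<in>PiE {..<n} Q. ?W w)" by blast
  next
    fix i assume "i \<in> (\<Union>w\<in>PiE {..<n} Q. ?W w)"
    then obtain w where "w \<in> PiE {..<n} Q" "i \<in> ?W w" by blast
    then show "i \<in> {i \<in> inj_tuples n. \<forall>j<n. i j \<in> (\<Union>q\<in>Q j. E q)}" by (auto dest: PiE_mem)
  qed
  have disjW: "?W w \<inter> ?W w' = {}" if ww: "w \<in> PiE {..<n} Q" "w' \<in> PiE {..<n} Q" "w \<noteq> w'" for w w'
  proof -
    obtain j where j: "j < n" "w j \<noteq> w' j" using PiE_ext[OF ww(1,2)] ww(3) by auto
    then have "E (w j) \<inter> E (w' j) = {}"
      using disjoint_family_onD[OF disj, of "w j" "w' j"] w[OF ww(1)] w[OF ww(2)] by simp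
    then show ?thesis using j(1) by blast
  qed
  show "finite {i \<in> inj_tuples n. \<forall>j<n. i j \<in> (\<Union>q\<in>Q j. E q)}"
    unfolding un using finPi cw by blast
  have "card (\<Union>w\<in>PiE {..<n} Q. ?W w) = (\<Sum>w\<in>PiE {..<n} Q. card (?W w))"
    by (rule card_UN_disjoint) (use finPi cw disjW in blast)+
  also have "\<dots> = (\<Sum>w\<in>PiE {..<n} Q. cellcount w n (\<lambda>q. card (E q)))"
    by (intro sum.cong refl) (use cw in blast)
  finally show "card {i \<in> inj_tuples n. \<forall>j<n. i j \<in> (\<Union>q\<in>Q j. E q)} = (\<Sum>w\<in>PiE {..<n} Q. cellcount w n (\<lambda>q. card (E q)))"
    unfolding un .
qed

lemma nn_integral_count_space_of_bool:
  assumes "finite {i \<in> S. P i}"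
  shows "(\<integral>\<^sup>+i. of_bool (P i) \<partial>count_space S) = of_nat (card {i \<in> S. P i})"
proof -
  have "(\<integral>\<^sup>+i. of_bool (P i) \<partial>count_space S) = (\<integral>\<^sup>+i. indicator {i \<in> S. P i} i \<partial>count_space S)"
    by (intro nn_integral_cong) (auto simp: indicator_def)
  also have "\<dots> = emeasure (count_space S) {i \<in> S. P i}" by (rule nn_integral_indicator) auto
  finally show ?thesis using assms by (subst (asm) emeasure_count_space_finite) (auto simp: ennreal_of_nat_eq_real_of_nat)
qed

context poisson_pp begin

text \<open>After cutting into atoms, the number of tuples in the rectangle is a sum of products of
  falling factorials of independent Poisson counts, and the event of exactly n points is an event
  about their sum. Each summand is then evaluated by
  \<open>nn_integral_cellcount_total\<close>.\<close>

lemma janossy_rectangle: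
  assumes A: "A \<in> sets borel" "emeasure L A < \<infinity>" and C: "\<And>j. j < n \<Longrightarrow> C j \<in> sets borel"
  shows "(\<integral>\<^sup>+\<omega>. of_bool (pcount \<kappa> X A \<omega> = enat n) *
        (\<integral>\<^sup>+i. of_bool (\<forall>j<n. i j \<in> pts \<kappa> X (A \<inter> C j) \<omega>) \<partial>count_space (inj_tuples n)) \<partial>M)
    = ennreal (exp (- enn2real (emeasure L A))) * (\<Prod>j<n. emeasure L (A \<inter> C j))"
proof -
  have "\<forall>j<n. C j \<in> sets borel" using C by blast
  from ex_partition[OF this A(1)] obtain p :: nat and D :: "nat \<Rightarrow> 'a set" and Q :: "nat \<Rightarrow> nat set"
    where p: "0 < p" and D: "\<And>q. D q \<in> sets borel" and disj: "disjoint_family_on D {..<p}"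
    and AD: "A = (\<Union>q<p. D q)" and Q: "\<And>j. j < n \<Longrightarrow> Q j \<subseteq> {..<p}"
    and CD: "\<And>j. j < n \<Longrightarrow> A \<inter> C j = (\<Union>q\<in>Q j. D q)"
    by blast
  have DA: "D q \<subseteq> A" if "q < p" for q using AD that by blast
  have finD: "emeasure L (D q) < \<infinity>" if "q < p" for q
    using emeasure_mono[OF DA[OF that], of L] A sets_L by (simp add: order_le_less_trans)
  define c where "c q = enn2real (emeasure L (D q))" for q
  have c0: "0 \<le> c q" for q by (simp add: c_def)
  have cD: "ennreal (c q) = emeasure L (D q)" if "q < p" for q
    using finD[OF that] by (simp add: c_def)
  have finQ: "finite (Q j)" if "j < n" for j using finite_subset[OF Q[OF that]] by simp
  have sumD: "emeasure L (\<Union>q\<in>R. D q) = (\<Sum>q\<in>R. ennreal (c q))" if "R \<subseteq> {..<p}" for R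
  proof -
    have "finite R" using finite_subset[OF that] by simp
    moreover have "disjoint_family_on D R" using disjoint_family_on_mono[OF that disj] .
    ultimately have "emeasure L (\<Union>q\<in>R. D q) = (\<Sum>q\<in>R. emeasure L (D q))"
      using D sets_L by (intro sum_emeasure[symmetric]) auto
    also have "\<dots> = (\<Sum>q\<in>R. ennreal (c q))" using that cD by (intro sum.cong refl) auto
    finally show ?thesis .
  qed
  have LA: "enn2real (emeasure L A) = (\<Sum>q<p. c q)"
  proof -
    have "emeasure L A = (\<Sum>q<p. ennreal (c q))" using sumD[of "{..<p}"] AD by simp
    also have "\<dots> = ennreal (\<Sum>q<p. c q)" by (rule sum_ennreal) (rule c0)
    finally show ?thesis using c0 by (simp add: sum_nonneg)
  qed
  let ?N = "\<lambda>\<omega>. \<lambda>q\<in>{..<p}. card (pts \<kappa> X (D q) \<omega>)"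
  let ?P = "PiM {..<p} (\<lambda>_. count_space (UNIV :: nat set))"
  have mN: "?N \<in> M \<rightarrow>\<^sub>M ?P"
  proof (rule measurable_restrict)
    fix q show "(\<lambda>\<omega>. card (pts \<kappa> X (D q) \<omega>)) \<in> M \<rightarrow>\<^sub>M count_space UNIV"
      unfolding enat_to_nat_pcount[symmetric] by (rule measurable_compose[OF measurable_pcount[OF D]]) simp
  qed
  let ?g = "\<lambda>w N. of_nat (cellcount w n N) * of_bool ((\<Sum>q<p. N q) = n) :: ennreal"
  have wQ: "w j < p" if "w \<in> PiE {..<n} Q" "j < n" for w j
    using PiE_mem[OF that(1), of j] Q[OF that(2)] that(2) by auto
  \<comment> \<open>A finite product of copies of the discrete space of naturals is discrete, so
    nothing has to be checked about the integrand.\<close>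
  have mg: "?g w \<in> borel_measurable ?P" if "w \<in> PiE {..<n} Q" for w
  proof -
    have "?P = count_space (PiE {..<p} (\<lambda>_. UNIV))" by (rule count_space_PiM_finite) auto
    then show ?thesis by simp
  qed
  have "(\<integral>\<^sup>+\<omega>. of_bool (pcount \<kappa> X A \<omega> = enat n) *
        (\<integral>\<^sup>+i. of_bool (\<forall>j<n. i j \<in> pts \<kappa> X (A \<inter> C j) \<omega>) \<partial>count_space (inj_tuples n)) \<partial>M)
    = (\<integral>\<^sup>+\<omega>. (\<Sum>w\<in>PiE {..<n} Q. ?g w (?N \<omega>)) \<partial>M)"
  proof (rule nn_integral_cong_AE, use AE_finite_pts[OF A] in eventually_elim)
    fix \<omega> assume fin: "finite (pts \<kappa> X A \<omega>)"
    let ?E = "\<lambda>q. pts \<kappa> X (D q) \<omega>"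
    have finE: "finite (?E q)" if "q < p" for q
      by (rule finite_subset[OF _ fin]) (use DA[OF that] in \<open>auto simp: pts_def\<close>)
    have disjE: "disjoint_family_on ?E {..<p}"
      using disj unfolding disjoint_family_on_def pts_def by blast
    have "pts \<kappa> X A \<omega> = (\<Union>q<p. ?E q)" using AD by (auto simp: pts_def)
    then have "card (pts \<kappa> X A \<omega>) = (\<Sum>q<p. card (?E q))"
      using finE disjE by (simp add: card_UN_disjoint' card_UN_disjoint disjoint_family_on_def)
    then have N: "pcount \<kappa> X A \<omega> = enat n \<longleftrightarrow> (\<Sum>q<p. ?N \<omega> q) = n" using fin by (simp add: pcount_eq)
    have "{i \<in> inj_tuples n. \<forall>j<n. i j \<in> pts \<kappa> X (A \<inter> C j) \<omega>} = {i \<in> inj_tuples n. \<forall>j<n. i j \<in> (\<Union>q\<in>Q j. ?E q)}"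
      using CD by (auto simp: pts_def)
    then have "(\<integral>\<^sup>+i. of_bool (\<forall>j<n. i j \<in> pts \<kappa> X (A \<inter> C j) \<omega>) \<partial>count_space (inj_tuples n))
      = of_nat (\<Sum>w\<in>PiE {..<n} Q. cellcount w n (\<lambda>q. card (?E q)))"
      using card_cell_tuples_union[of p ?E n Q] finE disjE Q by (subst nn_integral_count_space_of_bool) simp_all
    also have "\<dots> = (\<Sum>w\<in>PiE {..<n} Q. of_nat (cellcount w n (?N \<omega>)))"
    proof -
      have "cellcount w n (\<lambda>q. card (?E q)) = cellcount w n (?N \<omega>)" if "w \<in> PiE {..<n} Q" for w
        unfolding cellcount_def by (intro prod.cong refl) (use wQ[OF that] in simp)
      then show ?thesis by (simp cong: sum.cong)
    qed
    finally show "of_bool (pcount \<kappa> X A \<omega> = enat n) *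
        (\<integral>\<^sup>+i. of_bool (\<forall>j<n. i j \<in> pts \<kappa> X (A \<inter> C j) \<omega>) \<partial>count_space (inj_tuples n))
      = (\<Sum>w\<in>PiE {..<n} Q. ?g w (?N \<omega>))"
      unfolding N by (simp only: sum_distrib_left mult.commute)
  qed
  also have "\<dots> = (\<Sum>w\<in>PiE {..<n} Q. \<integral>\<^sup>+\<omega>. ?g w (?N \<omega>) \<partial>M)"
    by (rule nn_integral_sum) (rule measurable_compose[OF mN mg])
  also have "\<dots> = (\<Sum>w\<in>PiE {..<n} Q. (\<Prod>j<n. ennreal (c (w j))) * ennreal (exp (- (\<Sum>q<p. c q))))"
  proof (rule sum.cong[OF refl])
    fix w assume w: "w \<in> PiE {..<n} Q"
    have "(\<integral>\<^sup>+\<omega>. ?g w (?N \<omega>) \<partial>M) = (\<integral>\<^sup>+N. ?g w N \<partial>distr M ?P ?N)"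
      by (rule nn_integral_distr[OF mN, symmetric]) (simp only: measurable_distr_eq1 mg[OF w])
    also have "distr M ?P ?N = PiM {..<p} (\<lambda>q. measure_pmf (po (c q)))"
      unfolding c_def by (rule distr_counts[OF p D finD disj])
    also have "(\<integral>\<^sup>+N. ?g w N \<partial>PiM {..<p} (\<lambda>q. measure_pmf (po (c q)))) = (\<Prod>j<n. ennreal (c (w j))) * ennreal (exp (- (\<Sum>q<p. c q)))"
      using nn_integral_cellcount_total[of c "{..<p}" n w] c0 wQ[OF w] by simp
    finally show "(\<integral>\<^sup>+\<omega>. ?g w (?N \<omega>) \<partial>M) = (\<Prod>j<n. ennreal (c (w j))) * ennreal (exp (- (\<Sum>q<p. c q)))" .
  qed
  also have "\<dots> = (\<Sum>w\<in>PiE {..<n} Q. \<Prod>j<n. ennreal (c (w j))) * ennreal (exp (- (\<Sum>q<p. c q)))"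
    by (rule sum_distrib_right[symmetric])
  \<comment> \<open>Summing over all assignments of atoms is expanding a product of sums; each
    factor reassembles the mass of one side from its atoms.\<close>
  also have "(\<Sum>w\<in>PiE {..<n} Q. \<Prod>j<n. ennreal (c (w j))) = (\<Prod>j<n. \<Sum>q\<in>Q j. ennreal (c q))"
    by (rule prod_sum_PiE[symmetric]) (use finQ in auto)
  also have "\<dots> = (\<Prod>j<n. emeasure L (A \<inter> C j))"
    by (intro prod.cong refl) (use sumD[OF Q] CD in simp)
  finally show ?thesis unfolding LA by (simp only: mult.commute)
qed

end

text \<open>A hit is a finite set of naturals, hence coded by a natural number via \<open>set_encode\<close>.\<close>
lemma measurable_hits:
  fixes P :: "'w \<Rightarrow> nat set"
  assumes sym: "sym_set k H" and H: "H \<in> sets (PiM {..<k} (\<lambda>_. N))"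
    and X: "\<And>i. (\<lambda>\<omega>. X \<omega> i) \<in> M \<rightarrow>\<^sub>M N" and P: "\<And>j. Measurable.pred M (\<lambda>\<omega>. j \<in> P \<omega>)"
  shows measurable_ucount_random: "(\<lambda>\<omega>. ucount k H (P \<omega>) (X \<omega>)) \<in> M \<rightarrow>\<^sub>M count_space UNIV"
    and measurable_finite_hits: "Measurable.pred M (\<lambda>\<omega>. finite (hits k H (P \<omega>) (X \<omega>)))"
proof -
  let ?S = "\<lambda>\<omega>. {m. set_decode m \<subseteq> P \<omega> \<and> hit k H (X \<omega>) (set_decode m)}"
  have bij: "bij_betw set_decode (?S \<omega>) (hits k H (P \<omega>) (X \<omega>))" for \<omega>
  proof (rule bij_betw_byWitness[where f'=set_encode])
    show "\<forall>m\<in>?S \<omega>. set_encode (set_decode m) = m" by simp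
    show "\<forall>a\<in>hits k H (P \<omega>) (X \<omega>). set_decode (set_encode a) = a"
      by (auto simp: hits_def intro!: set_encode_inverse dest: hit_finite)
    show "set_decode ` ?S \<omega> \<subseteq> hits k H (P \<omega>) (X \<omega>)" by (auto simp: hits_def)
    show "set_encode ` hits k H (P \<omega>) (X \<omega>) \<subseteq> ?S \<omega>"
    proof (rule image_subsetI)
      fix a assume a: "a \<in> hits k H (P \<omega>) (X \<omega>)"
      then have "set_decode (set_encode a) = a" by (auto simp: hits_def intro!: set_encode_inverse dest: hit_finite)
      then show "set_encode a \<in> ?S \<omega>" using a by (simp add: hits_def)
    qed
  qed
  have S: "{\<omega> \<in> space M. m \<in> ?S \<omega>} \<in> sets M" for m
  proof -
    have [measurable]: "Measurable.pred M (\<lambda>\<omega>. hit k H (X \<omega>) (set_decode m))" by (rule measurable_hit[OF sym H X])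
    have [measurable]: "Measurable.pred M (\<lambda>\<omega>. \<forall>j\<in>set_decode m. j \<in> P \<omega>)"
      by (rule pred_intros_finite) (auto intro: P)
    have "Measurable.pred M (\<lambda>\<omega>. (\<forall>j\<in>set_decode m. j \<in> P \<omega>) \<and> hit k H (X \<omega>) (set_decode m))"
      by measurable
    then show ?thesis by (simp add: pred_def subset_eq)
  qed
  have eq: "ucount k H (P \<omega>) (X \<omega>) = card (?S \<omega>)" "finite (hits k H (P \<omega>) (X \<omega>)) = finite (?S \<omega>)" for \<omega>
    using bij_betw_same_card[OF bij] bij_betw_finite[OF bij] by (simp_all add: ucount_def)
  show "(\<lambda>\<omega>. ucount k H (P \<omega>) (X \<omega>)) \<in> M \<rightarrow>\<^sub>M count_space UNIV"
    unfolding eq by (rule measurable_card[OF S])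
  have [measurable]: "Measurable.pred M (\<lambda>\<omega>. m \<in> ?S \<omega>)" for m using S[of m] by (simp add: pred_def)
  \<comment> \<open>A set of naturals is finite iff it is bounded, which makes finiteness a
    countable combination of measurable events.\<close>
  have "Measurable.pred M (\<lambda>\<omega>. \<exists>b. \<forall>m. m \<in> ?S \<omega> \<longrightarrow> m < b)" by measurable
  moreover have "finite (?S \<omega>) \<longleftrightarrow> (\<exists>b. \<forall>m. m \<in> ?S \<omega> \<longrightarrow> m < b)" for \<omega>
    unfolding finite_nat_set_iff_bounded by blast
  ultimately show "Measurable.pred M (\<lambda>\<omega>. finite (hits k H (P \<omega>) (X \<omega>)))" unfolding eq by (simp only:)
qed

lemma emeasure_density_indicator_Int:
  assumes "A \<in> sets M" "E \<in> sets M"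
  shows "emeasure (density M (indicator A)) E = emeasure M (A \<inter> E)"
proof -
  have "emeasure (density M (indicator A)) E = (\<integral>\<^sup>+x. indicator (A \<inter> E) x \<partial>M)"
    unfolding indicator_inter_arith using assms by (intro emeasure_density) auto
  then show ?thesis using assms by simp
qed

lemma finite_measure_density_indicator:
  assumes "A \<in> sets M" "emeasure M A < \<infinity>"
  shows "finite_measure (density M (indicator A))"
proof
  have "emeasure (density M (indicator A)) (space (density M (indicator A))) = emeasure M A"
    using assms sets.sets_into_space[OF assms(1)] by (simp add: emeasure_density_indicator_Int Int_absorb2)
  then show "emeasure (density M (indicator A)) (space (density M (indicator A))) \<noteq> \<infinity>" using assms by simp
qed

context poisson_pp begin

abbreviation LA :: "'a set \<Rightarrow> 'a measure" where "LA A \<equiv> density L (indicator A)"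

text \<open>Summing over tuples and integrating over \<omega> defines a measure \<nu> on n-tuples of
  points. Its values on rectangles are known, and they determine it, so it is a multiple of the
  product measure and general integrands follow.\<close>

lemma janossy:
  assumes A: "A \<in> sets borel" "emeasure L A < \<infinity>" and F: "F \<in> borel_measurable (PiM {..<n} (\<lambda>_. borel))"
  shows "(\<integral>\<^sup>+\<omega>. of_bool (pcount \<kappa> X A \<omega> = enat n) * (\<integral>\<^sup>+i. of_bool (\<forall>j<n. i j \<in> pts \<kappa> X A \<omega>) *
        F (\<lambda>j\<in>{..<n}. X \<omega> (i j)) \<partial>count_space (inj_tuples n)) \<partial>M)
    = ennreal (exp (- enn2real (emeasure L A))) * (\<integral>\<^sup>+x. F x \<partial>PiM {..<n} (\<lambda>_. LA A))"
proof -
  let ?C = "count_space (inj_tuples n :: (nat \<Rightarrow> nat) set)" and ?B = "PiM {..<n} (\<lambda>_. borel :: 'a measure)"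
  let ?lam = "enn2real (emeasure L A)"
  define w :: "(nat \<Rightarrow> nat) \<times> 'w \<Rightarrow> ennreal"
    where "w z = of_bool (pcount \<kappa> X A (snd z) = enat n) * of_bool (\<forall>j<n. fst z j \<in> pts \<kappa> X A (snd z))" for z
  define g where "g z = (\<lambda>j\<in>{..<n}. X (snd z) (fst z j))" for z :: "(nat \<Rightarrow> nat) \<times> 'w"
  note cI = countable_inj_tuples
  interpret C: sigma_finite_measure ?C by (rule sigma_finite_measure_count_space_countable[OF cI])
  interpret CM: pair_sigma_finite ?C M ..
  have [measurable]: "Measurable.pred M (\<lambda>\<omega>. pcount \<kappa> X A \<omega> = enat n)"
    by (rule measurable_compose[OF measurable_pcount[OF A(1)]]) simp
  have [measurable]: "Measurable.pred M (\<lambda>\<omega>. j \<in> pts \<kappa> X A \<omega>)" for j by (rule measurable_pts[OF A(1)])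
  have mw: "w \<in> borel_measurable (?C \<Otimes>\<^sub>M M)"
  proof (rule measurable_pair_measure_countable1[OF cI])
    fix i :: "nat \<Rightarrow> nat"
    show "(\<lambda>\<omega>. w (i, \<omega>)) \<in> borel_measurable M" unfolding w_def fst_conv snd_conv by measurable
  qed
  have mg: "g \<in> ?C \<Otimes>\<^sub>M M \<rightarrow>\<^sub>M ?B"
  proof (rule measurable_pair_measure_countable1[OF cI])
    fix i :: "nat \<Rightarrow> nat"
    show "(\<lambda>\<omega>. g (i, \<omega>)) \<in> M \<rightarrow>\<^sub>M ?B" unfolding g_def fst_conv snd_conv by (intro measurable_restrict) simp
  qed
  define \<nu> where "\<nu> = distr (density (?C \<Otimes>\<^sub>M M) w) ?B g"
  have int\<nu>: "(\<integral>\<^sup>+x. G x \<partial>\<nu>) = (\<integral>\<^sup>+\<omega>. of_bool (pcount \<kappa> X A \<omega> = enat n) * (\<integral>\<^sup>+i. of_bool (\<forall>j<n. i j \<in> pts \<kappa> X A \<omega>) *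
        G (\<lambda>j\<in>{..<n}. X \<omega> (i j)) \<partial>?C) \<partial>M)" if G: "G \<in> borel_measurable ?B" for G
  proof -
    have "(\<integral>\<^sup>+x. G x \<partial>\<nu>) = (\<integral>\<^sup>+z. G (g z) \<partial>density (?C \<Otimes>\<^sub>M M) w)"
      unfolding \<nu>_def using mg G by (intro nn_integral_distr) (simp_all add: measurable_distr_eq1)
    also have "\<dots> = (\<integral>\<^sup>+z. w z * G (g z) \<partial>(?C \<Otimes>\<^sub>M M))"
      by (rule nn_integral_density[OF mw measurable_compose[OF mg G]])
    also have "\<dots> = (\<integral>\<^sup>+\<omega>. (\<integral>\<^sup>+i. w (i, \<omega>) * G (g (i, \<omega>)) \<partial>?C) \<partial>M)"
      by (rule CM.nn_integral_snd[symmetric]) (intro borel_measurable_times_ennreal mw measurable_compose[OF mg G])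
    also have "\<dots> = (\<integral>\<^sup>+\<omega>. of_bool (pcount \<kappa> X A \<omega> = enat n) * (\<integral>\<^sup>+i. of_bool (\<forall>j<n. i j \<in> pts \<kappa> X A \<omega>) *
        G (\<lambda>j\<in>{..<n}. X \<omega> (i j)) \<partial>?C) \<partial>M)"
      by (intro nn_integral_cong) (simp add: w_def g_def mult.assoc nn_integral_cmult)
    finally show ?thesis .
  qed
  interpret LA: finite_measure "LA A" by (rule finite_measure_density_indicator) (use A sets_L in auto)
  interpret PS: product_sigma_finite "\<lambda>_. LA A" ..
  have setsLA: "sets (LA A) = sets borel" using sets_L by simp
  \<comment> \<open>The factor exp(-lam) is moved to the side of \<nu>, so that the uniqueness of
    the bare product measure applies.\<close>
  have "scale_measure (ennreal (exp ?lam)) \<nu> = PiM {..<n} (\<lambda>_. LA A)"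
  proof (rule PS.PiM_eqI)
    show "sets (scale_measure (ennreal (exp ?lam)) \<nu>) = sets (PiM {..<n} (\<lambda>_. LA A))"
      by (simp add: \<nu>_def) (rule sets_PiM_cong, simp_all add: setsLA sets_L)
    fix E assume E: "\<And>j. j \<in> {..<n} \<Longrightarrow> E j \<in> sets (LA A)"
    then have E': "E j \<in> sets borel" if "j < n" for j using that setsLA by auto
    have PE: "PiE {..<n} E \<in> sets ?B" using E' by (intro sets_PiM_I_finite) auto
    have "emeasure \<nu> (PiE {..<n} E) = (\<integral>\<^sup>+x. indicator (PiE {..<n} E) x \<partial>\<nu>)"
      using PE by (subst nn_integral_indicator) (simp_all add: \<nu>_def)
    also have "\<dots> = (\<integral>\<^sup>+\<omega>. of_bool (pcount \<kappa> X A \<omega> = enat n) * (\<integral>\<^sup>+i. of_bool (\<forall>j<n. i j \<in> pts \<kappa> X A \<omega>) *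
        indicator (PiE {..<n} E) (\<lambda>j\<in>{..<n}. X \<omega> (i j)) \<partial>?C) \<partial>M)"
      using PE by (intro int\<nu>) simp
    also have "\<dots> = (\<integral>\<^sup>+\<omega>. of_bool (pcount \<kappa> X A \<omega> = enat n) * (\<integral>\<^sup>+i. of_bool (\<forall>j<n. i j \<in> pts \<kappa> X (A \<inter> E j) \<omega>) \<partial>?C) \<partial>M)"
    proof (intro nn_integral_cong arg_cong2[where f="(*)"] refl)
      fix \<omega> and i :: "nat \<Rightarrow> nat"
      have "(\<lambda>j\<in>{..<n}. X \<omega> (i j)) \<in> PiE {..<n} E \<longleftrightarrow> (\<forall>j<n. X \<omega> (i j) \<in> E j)"
        by (auto simp: PiE_iff)
      moreover have "(\<forall>j<n. i j \<in> pts \<kappa> X (A \<inter> E j) \<omega>) \<longleftrightarrow> (\<forall>j<n. i j \<in> pts \<kappa> X A \<omega>) \<and> (\<forall>j<n. X \<omega> (i j) \<in> E j)"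
        by (auto simp: pts_def)
      ultimately show "of_bool (\<forall>j<n. i j \<in> pts \<kappa> X A \<omega>) * indicator (PiE {..<n} E) (\<lambda>j\<in>{..<n}. X \<omega> (i j))
        = (of_bool (\<forall>j<n. i j \<in> pts \<kappa> X (A \<inter> E j) \<omega>) :: ennreal)"
        unfolding indicator_def by (simp only: of_bool_conj)
    qed
    also have "\<dots> = ennreal (exp (- ?lam)) * (\<Prod>j<n. emeasure L (A \<inter> E j))"
      by (rule janossy_rectangle[OF A E'])
    also have "(\<Prod>j<n. emeasure L (A \<inter> E j)) = (\<Prod>j<n. emeasure (LA A) (E j))"
    proof (intro prod.cong refl)
      fix j assume "j \<in> {..<n}"
      then show "emeasure L (A \<inter> E j) = emeasure (LA A) (E j)"
        using A E' sets_L by (subst emeasure_density_indicator_Int) auto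
    qed
    finally have "emeasure (scale_measure (ennreal (exp ?lam)) \<nu>) (PiE {..<n} E) =
      ennreal (exp ?lam) * (ennreal (exp (- ?lam)) * (\<Prod>j<n. emeasure (LA A) (E j)))" by simp
    also have "\<dots> = (\<Prod>j<n. emeasure (LA A) (E j))"
      by (simp only: mult.assoc[symmetric] ennreal_mult[symmetric] exp_ge_zero exp_minus_inverse ennreal_1 mult_1_left)
    finally show "emeasure (scale_measure (ennreal (exp ?lam)) \<nu>) (PiE {..<n} E) = (\<Prod>j<n. emeasure (LA A) (E j))" .
  qed simp
  then have "(\<integral>\<^sup>+x. F x \<partial>PiM {..<n} (\<lambda>_. LA A)) = ennreal (exp ?lam) * (\<integral>\<^sup>+x. F x \<partial>\<nu>)"
    using F by (subst nn_integral_scale_measure[symmetric]) (simp_all add: \<nu>_def)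
  then have "ennreal (exp (- ?lam)) * (\<integral>\<^sup>+x. F x \<partial>PiM {..<n} (\<lambda>_. LA A)) = (\<integral>\<^sup>+x. F x \<partial>\<nu>)"
    by (simp only: mult.assoc[symmetric] ennreal_mult[symmetric] exp_ge_zero mult_1_left ennreal_1
        mult.commute[of "exp (- ?lam)"] exp_minus_inverse)
  then show ?thesis using int\<nu>[OF F] by simp
qed

end

lemma card_inj_tuples_onto:
  assumes "finite P" "card P = n"
  shows "finite {i \<in> inj_tuples n. \<forall>j<n. i j \<in> P}" and "card {i \<in> inj_tuples n. \<forall>j<n. i j \<in> P} = fact n"
    and "i \<in> inj_tuples n \<Longrightarrow> \<forall>j<n. i j \<in> P \<Longrightarrow> i ` {..<n} = P"
proof -
  have eq: "{i \<in> inj_tuples n. \<forall>j<n. i j \<in> P} = {i \<in> {..<n} \<rightarrow>\<^sub>E P. inj_on i {..<n}}"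
    by (auto simp: inj_tuples_def PiE_def Pi_def)
  show "finite {i \<in> inj_tuples n. \<forall>j<n. i j \<in> P}"
    unfolding eq by (rule finite_subset[OF _ finite_PiE[of "{..<n}" "\<lambda>_. P"]]) (use assms in auto)
  have "card {i \<in> {..<n} \<rightarrow>\<^sub>E P. inj_on i {..<n}} = (\<Prod>j = 0..<n. n - j)"
    using card_inj_on_subset_funcset[of "{..<n}" P "{..<n}"] assms by simp
  then show "card {i \<in> inj_tuples n. \<forall>j<n. i j \<in> P} = fact n" unfolding eq by (simp add: fact_prod_rev)
  show "i ` {..<n} = P" if "i \<in> inj_tuples n" "\<forall>j<n. i j \<in> P"
    by (rule card_subset_eq) (use that assms in \<open>auto simp: inj_tuples_def card_image\<close>)
qed

context poisson_pp begin

text \<open>The count does not depend on the order of the points, so all n! enumerations of n points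
  give the same value. The sum over enumerations is n! times that value, whence the weight 1 /
  n!.\<close>

lemma poisson_functional:
  fixes \<phi> :: "nat \<Rightarrow> ennreal"
  assumes A: "A \<in> sets borel" "emeasure L A < \<infinity>"
    and sym: "sym_set k H" and H: "H \<in> sets (PiM {..<k} (\<lambda>_. borel))"
  shows "(\<integral>\<^sup>+\<omega>. \<phi> (ucount k H (pts \<kappa> X A \<omega>) (X \<omega>)) \<partial>M)
    = (\<Sum>n. ennreal (exp (- enn2real (emeasure L A)) / fact n) * (\<integral>\<^sup>+x. \<phi> (ucount k H {..<n} x) \<partial>PiM {..<n} (\<lambda>_. LA A)))"
proof -
  let ?lam = "enn2real (emeasure L A)"
  let ?I = "\<lambda>n. \<integral>\<^sup>+x. \<phi> (ucount k H {..<n} x) \<partial>PiM {..<n} (\<lambda>_. LA A)"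
  let ?s = "\<lambda>\<omega>. ucount k H (pts \<kappa> X A \<omega>) (X \<omega>)"
  let ?N = "\<lambda>n \<omega>. of_bool (pcount \<kappa> X A \<omega> = enat n) :: ennreal"
  have [measurable]: "?s \<in> M \<rightarrow>\<^sub>M count_space UNIV"
    by (rule measurable_ucount_random[OF sym H measurable_X measurable_pts[OF A(1)]])
  have [measurable]: "Measurable.pred M (\<lambda>\<omega>. pcount \<kappa> X A \<omega> = enat n)" for n
    by (rule measurable_compose[OF measurable_pcount[OF A(1)]]) simp
  have level: "(\<integral>\<^sup>+\<omega>. ?N n \<omega> * \<phi> (?s \<omega>) \<partial>M) = ennreal (exp (- ?lam) / fact n) * ?I n" for n
  proof -
    have mF: "(\<lambda>x. \<phi> (ucount k H {..<n} x)) \<in> borel_measurable (PiM {..<n} (\<lambda>_. borel))"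
      by (rule measurable_compose[OF measurable_ucount[OF _ sym H]]) auto
    have "ennreal (exp (- ?lam)) * ?I n = (\<integral>\<^sup>+\<omega>. ?N n \<omega> * (\<integral>\<^sup>+i. of_bool (\<forall>j<n. i j \<in> pts \<kappa> X A \<omega>) *
        \<phi> (ucount k H {..<n} (\<lambda>j\<in>{..<n}. X \<omega> (i j))) \<partial>count_space (inj_tuples n)) \<partial>M)"
      by (rule janossy[OF A mF, symmetric])
    also have "\<dots> = (\<integral>\<^sup>+\<omega>. of_nat (fact n) * (?N n \<omega> * \<phi> (?s \<omega>)) \<partial>M)"
    proof (rule nn_integral_cong)
      fix \<omega>
      show "?N n \<omega> * (\<integral>\<^sup>+i. of_bool (\<forall>j<n. i j \<in> pts \<kappa> X A \<omega>) *
        \<phi> (ucount k H {..<n} (\<lambda>j\<in>{..<n}. X \<omega> (i j))) \<partial>count_space (inj_tuples n)) = of_nat (fact n) * (?N n \<omega> * \<phi> (?s \<omega>))"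
      proof (cases "pcount \<kappa> X A \<omega> = enat n")
        case True
        then have P: "finite (pts \<kappa> X A \<omega>)" "card (pts \<kappa> X A \<omega>) = n" by (auto simp: pcount_eq split: if_splits)
        have "(\<integral>\<^sup>+i. of_bool (\<forall>j<n. i j \<in> pts \<kappa> X A \<omega>) * \<phi> (ucount k H {..<n} (\<lambda>j\<in>{..<n}. X \<omega> (i j))) \<partial>count_space (inj_tuples n))
          = (\<integral>\<^sup>+i. of_bool (\<forall>j<n. i j \<in> pts \<kappa> X A \<omega>) * \<phi> (?s \<omega>) \<partial>count_space (inj_tuples n))"
        proof (rule nn_integral_cong)
          fix i :: "nat \<Rightarrow> nat" assume "i \<in> space (count_space (inj_tuples n))"
          then have i: "i \<in> inj_tuples n" by simp
          show "of_bool (\<forall>j<n. i j \<in> pts \<kappa> X A \<omega>) * \<phi> (ucount k H {..<n} (\<lambda>j\<in>{..<n}. X \<omega> (i j)))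
            = of_bool (\<forall>j<n. i j \<in> pts \<kappa> X A \<omega>) * \<phi> (?s \<omega>)"
          proof (cases "\<forall>j<n. i j \<in> pts \<kappa> X A \<omega>")
            case True
            have "ucount k H {..<n} (\<lambda>j\<in>{..<n}. X \<omega> (i j)) = ucount k H {..<n} (\<lambda>j. X \<omega> (i j))"
              by (rule ucount_cong) simp
            also have "\<dots> = ucount k H (i ` {..<n}) (X \<omega>)" by (rule ucount_image) (use i in \<open>simp add: inj_tuples_def\<close>)
            also have "i ` {..<n} = pts \<kappa> X A \<omega>" by (rule card_inj_tuples_onto(3)[OF P i True])
            finally have e: "ucount k H {..<n} (\<lambda>j\<in>{..<n}. X \<omega> (i j)) = ?s \<omega>" .
            show ?thesis unfolding e ..
          qed (simp only: of_bool_eq mult_zero_left)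
        qed
        also have "\<dots> = (\<integral>\<^sup>+i. of_bool (\<forall>j<n. i j \<in> pts \<kappa> X A \<omega>) \<partial>count_space (inj_tuples n)) * \<phi> (?s \<omega>)"
          by (rule nn_integral_multc) simp
        also have "(\<integral>\<^sup>+i. of_bool (\<forall>j<n. i j \<in> pts \<kappa> X A \<omega>) \<partial>count_space (inj_tuples n)) = of_nat (fact n)"
          by (simp only: nn_integral_count_space_of_bool[OF card_inj_tuples_onto(1)[OF P]] card_inj_tuples_onto(2)[OF P])
        finally have e: "(\<integral>\<^sup>+i. of_bool (\<forall>j<n. i j \<in> pts \<kappa> X A \<omega>) *
            \<phi> (ucount k H {..<n} (\<lambda>j\<in>{..<n}. X \<omega> (i j))) \<partial>count_space (inj_tuples n)) = of_nat (fact n) * \<phi> (?s \<omega>)" .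
        show ?thesis unfolding e using True by simp
      qed (simp only: of_bool_eq mult_zero_left mult_zero_right)
    qed
    also have "\<dots> = of_nat (fact n) * (\<integral>\<^sup>+\<omega>. ?N n \<omega> * \<phi> (?s \<omega>) \<partial>M)" by (rule nn_integral_cmult) measurable
    finally have eq: "ennreal (exp (- ?lam)) * ?I n = ennreal (fact n) * (\<integral>\<^sup>+\<omega>. ?N n \<omega> * \<phi> (?s \<omega>) \<partial>M)"
      by (simp add: ennreal_of_nat_eq_real_of_nat)
    have "ennreal (exp (- ?lam) / fact n) * ?I n = ennreal (1 / fact n) * (ennreal (exp (- ?lam)) * ?I n)"
      by (simp add: mult.assoc[symmetric] ennreal_mult[symmetric])
    also have "\<dots> = ennreal (1 / fact n) * ennreal (fact n) * (\<integral>\<^sup>+\<omega>. ?N n \<omega> * \<phi> (?s \<omega>) \<partial>M)"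
      unfolding eq by (simp only: mult.assoc)
    also have "ennreal (1 / fact n) * ennreal (fact n) = 1"
      by (subst ennreal_mult[symmetric]) simp_all
    finally show ?thesis by simp
  qed
  \<comment> \<open>The events of exactly n points in \<open>A\<close> partition the space up to a
    null set, because the intensity of \<open>A\<close> is finite.\<close>
  have "(\<integral>\<^sup>+\<omega>. \<phi> (?s \<omega>) \<partial>M) = (\<integral>\<^sup>+\<omega>. (\<Sum>n. ?N n \<omega> * \<phi> (?s \<omega>)) \<partial>M)"
  proof (rule nn_integral_cong_AE, use AE_finite_pts[OF A] in eventually_elim)
    fix \<omega> assume "finite (pts \<kappa> X A \<omega>)"
    then have "pcount \<kappa> X A \<omega> = enat (card (pts \<kappa> X A \<omega>))" by (simp add: pcount_eq)
    then have "(\<Sum>n. ?N n \<omega> * \<phi> (?s \<omega>)) = (\<Sum>n\<in>{card (pts \<kappa> X A \<omega>)}. ?N n \<omega> * \<phi> (?s \<omega>))"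
      by (intro suminf_finite) auto
    then show "\<phi> (?s \<omega>) = (\<Sum>n. ?N n \<omega> * \<phi> (?s \<omega>))"
      using \<open>pcount \<kappa> X A \<omega> = enat (card (pts \<kappa> X A \<omega>))\<close> by simp
  qed
  also have "\<dots> = (\<Sum>n. \<integral>\<^sup>+\<omega>. ?N n \<omega> * \<phi> (?s \<omega>) \<partial>M)" by (rule nn_integral_suminf) measurable
  finally show ?thesis unfolding level .
qed

end

section \<open>Poisson processes\<close>

text \<open>Since (n choose r) / n! = 1 / (r! (n - r)!), taking r points out of a Poisson number of
  points leaves a Poisson number again with the same weights. Hence the Poisson case has no
  counterpart of the refilling error for n points.\<close>

lemma suminf_choose_shift:
  fixes G :: "nat \<Rightarrow> ennreal"
  assumes "0 \<le> e"
  shows "(\<Sum>n. ennreal (e / fact n) * (of_nat (n choose r) * G (n - r))) = ennreal (1 / fact r) * (\<Sum>n. ennreal (e / fact n) * G n)"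
proof -
  let ?f = "\<lambda>n. ennreal (e / fact n) * (of_nat (n choose r) * G (n - r))"
  have S: "?f (n + r) = ennreal (1 / fact r) * (ennreal (e / fact n) * G n)" for n
  proof -
    have "real ((n + r) choose r) = fact (n + r) / (fact r * fact n)"
      using binomial_fact[of r "n + r", where 'a=real] by simp
    then have "e / fact (n + r) * real ((n + r) choose r) = 1 / fact r * (e / fact n)" by simp
    then have "ennreal (e / fact (n + r)) * of_nat ((n + r) choose r) = ennreal (1 / fact r) * ennreal (e / fact n)"
      using assms by (simp add: ennreal_of_nat_eq_real_of_nat flip: ennreal_mult)
    then show ?thesis by (simp only: mult.assoc[symmetric] add_diff_cancel_right')
  qed
  have 0: "?f n = 0" if "n < r" for n
  proof -
    have "n choose r = 0" using that by simp
    then show ?thesis by (simp only: of_nat_0 mult_zero_left mult_zero_right)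
  qed
  have "(\<Sum>n. ?f n) = (\<Sum>n. ?f (n + r)) + (\<Sum>n<r. ?f n)"
    by (rule suminf_offset) (rule summableI)
  also have "(\<Sum>n<r. ?f n) = 0" using 0 by (intro sum.neutral) simp
  finally have "(\<Sum>n. ?f n) = (\<Sum>n. ?f (n + r))" by (simp only: add_0_right)
  also have "\<dots> = ennreal (1 / fact r) * (\<Sum>n. ennreal (e / fact n) * G n)"
    unfolding S by (rule ennreal_suminf_cmult)
  finally show ?thesis .
qed

lemma suminf_poisson_weights:
  assumes "0 \<le> c"
  shows "(\<Sum>n. ennreal (exp (- c) / fact n) * ennreal c ^ n) = 1"
proof -
  have "(\<lambda>n. exp (-c) * (c ^ n / fact n)) sums (exp (-c) * exp c)"
    by (rule sums_mult) (use exp_converges[of c] in \<open>simp add: scaleR_conv_of_real divide_inverse mult.commute\<close>)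
  then have s: "(\<lambda>n. exp (-c) / fact n * c ^ n) sums 1" by (simp add: exp_minus field_simps)
  have "(\<Sum>n. ennreal (exp (- c) / fact n) * ennreal c ^ n) = (\<Sum>n. ennreal (exp (-c) / fact n * c ^ n))"
    unfolding ennreal_power[OF assms]
    by (intro arg_cong[where f=suminf] ext ennreal_mult[symmetric]) (use assms in auto)
  also have "\<dots> = ennreal (\<Sum>n. exp (-c) / fact n * c ^ n)"
    using assms s by (intro suminf_ennreal2) (auto simp: sums_iff)
  finally show ?thesis using s by (simp add: sums_iff)
qed

text \<open>Origin of the constant 2^k / k!: the factors 1 / (k - l)! are bounded by 1 and the
  binomial coefficients by their full row sum.\<close>

lemma sum_overlap_le:
  fixes I :: "nat \<Rightarrow> ennreal"
  assumes I: "\<And>l. 1 \<le> l \<Longrightarrow> l < k \<Longrightarrow> I l \<le> R"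
  shows "(\<Sum>l\<in>{1..<k}. ennreal (real (k choose l) / (fact k * fact (k - l))) * I l) \<le> ennreal (2 ^ k / fact k) * R"
proof -
  have "(\<Sum>l\<in>{1..<k}. ennreal (real (k choose l) / (fact k * fact (k - l))) * I l)
    \<le> (\<Sum>l\<in>{1..<k}. ennreal (real (k choose l) / fact k) * R)"
  proof (intro sum_mono mult_mono ennreal_leI)
    fix l assume l: "l \<in> {1..<k}"
    have "real (k choose l) / (fact k * fact (k - l)) = real (k choose l) / fact k / fact (k - l)" by simp
    also have "\<dots> \<le> real (k choose l) / fact k / 1" by (intro divide_left_mono) (auto simp: fact_ge_1)
    finally show "real (k choose l) / (fact k * fact (k - l)) \<le> real (k choose l) / fact k" by simp
    show "I l \<le> R" using I l by simp
  qed auto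
  also have "\<dots> = (\<Sum>l\<in>{1..<k}. ennreal (real (k choose l) / fact k)) * R" by (rule sum_distrib_right[symmetric])
  also have "(\<Sum>l\<in>{1..<k}. ennreal (real (k choose l) / fact k)) = ennreal (\<Sum>l\<in>{1..<k}. real (k choose l) / fact k)"
    by (rule sum_ennreal) simp
  also have "\<dots> * R \<le> ennreal (2 ^ k / fact k) * R"
  proof (intro mult_right_mono ennreal_leI)
    have "(\<Sum>l\<in>{1..<k}. real (k choose l)) \<le> (\<Sum>l\<le>k. real (k choose l))" by (rule sum_mono2) auto
    also have "\<dots> = real (\<Sum>l\<le>k. k choose l)" by simp
    also have "\<dots> = 2 ^ k" unfolding choose_row_sum by simp
    finally show "(\<Sum>l\<in>{1..<k}. real (k choose l) / fact k) \<le> 2 ^ k / fact k"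
      by (simp add: sum_divide_distrib[symmetric] divide_right_mono)
  qed auto
  finally show ?thesis .
qed

lemma sum_atMost_split_ends:
  assumes "1 \<le> (k::nat)"
  shows "(\<Sum>l\<le>k. g l) = g 0 + g k + (\<Sum>l\<in>{1..<k}. g l :: ennreal)"
proof -
  have "{..k} = insert 0 (insert k {1..<k})" using assms by auto
  then show ?thesis using assms by (simp add: add.assoc)
qed

text \<open>Joins the two one-sided \<open>ennreal\<close> estimates into one bound on an absolute
  value. Finiteness of \<open>D\<close> is needed because \<open>enn2real\<close> would turn an
  infinite error into 0.\<close>

lemma (in prob_space) size_bias_real:
  fixes s :: "'a \<Rightarrow> nat" and D :: ennreal and \<phi> :: "nat \<Rightarrow> real"
  assumes s[measurable]: "s \<in> M \<rightarrow>\<^sub>M count_space UNIV" and int_s: "integrable M (\<lambda>\<omega>. real (s \<omega>))" and D: "D < \<infinity>"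
    and le: "\<And>\<phi>. (\<And>n. \<phi> n \<le> 2) \<Longrightarrow> (\<integral>\<^sup>+\<omega>. of_nat (s \<omega>) * \<phi> (s \<omega>) \<partial>M) \<le> (\<integral>\<^sup>+\<omega>. of_nat (s \<omega>) \<partial>M) * (\<integral>\<^sup>+\<omega>. \<phi> (Suc (s \<omega>)) \<partial>M) + 2 * D"
    and ge: "\<And>\<phi>. (\<And>n. \<phi> n \<le> 2) \<Longrightarrow> (\<integral>\<^sup>+\<omega>. of_nat (s \<omega>) \<partial>M) * (\<integral>\<^sup>+\<omega>. \<phi> (Suc (s \<omega>)) \<partial>M) \<le> (\<integral>\<^sup>+\<omega>. of_nat (s \<omega>) * \<phi> (s \<omega>) \<partial>M) + 2 * D"
    and \<phi>: "\<And>n. 0 \<le> \<phi> n" "\<And>n. \<phi> n \<le> 2"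
  shows "\<bar>expectation (\<lambda>\<omega>. real (s \<omega>) * \<phi> (s \<omega>)) - expectation (\<lambda>\<omega>. real (s \<omega>)) * expectation (\<lambda>\<omega>. \<phi> (Suc (s \<omega>)))\<bar> \<le> 2 * enn2real D"
proof -
  have i1: "integrable M (\<lambda>\<omega>. real (s \<omega>) * \<phi> (s \<omega>))"
  proof (rule Bochner_Integration.integrable_bound)
    show "integrable M (\<lambda>\<omega>. 2 * real (s \<omega>))" using int_s by simp
    show "AE \<omega> in M. norm (real (s \<omega>) * \<phi> (s \<omega>)) \<le> norm (2 * real (s \<omega>))"
    proof (intro AE_I2)
      fix \<omega> show "norm (real (s \<omega>) * \<phi> (s \<omega>)) \<le> norm (2 * real (s \<omega>))"
        using \<phi>[of "s \<omega>"] mult_left_mono[of "\<phi> (s \<omega>)" 2 "real (s \<omega>)"] by (simp add: abs_mult mult.commute)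
    qed
  qed simp
  have i2: "integrable M (\<lambda>\<omega>. \<phi> (Suc (s \<omega>)))"
    by (rule integrable_const_bound[where B=2]) (use \<phi> in auto)
  let ?a = "expectation (\<lambda>\<omega>. real (s \<omega>) * \<phi> (s \<omega>))" and ?m = "expectation (\<lambda>\<omega>. real (s \<omega>))"
    and ?f = "expectation (\<lambda>\<omega>. \<phi> (Suc (s \<omega>)))"
  have a: "(\<integral>\<^sup>+\<omega>. of_nat (s \<omega>) * ennreal (\<phi> (s \<omega>)) \<partial>M) = ennreal ?a"
    using nn_integral_eq_integral[OF i1] \<phi> by (simp add: ennreal_mult ennreal_of_nat_eq_real_of_nat)
  have m: "(\<integral>\<^sup>+\<omega>. of_nat (s \<omega>) \<partial>M) = ennreal ?m"
    using nn_integral_eq_integral[OF int_s] by (simp add: ennreal_of_nat_eq_real_of_nat)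
  have f: "(\<integral>\<^sup>+\<omega>. ennreal (\<phi> (Suc (s \<omega>))) \<partial>M) = ennreal ?f"
    using nn_integral_eq_integral[OF i2] \<phi> by simp
  have nn: "0 \<le> ?a" "0 \<le> ?m" "0 \<le> ?f" "0 \<le> enn2real D" using \<phi> by auto
  have p2: "ennreal (\<phi> n) \<le> 2" for n
    using \<phi>(2)[of n] ennreal_leI[of "\<phi> n" 2] by (simp add: ennreal_numeral[symmetric] del: ennreal_numeral)
  have D': "2 * D = ennreal (2 * enn2real D)"
    using D nn by (simp add: ennreal_mult)
  have "ennreal ?a \<le> ennreal (?m * ?f + 2 * enn2real D)"
    using le[of "\<lambda>n. ennreal (\<phi> n)", OF p2] nn unfolding a m f D' by (simp add: ennreal_mult ennreal_plus)
  then have 1: "?a \<le> ?m * ?f + 2 * enn2real D" using nn by (subst (asm) ennreal_le_iff) auto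
  have "ennreal (?m * ?f) \<le> ennreal (?a + 2 * enn2real D)"
    using ge[of "\<lambda>n. ennreal (\<phi> n)", OF p2] nn unfolding a m f D' by (simp add: ennreal_mult ennreal_plus)
  then have 2: "?m * ?f \<le> ?a + 2 * enn2real D" using nn by (subst (asm) ennreal_le_iff) auto
  show ?thesis using 1 2 by linarith
qed

locale poisson_stat = poisson_pp M \<kappa> X L for M :: "'w measure" and \<kappa> and X :: "'w \<Rightarrow> nat \<Rightarrow> 'a::topological_space" and L +
  fixes k :: nat and H :: "(nat \<Rightarrow> 'a) set"
  assumes k: "1 \<le> k" and sym: "sym_set k H" and H: "H \<in> sets (PiM {..<k} (\<lambda>_. borel))"
begin

abbreviation sA :: "'a set \<Rightarrow> 'w \<Rightarrow> nat" where "sA A \<omega> \<equiv> ucount k H (pts \<kappa> X A \<omega>) (X \<omega>)"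

lemma measurable_sA [measurable]: "A \<in> sets borel \<Longrightarrow> sA A \<in> M \<rightarrow>\<^sub>M count_space UNIV"
  by (rule measurable_ucount_random[OF sym H measurable_X measurable_pts])

lemma ustat_LA:
  assumes A: "A \<in> sets borel" "emeasure L A < \<infinity>"
  shows "ustat (LA A) k H"
proof -
  interpret finite_measure "LA A" by (rule finite_measure_density_indicator) (use A sets_L in auto)
  have "sets (PiM {..<k} (\<lambda>_. LA A)) = sets (PiM {..<k} (\<lambda>_. borel))"
    by (rule sets_PiM_cong) (simp_all add: sets_L)
  then show ?thesis by unfold_locales (use k sym H in auto)
qed

text \<open>The estimates for n points are averaged with the weights exp(-c) / n!. The terms with n
  - k points recombine into the mean times a full expectation, and \<open>D\<close> is the averaged
  \<open>excess\<close>.\<close>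

lemma truncated_size_bias:
  assumes A: "A \<in> sets borel" "emeasure L A < \<infinity>"
  obtains D :: ennreal where
    "\<And>\<phi>. (\<And>n. \<phi> n \<le> 2) \<Longrightarrow> (\<integral>\<^sup>+\<omega>. of_nat (sA A \<omega>) * \<phi> (sA A \<omega>) \<partial>M) \<le> (\<integral>\<^sup>+\<omega>. of_nat (sA A \<omega>) \<partial>M) * (\<integral>\<^sup>+\<omega>. \<phi> (Suc (sA A \<omega>)) \<partial>M) + 2 * D"
    "\<And>\<phi>. (\<And>n. \<phi> n \<le> 2) \<Longrightarrow> (\<integral>\<^sup>+\<omega>. of_nat (sA A \<omega>) \<partial>M) * (\<integral>\<^sup>+\<omega>. \<phi> (Suc (sA A \<omega>)) \<partial>M) \<le> (\<integral>\<^sup>+\<omega>. of_nat (sA A \<omega>) * \<phi> (sA A \<omega>) \<partial>M) + 2 * D"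
    "(\<integral>\<^sup>+\<omega>. of_nat (sA A \<omega>) * of_nat (sA A \<omega>) \<partial>M) = (\<integral>\<^sup>+\<omega>. of_nat (sA A \<omega>) \<partial>M) * (\<integral>\<^sup>+\<omega>. of_nat (Suc (sA A \<omega>)) \<partial>M) + D"
    "\<And>R. (\<And>l. 1 \<le> l \<Longrightarrow> l < k \<Longrightarrow> overlap k H (LA A) l \<le> R) \<Longrightarrow>
      (\<integral>\<^sup>+\<omega>. of_nat (sA A \<omega>) * of_nat (sA A \<omega>) \<partial>M) \<le> (\<integral>\<^sup>+\<omega>. of_nat (sA A \<omega>) \<partial>M)\<^sup>2 + (\<integral>\<^sup>+\<omega>. of_nat (sA A \<omega>) \<partial>M) + ennreal (2 ^ k / fact k) * R"
proof -
  interpret U: ustat "LA A" k H by (rule ustat_LA[OF A])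
  let ?lam = "enn2real (emeasure L A)"
  let ?a = "\<lambda>n. ennreal (exp (- ?lam) / fact n)"
  have func: "(\<integral>\<^sup>+\<omega>. \<phi> (sA A \<omega>) \<partial>M) = (\<Sum>n. ?a n * U.J n \<phi>)" for \<phi> :: "nat \<Rightarrow> ennreal"
    unfolding U.J_def by (rule poisson_functional[OF A sym H])
  have AL: "A \<in> sets L" using A sets_L by simp
  then have "A \<inter> space L = A" using sets.sets_into_space by blast
  then have mass: "U.mass = ennreal ?lam"
    unfolding U.mass_def using A emeasure_density_indicator_Int[OF AL sets.top] by simp
  let ?p = "ennreal (1 / fact k) * U.hitprob"
  have one: "(\<Sum>n. ?a n * U.mass ^ n) = 1" unfolding mass by (rule suminf_poisson_weights) simp
  have shift: "(\<Sum>n. ?a n * (of_nat (n choose k) * (U.hitprob * G (n - k)))) = ?p * (\<Sum>n. ?a n * G n)" for G :: "nat \<Rightarrow> ennreal"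
    using suminf_choose_shift[of "exp (- ?lam)" k "\<lambda>n. U.hitprob * G n"]
    by (simp add: mult.assoc ennreal_suminf_cmult mult.left_commute[of _ U.hitprob])
  have mean: "(\<integral>\<^sup>+\<omega>. of_nat (sA A \<omega>) \<partial>M) = ?p"
    unfolding func U.J_of_nat shift one by simp
  define D where "D = (\<Sum>n. ?a n * U.excess n)"
  have split2: "(\<Sum>n. ?a n * (b n + 2 * U.excess n)) = (\<Sum>n. ?a n * b n) + 2 * D" for b :: "nat \<Rightarrow> ennreal"
  proof -
    have "(\<Sum>n. ?a n * (b n + 2 * U.excess n)) = (\<Sum>n. ?a n * b n + 2 * (?a n * U.excess n))"
      by (intro arg_cong[where f=suminf] ext) (simp add: distrib_left mult.left_commute)
    also have "\<dots> = (\<Sum>n. ?a n * b n) + (\<Sum>n. 2 * (?a n * U.excess n))"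
      by (rule suminf_add[symmetric]) (rule summableI)+
    finally show ?thesis unfolding D_def by (simp only: ennreal_suminf_cmult)
  qed
  have mono: "(\<Sum>n. ?a n * b n) \<le> (\<Sum>n. ?a n * b' n)" if "\<And>n. b n \<le> b' n" for b b' :: "nat \<Rightarrow> ennreal"
    by (rule suminf_le) (use that in \<open>auto intro: mult_left_mono\<close>)
  have palm: "?p * (\<integral>\<^sup>+\<omega>. \<phi> (Suc (sA A \<omega>)) \<partial>M) = (\<Sum>n. ?a n * (of_nat (n choose k) * (U.hitprob * U.J (n - k) (\<lambda>s. \<phi> (Suc s)))))" for \<phi> :: "nat \<Rightarrow> ennreal"
    unfolding func[of "\<lambda>s. \<phi> (Suc s)"] by (rule shift[symmetric])
  show thesis
  proof (rule that[of D])
    fix \<phi> :: "nat \<Rightarrow> ennreal" assume \<phi>: "\<And>n. \<phi> n \<le> 2"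
    show "(\<integral>\<^sup>+\<omega>. of_nat (sA A \<omega>) * \<phi> (sA A \<omega>) \<partial>M) \<le> (\<integral>\<^sup>+\<omega>. of_nat (sA A \<omega>) \<partial>M) * (\<integral>\<^sup>+\<omega>. \<phi> (Suc (sA A \<omega>)) \<partial>M) + 2 * D"
      unfolding mean palm func[of "\<lambda>s. of_nat s * \<phi> s"] split2[symmetric]
      by (intro mono U.size_bias_le \<phi>)
    show "(\<integral>\<^sup>+\<omega>. of_nat (sA A \<omega>) \<partial>M) * (\<integral>\<^sup>+\<omega>. \<phi> (Suc (sA A \<omega>)) \<partial>M) \<le> (\<integral>\<^sup>+\<omega>. of_nat (sA A \<omega>) * \<phi> (sA A \<omega>) \<partial>M) + 2 * D"
      unfolding mean palm func[of "\<lambda>s. of_nat s * \<phi> s"] split2[symmetric]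
      by (intro mono U.size_bias_ge \<phi>)
  next
    have "(\<integral>\<^sup>+\<omega>. of_nat (sA A \<omega>) * of_nat (sA A \<omega>) \<partial>M) = (\<Sum>n. ?a n * U.J n (\<lambda>s. of_nat s * of_nat s))"
      by (rule func)
    also have "\<dots> = (\<Sum>n. ?a n * (of_nat (n choose k) * (U.hitprob * U.J (n - k) (\<lambda>s. of_nat (Suc s)))) + ?a n * U.excess n)"
      by (intro arg_cong[where f=suminf] ext) (simp only: U.size_bias_eq[of "\<lambda>_. 0"] distrib_left zero_le)
    also have "\<dots> = (\<Sum>n. ?a n * (of_nat (n choose k) * (U.hitprob * U.J (n - k) (\<lambda>s. of_nat (Suc s))))) + D"
      unfolding D_def by (rule suminf_add[symmetric]) (rule summableI)+
    finally show "(\<integral>\<^sup>+\<omega>. of_nat (sA A \<omega>) * of_nat (sA A \<omega>) \<partial>M) = (\<integral>\<^sup>+\<omega>. of_nat (sA A \<omega>) \<partial>M) * (\<integral>\<^sup>+\<omega>. of_nat (Suc (sA A \<omega>)) \<partial>M) + D"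
      unfolding mean palm[of of_nat] .
  next
    fix R assume R: "\<And>l. 1 \<le> l \<Longrightarrow> l < k \<Longrightarrow> overlap k H (LA A) l \<le> R"
    have inner: "(\<Sum>n. ?a n * (of_nat ((n choose k) * (k choose l) * ((n - k) choose (k - l))) * (overlap k H (LA A) l * U.mass ^ (n + l - 2*k))))
        = ennreal (real (k choose l) / (fact k * fact (k - l))) * overlap k H (LA A) l" if l: "l \<le> k" for l
    proof -
      let ?c = "of_nat (k choose l) * overlap k H (LA A) l"
      have e: "n + l - 2*k = n - k - (k - l)" for n using l by simp
      have "(\<Sum>n. ?a n * (of_nat ((n choose k) * (k choose l) * ((n - k) choose (k - l))) * (overlap k H (LA A) l * U.mass ^ (n + l - 2*k))))
        = (\<Sum>n. ?a n * (of_nat (n choose k) * (of_nat ((n - k) choose (k - l)) * (?c * U.mass ^ (n - k - (k - l))))))"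
        unfolding e by (intro arg_cong[where f=suminf] ext) (simp only: of_nat_mult mult.assoc mult.left_commute)
      \<comment> \<open>The shift is used twice: once for the k points of the first hit, then for
        the k - l points that the second hit adds.\<close>
      also have "\<dots> = ennreal (1 / fact k) * (\<Sum>n. ?a n * (of_nat (n choose (k - l)) * (?c * U.mass ^ (n - (k - l)))))"
        by (rule suminf_choose_shift) simp
      also have "(\<Sum>n. ?a n * (of_nat (n choose (k - l)) * (?c * U.mass ^ (n - (k - l))))) = ennreal (1 / fact (k - l)) * (\<Sum>n. ?a n * (?c * U.mass ^ n))"
        by (rule suminf_choose_shift) simp
      also have "(\<Sum>n. ?a n * (?c * U.mass ^ n)) = ?c"
        using one by (simp add: mult.left_commute[of _ ?c] ennreal_suminf_cmult)
      also have "ennreal (1 / fact k) * (ennreal (1 / fact (k - l)) * ?c) = ennreal (1 / fact k * (1 / fact (k - l)) * real (k choose l)) * overlap k H (LA A) l"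
      proof -
        have "ennreal (1 / fact k * (1 / fact (k - l)) * real (k choose l)) = ennreal (1 / fact k) * ennreal (1 / fact (k - l)) * of_nat (k choose l)"
          unfolding ennreal_of_nat_eq_real_of_nat by (subst ennreal_mult, simp, simp, subst ennreal_mult) simp_all
        then show ?thesis by (simp only: mult.assoc)
      qed
      finally show ?thesis by simp
    qed
    have "(\<integral>\<^sup>+\<omega>. of_nat (sA A \<omega>) * of_nat (sA A \<omega>) \<partial>M) = (\<Sum>n. ?a n * U.J n (\<lambda>s. of_nat s * of_nat s))"
      by (rule func)
    also have "\<dots> = (\<Sum>n. \<Sum>l\<le>k. ?a n * (of_nat ((n choose k) * (k choose l) * ((n - k) choose (k - l))) * (overlap k H (LA A) l * U.mass ^ (n + l - 2*k))))"
      unfolding U.second_moment by (simp only: sum_distrib_left)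
    also have "\<dots> = (\<Sum>l\<le>k. \<Sum>n. ?a n * (of_nat ((n choose k) * (k choose l) * ((n - k) choose (k - l))) * (overlap k H (LA A) l * U.mass ^ (n + l - 2*k))))"
      by (rule suminf_sum) (rule summableI)
    also have "\<dots> = (\<Sum>l\<le>k. ennreal (real (k choose l) / (fact k * fact (k - l))) * overlap k H (LA A) l)"
      by (intro sum.cong refl inner) simp
    also have "\<dots> = ennreal (1 / (fact k * fact k)) * U.hitprob\<^sup>2 + ?p + (\<Sum>l\<in>{1..<k}. ennreal (real (k choose l) / (fact k * fact (k - l))) * overlap k H (LA A) l)"
      unfolding sum_atMost_split_ends[OF k] U.overlap_0 U.overlap_k by simp
    also have "ennreal (1 / (fact k * fact k)) * U.hitprob\<^sup>2 = ?p\<^sup>2"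
    proof -
      have "ennreal (1 / (fact k * fact k)) = ennreal (1 / fact k) * ennreal (1 / fact k)"
        by (subst ennreal_mult[symmetric]) simp_all
      then show ?thesis by (simp only: power2_eq_square mult.assoc mult.left_commute)
    qed
    also have "?p\<^sup>2 + ?p + (\<Sum>l\<in>{1..<k}. ennreal (real (k choose l) / (fact k * fact (k - l))) * overlap k H (LA A) l) \<le> ?p\<^sup>2 + ?p + ennreal (2 ^ k / fact k) * R"
      by (intro add_left_mono sum_overlap_le R)
    finally show "(\<integral>\<^sup>+\<omega>. of_nat (sA A \<omega>) * of_nat (sA A \<omega>) \<partial>M) \<le> (\<integral>\<^sup>+\<omega>. of_nat (sA A \<omega>) \<partial>M)\<^sup>2 + (\<integral>\<^sup>+\<omega>. of_nat (sA A \<omega>) \<partial>M) + ennreal (2 ^ k / fact k) * R"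
      unfolding mean .
  qed
qed

end

section \<open>Overlap integrals under restriction of the intensity measure\<close>

lemma measurable_join_tuple_pair:
  assumes "l \<le> k"
  shows "(\<lambda>(x, y). join_tuple k l x y) \<in> PiM {..<l} (\<lambda>_. L) \<Otimes>\<^sub>M PiM {..<k-l} (\<lambda>_. L) \<rightarrow>\<^sub>M PiM {..<k} (\<lambda>_. L)"
  unfolding join_tuple_def split_beta
proof (rule measurable_restrict)
  fix j assume j: "j \<in> {..<k}"
  show "(\<lambda>z. if j < l then fst z j else snd z (j - l)) \<in> PiM {..<l} (\<lambda>_. L) \<Otimes>\<^sub>M PiM {..<k-l} (\<lambda>_. L) \<rightarrow>\<^sub>M L"
  proof (cases "j < l")
    case True
    then show ?thesis by (simp add: measurable_compose[OF measurable_fst measurable_component_singleton])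
  next
    case False
    then have "j - l \<in> {..<k-l}" using j assms by auto
    then show ?thesis using False by (simp add: measurable_compose[OF measurable_snd measurable_component_singleton])
  qed
qed

lemma measurable_overlap_inner:
  assumes "sigma_finite_measure L" "l \<le> k" "H \<in> sets (PiM {..<k} (\<lambda>_. L))"
  shows "(\<lambda>x. (\<integral>\<^sup>+y. indicator H (join_tuple k l x y) \<partial>PiM {..<k-l} (\<lambda>_. L))) \<in> borel_measurable (PiM {..<l} (\<lambda>_. L))"
    and "x \<in> space (PiM {..<l} (\<lambda>_. L)) \<Longrightarrow> (\<lambda>y. indicator H (join_tuple k l x y) :: ennreal) \<in> borel_measurable (PiM {..<k-l} (\<lambda>_. L))"
proof -
  interpret L: sigma_finite_measure L by fact
  interpret product_sigma_finite "\<lambda>_::nat. L" ..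
  interpret P: finite_product_sigma_finite "\<lambda>_::nat. L" "{..<k-l}" by standard simp
  have m: "(\<lambda>z. indicator H (case z of (x, y) \<Rightarrow> join_tuple k l x y) :: ennreal) \<in> borel_measurable (PiM {..<l} (\<lambda>_. L) \<Otimes>\<^sub>M PiM {..<k-l} (\<lambda>_. L))"
    by (rule measurable_compose[OF measurable_join_tuple_pair[OF assms(2)]]) (use assms(3) in simp)
  show "(\<lambda>x. (\<integral>\<^sup>+y. indicator H (join_tuple k l x y) \<partial>PiM {..<k-l} (\<lambda>_. L))) \<in> borel_measurable (PiM {..<l} (\<lambda>_. L))"
    using P.borel_measurable_nn_integral_fst[OF m] by simp
  show "(\<lambda>y. indicator H (join_tuple k l x y) :: ennreal) \<in> borel_measurable (PiM {..<k-l} (\<lambda>_. L))"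
    if "x \<in> space (PiM {..<l} (\<lambda>_. L))"
    using measurable_compose[OF measurable_Pair1'[OF that] m] by simp
qed

lemma PiM_density_indicator:
  assumes L: "sigma_finite_measure L" and A: "A \<in> sets L" and I: "finite I"
  shows "PiM I (\<lambda>_. density L (indicator A)) = density (PiM I (\<lambda>_. L)) (\<lambda>x. \<Prod>i\<in>I. indicator A (x i))"
proof -
  interpret L: sigma_finite_measure L by fact
  interpret PL: product_sigma_finite "\<lambda>_. L" ..
  have fin: "sigma_finite_measure (density L (indicator A))"
    by (rule L.sigma_finite_iff_density_finite[THEN iffD2]) (use A in \<open>auto simp: indicator_def\<close>)
  interpret PA: product_sigma_finite "\<lambda>_. density L (indicator A)"
    by (rule product_sigma_finite.intro) (rule fin)
  have m: "(\<lambda>x. \<Prod>i\<in>I. indicator A (x i) :: ennreal) \<in> borel_measurable (PiM I (\<lambda>_. L))"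
    using A by (intro borel_measurable_prod_ennreal measurable_compose[OF measurable_component_singleton]) auto
  show ?thesis
  proof (rule PA.PiM_eqI[OF I, symmetric])
    show "sets (density (PiM I (\<lambda>_. L)) (\<lambda>x. \<Prod>i\<in>I. indicator A (x i))) = sets (PiM I (\<lambda>_. density L (indicator A)))"
      by simp (rule sets_PiM_cong, simp_all)
    fix E assume E: "\<And>i. i \<in> I \<Longrightarrow> E i \<in> sets (density L (indicator A))"
    then have E': "E i \<in> sets L" if "i \<in> I" for i using that by simp
    have "emeasure (density (PiM I (\<lambda>_. L)) (\<lambda>x. \<Prod>i\<in>I. indicator A (x i))) (PiE I E)
      = (\<integral>\<^sup>+x. (\<Prod>i\<in>I. indicator A (x i)) * indicator (PiE I E) x \<partial>PiM I (\<lambda>_. L))"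
      by (rule emeasure_density[OF m]) (use E' I in \<open>auto intro!: sets_PiM_I_finite\<close>)
    also have "\<dots> = (\<integral>\<^sup>+x. (\<Prod>i\<in>I. indicator (A \<inter> E i) (x i)) \<partial>PiM I (\<lambda>_. L))"
    proof (rule nn_integral_cong)
      fix x assume "x \<in> space (PiM I (\<lambda>_. L))"
      then have "x \<in> extensional I" by (simp add: space_PiM PiE_def)
      then have "(indicator (PiE I E) x :: ennreal) = of_bool (\<forall>i\<in>I. x i \<in> E i)"
        by (auto simp: indicator_def PiE_def Pi_def)
      also have "\<dots> = (\<Prod>i\<in>I. indicator (E i) (x i))"
        using I by (induction I rule: finite_induct) (simp_all add: indicator_def)
      finally show "(\<Prod>i\<in>I. indicator A (x i)) * indicator (PiE I E) x = (\<Prod>i\<in>I. indicator (A \<inter> E i) (x i) :: ennreal)"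
        by (simp only: prod.distrib[symmetric] indicator_inter_arith)
    qed
    also have "\<dots> = (\<Prod>i\<in>I. \<integral>\<^sup>+x. indicator (A \<inter> E i) x \<partial>L)"
      by (rule PL.product_nn_integral_prod[OF I]) (use A E' in auto)
    also have "\<dots> = (\<Prod>i\<in>I. emeasure (density L (indicator A)) (E i))"
      by (intro prod.cong refl) (use A E' in \<open>simp add: emeasure_density_indicator_Int\<close>)
    finally show "emeasure (density (PiM I (\<lambda>_. L)) (\<lambda>x. \<Prod>i\<in>I. indicator A (x i))) (PiE I E) = (\<Prod>i\<in>I. emeasure (density L (indicator A)) (E i))" .
  qed
qed

lemma nn_integral_PiM_density_le:
  assumes L: "sigma_finite_measure L" and A: "A \<in> sets L" and I: "finite I" and F: "F \<in> borel_measurable (PiM I (\<lambda>_. L))"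
  shows "(\<integral>\<^sup>+x. F x \<partial>PiM I (\<lambda>_. density L (indicator A))) \<le> (\<integral>\<^sup>+x. F x \<partial>PiM I (\<lambda>_. L))"
proof -
  have m: "(\<lambda>x. \<Prod>i\<in>I. indicator A (x i) :: ennreal) \<in> borel_measurable (PiM I (\<lambda>_. L))"
    using A by (intro borel_measurable_prod_ennreal measurable_compose[OF measurable_component_singleton]) auto
  have le1: "(\<Prod>i\<in>I. indicator A (x i) :: ennreal) \<le> 1" for x
    by (rule prod_le_1) (auto simp: indicator_def)
  have "(\<integral>\<^sup>+x. F x \<partial>PiM I (\<lambda>_. density L (indicator A))) = (\<integral>\<^sup>+x. (\<Prod>i\<in>I. indicator A (x i)) * F x \<partial>PiM I (\<lambda>_. L))"
    unfolding PiM_density_indicator[OF L A I] by (rule nn_integral_density[OF m F])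
  also have "\<dots> \<le> (\<integral>\<^sup>+x. F x \<partial>PiM I (\<lambda>_. L))"
    by (intro nn_integral_mono) (use mult_right_mono[OF le1] in force)
  finally show ?thesis .
qed

text \<open>Restriction is a density bounded by 1, applied once inside and once outside the square.
  The overlap integrals of the full measure therefore bound all truncated ones uniformly.\<close>

lemma overlap_density_le:
  assumes L: "sigma_finite_measure L" and A: "A \<in> sets L" and l: "l \<le> k" and H: "H \<in> sets (PiM {..<k} (\<lambda>_. L))"
  shows "overlap k H (density L (indicator A)) l \<le> overlap k H L l"
proof -
  let ?G = "\<lambda>x. (\<integral>\<^sup>+y. indicator H (join_tuple k l x y) \<partial>PiM {..<k-l} (\<lambda>_. L))\<^sup>2"
  have "overlap k H (density L (indicator A)) l \<le> (\<integral>\<^sup>+x. ?G x \<partial>PiM {..<l} (\<lambda>_. density L (indicator A)))"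
    unfolding overlap_def
  proof (intro nn_integral_mono power_mono)
    fix x assume "x \<in> space (PiM {..<l} (\<lambda>_. density L (indicator A)))"
    then have "x \<in> space (PiM {..<l} (\<lambda>_. L))" by (simp add: space_PiM)
    then show "(\<integral>\<^sup>+y. indicator H (join_tuple k l x y) \<partial>PiM {..<k-l} (\<lambda>_. density L (indicator A)))
      \<le> (\<integral>\<^sup>+y. indicator H (join_tuple k l x y) \<partial>PiM {..<k-l} (\<lambda>_. L))"
      by (intro nn_integral_PiM_density_le[OF L A] measurable_overlap_inner(2)[OF L l H]) auto
  qed simp
  also have "\<dots> \<le> (\<integral>\<^sup>+x. ?G x \<partial>PiM {..<l} (\<lambda>_. L))"
    unfolding power2_eq_square
    by (intro nn_integral_PiM_density_le[OF L A] borel_measurable_times_ennreal measurable_overlap_inner(1)[OF L l H]) auto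
  finally show ?thesis unfolding overlap_def .
qed

section \<open>From sets of finite intensity to the whole space\<close>

context poisson_stat begin

text \<open>The case \<phi> = id of the size-bias relation is an exact equation for the error
  \<open>D\<close>. It shows that \<open>D\<close> is finite, being a summand of a finite second
  moment, and solving it puts moments in place of \<open>D\<close> in the estimate for general
  \<phi>.\<close>

lemma truncated_real:
  assumes A: "A \<in> sets borel" "emeasure L A < \<infinity>"
    and int1: "integrable M (\<lambda>\<omega>. real (sA A \<omega>))" and int2: "integrable M (\<lambda>\<omega>. (real (sA A \<omega>))\<^sup>2)"
  defines "m \<equiv> expectation (\<lambda>\<omega>. real (sA A \<omega>))" and "m2 \<equiv> expectation (\<lambda>\<omega>. (real (sA A \<omega>))\<^sup>2)"
  shows "(\<And>n. 0 \<le> \<phi> n) \<Longrightarrow> (\<And>n. \<phi> n \<le> 2) \<Longrightarrow>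
      \<bar>expectation (\<lambda>\<omega>. real (sA A \<omega>) * \<phi> (sA A \<omega>)) - m * expectation (\<lambda>\<omega>. \<phi> (Suc (sA A \<omega>)))\<bar> \<le> 2 * (m2 - m - m\<^sup>2)"
    and "0 \<le> r \<Longrightarrow> (\<And>l. 1 \<le> l \<Longrightarrow> l < k \<Longrightarrow> overlap k H (LA A) l \<le> ennreal r) \<Longrightarrow> m2 \<le> m\<^sup>2 + m + 2 ^ k / fact k * r"
proof -
  interpret U: ustat "LA A" k H by (rule ustat_LA[OF A])
  obtain D where le: "\<And>\<phi>. (\<And>n. \<phi> n \<le> 2) \<Longrightarrow> (\<integral>\<^sup>+\<omega>. of_nat (sA A \<omega>) * \<phi> (sA A \<omega>) \<partial>M) \<le> (\<integral>\<^sup>+\<omega>. of_nat (sA A \<omega>) \<partial>M) * (\<integral>\<^sup>+\<omega>. \<phi> (Suc (sA A \<omega>)) \<partial>M) + 2 * D"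
    and ge: "\<And>\<phi>. (\<And>n. \<phi> n \<le> 2) \<Longrightarrow> (\<integral>\<^sup>+\<omega>. of_nat (sA A \<omega>) \<partial>M) * (\<integral>\<^sup>+\<omega>. \<phi> (Suc (sA A \<omega>)) \<partial>M) \<le> (\<integral>\<^sup>+\<omega>. of_nat (sA A \<omega>) * \<phi> (sA A \<omega>) \<partial>M) + 2 * D"
    and eq: "(\<integral>\<^sup>+\<omega>. of_nat (sA A \<omega>) * of_nat (sA A \<omega>) \<partial>M) = (\<integral>\<^sup>+\<omega>. of_nat (sA A \<omega>) \<partial>M) * (\<integral>\<^sup>+\<omega>. of_nat (Suc (sA A \<omega>)) \<partial>M) + D"
    and R: "\<And>R. (\<And>l. 1 \<le> l \<Longrightarrow> l < k \<Longrightarrow> overlap k H (LA A) l \<le> R) \<Longrightarrow>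
      (\<integral>\<^sup>+\<omega>. of_nat (sA A \<omega>) * of_nat (sA A \<omega>) \<partial>M) \<le> (\<integral>\<^sup>+\<omega>. of_nat (sA A \<omega>) \<partial>M)\<^sup>2 + (\<integral>\<^sup>+\<omega>. of_nat (sA A \<omega>) \<partial>M) + ennreal (2 ^ k / fact k) * R"
    using truncated_size_bias[OF A] by blast
  have [measurable]: "sA A \<in> M \<rightarrow>\<^sub>M count_space UNIV" by (rule measurable_sA[OF A(1)])
  have nn: "0 \<le> m" "0 \<le> m2" by (simp_all add: m_def m2_def)
  have e1: "(\<integral>\<^sup>+\<omega>. of_nat (sA A \<omega>) \<partial>M) = ennreal m"
    unfolding m_def using nn_integral_eq_integral[OF int1] by (simp add: ennreal_of_nat_eq_real_of_nat)
  have e2: "(\<integral>\<^sup>+\<omega>. of_nat (sA A \<omega>) * of_nat (sA A \<omega>) \<partial>M) = ennreal m2"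
    unfolding m2_def using nn_integral_eq_integral[OF int2]
    by (simp add: ennreal_of_nat_eq_real_of_nat ennreal_mult[symmetric] power2_eq_square)
  have e3: "(\<integral>\<^sup>+\<omega>. of_nat (Suc (sA A \<omega>)) \<partial>M) = ennreal (1 + m)"
    using e1 nn by (simp add: nn_integral_add emeasure_space_1 ennreal_plus)
  have eq': "ennreal m2 = ennreal (m * (1 + m)) + D"
    using eq nn unfolding e1 e2 e3 by (simp add: ennreal_mult)
  then have D: "D < \<infinity>" 
  proof -
    have "D \<noteq> top"
    proof
      assume "D = top"
      then have "ennreal m2 = top" using eq' by simp
      then show False by simp
    qed
    then show ?thesis by (simp add: less_top)
  qed
  have "ennreal m2 = ennreal (m * (1 + m) + enn2real D)"
    using eq' D nn by (simp add: ennreal_plus)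
  then have "m2 = m * (1 + m) + enn2real D" using nn by (subst (asm) ennreal_inj) auto
  then have Dv: "enn2real D = m2 - m - m\<^sup>2" by (simp add: power2_eq_square algebra_simps)
  show "\<bar>expectation (\<lambda>\<omega>. real (sA A \<omega>) * \<phi> (sA A \<omega>)) - m * expectation (\<lambda>\<omega>. \<phi> (Suc (sA A \<omega>)))\<bar> \<le> 2 * (m2 - m - m\<^sup>2)"
    if "\<And>n. 0 \<le> \<phi> n" "\<And>n. \<phi> n \<le> 2"
  proof -
    have "\<bar>expectation (\<lambda>\<omega>. real (sA A \<omega>) * \<phi> (sA A \<omega>)) - m * expectation (\<lambda>\<omega>. \<phi> (Suc (sA A \<omega>)))\<bar> \<le> 2 * enn2real D"
      unfolding m_def by (rule size_bias_real[OF _ int1 D le ge that]) auto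
    then show ?thesis unfolding Dv .
  qed
  show "m2 \<le> m\<^sup>2 + m + 2 ^ k / fact k * r"
    if r: "0 \<le> r" and I: "\<And>l. 1 \<le> l \<Longrightarrow> l < k \<Longrightarrow> overlap k H (LA A) l \<le> ennreal r"
  proof -
    have "ennreal m2 \<le> (ennreal m)\<^sup>2 + ennreal m + ennreal (2 ^ k / fact k) * ennreal r"
      using R[of "ennreal r"] I unfolding e1 e2 by blast
    also have "\<dots> = ennreal (m\<^sup>2 + m + 2 ^ k / fact k * r)"
    proof -
      have "ennreal (2 ^ k / fact k) * ennreal r = ennreal (2 ^ k / fact k * r)"
        by (rule ennreal_mult[symmetric]) (use r in auto)
      then show ?thesis using nn r by (simp add: ennreal_power ennreal_plus)
    qed
    finally show ?thesis using nn r by (subst (asm) ennreal_le_iff) auto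
  qed
qed

text \<open>Finitely many hits involve finitely many points altogether, and each of these lies in
  \<open>A N\<close> from some N on. So the truncated count becomes constant instead of merely
  converging.\<close>

lemma truncation_limit:
  fixes A :: "nat \<Rightarrow> 'a set"
  assumes A: "incseq A" "(\<Union>i. A i) = UNIV" and fin: "finite (hits k H (pts \<kappa> X UNIV \<omega>) (X \<omega>))"
  shows "sA (A N) \<omega> \<le> sA UNIV \<omega>" and "eventually (\<lambda>N. sA (A N) \<omega> = sA UNIV \<omega>) sequentially"
proof -
  have sub: "hits k H (pts \<kappa> X (A N) \<omega>) (X \<omega>) \<subseteq> hits k H (pts \<kappa> X UNIV \<omega>) (X \<omega>)" for N
    by (auto simp: hits_def pts_def)
  show "sA (A N) \<omega> \<le> sA UNIV \<omega>" unfolding ucount_def by (rule card_mono[OF fin sub])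
  let ?F = "\<Union>(hits k H (pts \<kappa> X UNIV \<omega>) (X \<omega>))"
  have "finite ?F" using fin by (rule finite_Union) (auto simp: hits_def dest: hit_finite)
  moreover have "\<forall>j\<in>?F. eventually (\<lambda>N. X \<omega> j \<in> A N) sequentially"
  proof
    fix j
    have "X \<omega> j \<in> (\<Union>i. A i)" unfolding A(2) by simp
    then obtain N0 where "X \<omega> j \<in> A N0" by blast
    then have "X \<omega> j \<in> A N" if "N0 \<le> N" for N using incseqD[OF A(1) that] by blast
    then show "eventually (\<lambda>N. X \<omega> j \<in> A N) sequentially" unfolding eventually_sequentially by blast
  qed
  ultimately have "eventually (\<lambda>N. \<forall>j\<in>?F. X \<omega> j \<in> A N) sequentially" by (rule eventually_ball_finite)
  then show "eventually (\<lambda>N. sA (A N) \<omega> = sA UNIV \<omega>) sequentially"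
  proof eventually_elim
    case (elim N)
    have "hits k H (pts \<kappa> X UNIV \<omega>) (X \<omega>) \<subseteq> hits k H (pts \<kappa> X (A N) \<omega>) (X \<omega>)"
    proof
      fix a assume a: "a \<in> hits k H (pts \<kappa> X UNIV \<omega>) (X \<omega>)"
      then have "a \<subseteq> ?F" by blast
      then have "X \<omega> j \<in> A N" if "j \<in> a" for j using elim that by blast
      then show "a \<in> hits k H (pts \<kappa> X (A N) \<omega>) (X \<omega>)" using a by (auto simp: hits_def pts_def)
    qed
    then have "hits k H (pts \<kappa> X (A N) \<omega>) (X \<omega>) = hits k H (pts \<kappa> X UNIV \<omega>) (X \<omega>)" using sub by (rule subset_antisym[rotated])
    then show ?case by (simp only: ucount_def)
  qed
qed

text \<open>Every quantity in the truncated bounds is the expectation of a function of the truncated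
  count, which never exceeds the full count and equals it eventually; the inequalities pass to the
  limit by dominated convergence.\<close>

lemma poisson_bounds:
  assumes sf: "sigma_finite_measure L"
    and fin: "AE \<omega> in M. finite (hits k H (pts \<kappa> X UNIV \<omega>) (X \<omega>))"
    and int2: "integrable M (\<lambda>\<omega>. (real (sA UNIV \<omega>))\<^sup>2)"
  defines "m \<equiv> expectation (\<lambda>\<omega>. real (sA UNIV \<omega>))" and "m2 \<equiv> expectation (\<lambda>\<omega>. (real (sA UNIV \<omega>))\<^sup>2)"
  shows "(\<And>n. 0 \<le> \<phi> n) \<Longrightarrow> (\<And>n. \<phi> n \<le> 2) \<Longrightarrow>
      \<bar>expectation (\<lambda>\<omega>. real (sA UNIV \<omega>) * \<phi> (sA UNIV \<omega>)) - m * expectation (\<lambda>\<omega>. \<phi> (Suc (sA UNIV \<omega>)))\<bar> \<le> 2 * (m2 - m - m\<^sup>2)"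
    and "0 \<le> r \<Longrightarrow> (\<And>l. 1 \<le> l \<Longrightarrow> l < k \<Longrightarrow> overlap k H L l \<le> ennreal r) \<Longrightarrow> m2 \<le> m\<^sup>2 + m + 2 ^ k / fact k * r"
proof -
  interpret L: sigma_finite_measure L by fact
  have spL: "space L = UNIV" using sets_eq_imp_space_eq[OF sets_L] by simp
  obtain A :: "nat \<Rightarrow> 'a set" where A: "range A \<subseteq> sets L" "(\<Union>i. A i) = UNIV" "\<And>i. emeasure L (A i) \<noteq> \<infinity>" "incseq A"
    using L.sigma_finite_incseq unfolding spL by blast
  have AN: "A N \<in> sets borel" "emeasure L (A N) < \<infinity>" for N using A(1) A(3)[of N] sets_L by (auto simp: less_top)
  have [measurable]: "sA (A N) \<in> M \<rightarrow>\<^sub>M count_space UNIV" for N by (rule measurable_sA[OF AN(1)])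
  have [measurable]: "sA UNIV \<in> M \<rightarrow>\<^sub>M count_space UNIV" by (rule measurable_sA) simp
  have leAE: "AE \<omega> in M. sA (A N) \<omega> \<le> sA UNIV \<omega>" for N
    using fin by eventually_elim (rule truncation_limit(1)[OF A(4,2)])
  have evAE: "AE \<omega> in M. eventually (\<lambda>N. sA (A N) \<omega> = sA UNIV \<omega>) sequentially"
    using fin by eventually_elim (rule truncation_limit(2)[OF A(4,2)])
  have sq: "real n \<le> (real n)\<^sup>2" for n by (cases n) (simp_all add: power2_eq_square)
  have int1: "integrable M (\<lambda>\<omega>. real (sA UNIV \<omega>))"
    by (rule Bochner_Integration.integrable_bound[OF int2]) (use sq in auto)
  \<comment> \<open>\<open>W j\<close> has to dominate \<psi> at all i \<le> j, because only
    \<open>sA (A N) \<omega> \<le> sA UNIV \<omega>\<close> is known and \<psi> need not be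
    monotone.\<close>
  have conv: "integrable M (\<lambda>\<omega>. \<psi> (sA (A N) \<omega>)) \<and> (\<lambda>N. expectation (\<lambda>\<omega>. \<psi> (sA (A N) \<omega>))) \<longlonglongrightarrow> expectation (\<lambda>\<omega>. \<psi> (sA UNIV \<omega>))"
    if W: "integrable M (\<lambda>\<omega>. W (sA UNIV \<omega>))" and bd: "\<And>i j. i \<le> j \<Longrightarrow> \<bar>\<psi> i\<bar> \<le> W j" for \<psi> W :: "nat \<Rightarrow> real" and N
  proof
    have b: "AE \<omega> in M. norm (\<psi> (sA (A N) \<omega>)) \<le> W (sA UNIV \<omega>)" for N
      using leAE[of N] by eventually_elim (simp add: bd)
    show "integrable M (\<lambda>\<omega>. \<psi> (sA (A N) \<omega>))"
    proof (rule Bochner_Integration.integrable_bound[OF W])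
      show "AE \<omega> in M. norm (\<psi> (sA (A N) \<omega>)) \<le> norm (W (sA UNIV \<omega>))"
        using b[of N] by eventually_elim simp
    qed simp
    show "(\<lambda>N. expectation (\<lambda>\<omega>. \<psi> (sA (A N) \<omega>))) \<longlonglongrightarrow> expectation (\<lambda>\<omega>. \<psi> (sA UNIV \<omega>))"
    proof (rule integral_dominated_convergence[where w="\<lambda>\<omega>. W (sA UNIV \<omega>)"])
      show "AE \<omega> in M. (\<lambda>N. \<psi> (sA (A N) \<omega>)) \<longlonglongrightarrow> \<psi> (sA UNIV \<omega>)"
        using evAE
      proof eventually_elim
        case (elim \<omega>)
        then have "eventually (\<lambda>N. \<psi> (sA (A N) \<omega>) = \<psi> (sA UNIV \<omega>)) sequentially" by eventually_elim simp
        then show ?case by (rule tendsto_eventually)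
      qed
    qed (use W b in auto)
  qed
  have c1: "integrable M (\<lambda>\<omega>. real (sA (A N) \<omega>)) \<and> (\<lambda>N. expectation (\<lambda>\<omega>. real (sA (A N) \<omega>))) \<longlonglongrightarrow> m" for N
    unfolding m_def by (rule conv[OF int1]) simp
  have c2: "integrable M (\<lambda>\<omega>. (real (sA (A N) \<omega>))\<^sup>2) \<and> (\<lambda>N. expectation (\<lambda>\<omega>. (real (sA (A N) \<omega>))\<^sup>2)) \<longlonglongrightarrow> m2" for N
    unfolding m2_def by (rule conv[of "\<lambda>n. (real n)\<^sup>2", OF int2]) simp
  note tr = truncated_real[OF AN conjunct1[OF c1] conjunct1[OF c2]]
  show "\<bar>expectation (\<lambda>\<omega>. real (sA UNIV \<omega>) * \<phi> (sA UNIV \<omega>)) - m * expectation (\<lambda>\<omega>. \<phi> (Suc (sA UNIV \<omega>)))\<bar> \<le> 2 * (m2 - m - m\<^sup>2)"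
    if \<phi>: "\<And>n. 0 \<le> \<phi> n" "\<And>n. \<phi> n \<le> 2"
  proof -
    have c3: "integrable M (\<lambda>\<omega>. real (sA (A N) \<omega>) * \<phi> (sA (A N) \<omega>)) \<and> (\<lambda>N. expectation (\<lambda>\<omega>. real (sA (A N) \<omega>) * \<phi> (sA (A N) \<omega>))) \<longlonglongrightarrow> expectation (\<lambda>\<omega>. real (sA UNIV \<omega>) * \<phi> (sA UNIV \<omega>))" for N
    proof (rule conv[of "\<lambda>n. 2 * real n"])
      fix i j :: nat assume "i \<le> j"
      then have "real i * \<phi> i \<le> real j * 2" using \<phi> by (intro mult_mono) auto
      then show "\<bar>real i * \<phi> i\<bar> \<le> 2 * real j" using \<phi>(1)[of i] by (simp add: abs_mult)
    qed (use int1 in simp)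
    have c4: "integrable M (\<lambda>\<omega>. \<phi> (Suc (sA (A N) \<omega>))) \<and> (\<lambda>N. expectation (\<lambda>\<omega>. \<phi> (Suc (sA (A N) \<omega>)))) \<longlonglongrightarrow> expectation (\<lambda>\<omega>. \<phi> (Suc (sA UNIV \<omega>)))" for N
      by (rule conv[of "\<lambda>_. 2" "\<lambda>n. \<phi> (Suc n)"]) (use \<phi> in simp_all)
    show ?thesis
    proof (rule LIMSEQ_le)
      show "(\<lambda>N. \<bar>expectation (\<lambda>\<omega>. real (sA (A N) \<omega>) * \<phi> (sA (A N) \<omega>)) - expectation (\<lambda>\<omega>. real (sA (A N) \<omega>)) * expectation (\<lambda>\<omega>. \<phi> (Suc (sA (A N) \<omega>)))\<bar>)
        \<longlonglongrightarrow> \<bar>expectation (\<lambda>\<omega>. real (sA UNIV \<omega>) * \<phi> (sA UNIV \<omega>)) - m * expectation (\<lambda>\<omega>. \<phi> (Suc (sA UNIV \<omega>)))\<bar>"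
        by (intro tendsto_intros conjunct2[OF c1] conjunct2[OF c3] conjunct2[OF c4])
      show "(\<lambda>N. 2 * (expectation (\<lambda>\<omega>. (real (sA (A N) \<omega>))\<^sup>2) - expectation (\<lambda>\<omega>. real (sA (A N) \<omega>)) - (expectation (\<lambda>\<omega>. real (sA (A N) \<omega>)))\<^sup>2))
        \<longlonglongrightarrow> 2 * (m2 - m - m\<^sup>2)"
        by (intro tendsto_intros conjunct2[OF c1] conjunct2[OF c2])
    qed (intro exI allI impI tr(1) \<phi>)
  qed
  show "m2 \<le> m\<^sup>2 + m + 2 ^ k / fact k * r"
    if r: "0 \<le> r" and I: "\<And>l. 1 \<le> l \<Longrightarrow> l < k \<Longrightarrow> overlap k H L l \<le> ennreal r"
  proof (rule LIMSEQ_le)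
    show "(\<lambda>N. expectation (\<lambda>\<omega>. (real (sA (A N) \<omega>))\<^sup>2)) \<longlonglongrightarrow> m2" by (rule conjunct2[OF c2])
    show "(\<lambda>N. (expectation (\<lambda>\<omega>. real (sA (A N) \<omega>)))\<^sup>2 + expectation (\<lambda>\<omega>. real (sA (A N) \<omega>)) + 2 ^ k / fact k * r) \<longlonglongrightarrow> m\<^sup>2 + m + 2 ^ k / fact k * r"
      by (intro tendsto_intros conjunct2[OF c1])
    have HL: "H \<in> sets (PiM {..<k} (\<lambda>_. L))"
      using H sets_PiM_cong[of "{..<k}" "{..<k}" "\<lambda>_. L" "\<lambda>_. borel"] sets_L by simp
    have "overlap k H (LA (A N)) l \<le> ennreal r" if "1 \<le> l" "l < k" for l N
      using overlap_density_le[OF sf _ _ HL, of "A N" l] AN(1)[of N] sets_L I[OF that] that by (simp add: order_trans)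
    then show "\<exists>N0. \<forall>N\<ge>N0. expectation (\<lambda>\<omega>. (real (sA (A N) \<omega>))\<^sup>2) \<le> (expectation (\<lambda>\<omega>. real (sA (A N) \<omega>)))\<^sup>2 + expectation (\<lambda>\<omega>. real (sA (A N) \<omega>)) + 2 ^ k / fact k * r"
      using tr(2)[OF r] by blast
  qed
qed

end

section \<open>Binomial processes\<close>

lemma prod_diff_eq_fact_binomial: "(\<Prod>i<k. real (m - i)) = fact k * real (m choose k)"
proof (induction k)
  case (Suc k)
  have "Suc k * (m choose Suc k) = (m - k) * (m choose k)"
    by (simp only: binomial_absorption binomial_absorb_comp)
  then have eq: "real (Suc k) * real (m choose Suc k) = real (m - k) * real (m choose k)"
    by (metis of_nat_mult)
  have "(\<Prod>i<Suc k. real (m - i)) = fact k * (real (m - k) * real (m choose k))"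
    using Suc by (simp add: mult.commute mult.left_commute)
  also have "\<dots> = fact (Suc k) * real (m choose Suc k)"
    unfolding eq[symmetric] fact_Suc by (simp only: mult.assoc mult.left_commute)
  finally show ?case .
qed simp

text \<open>Identifies the ratio in the theorem as the ratio of mean counts with n - k and with n
  points. For n < k both sides vanish, on the left because \<open>0 choose k\<close> is 0 when k
  \<ge> 1.\<close>

lemma binomial_eq_ffact_ratio:
  assumes "1 \<le> k"
  shows "real ((n - k) choose k) = ffact_ratio n k * real (n choose k)"
proof (cases "n < k")
  case True
  then show ?thesis using assms by (simp add: ffact_ratio_def binomial_eq_0)
next
  case False
  then have "real (n choose k) \<noteq> 0" by simp
  moreover have "ffact_ratio n k = (fact k * real ((n - k) choose k)) / (fact k * real (n choose k))"
    unfolding ffact_ratio_def prod_diff_eq_fact_binomial using False by (simp only: if_False)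
  ultimately show ?thesis by simp
qed

text \<open>At most \<open>j * ((n - 1) choose (k - 1))\<close> of the \<open>k\<close>-subsets of \<open>{..<n}\<close> meet a fixed \<open>j\<close>-set.\<close>
lemma binomial_diff_le: "(n choose k) \<le> ((n - j) choose k) + j * ((n - 1) choose (k - 1))"
proof (induction j)
  case (Suc j)
  show ?case
  proof (cases "n - j = 0 \<or> k = 0")
    case True
    then have "((n - j) choose k) \<le> ((n - Suc j) choose k)" by auto
    moreover have "j * ((n - 1) choose (k - 1)) \<le> Suc j * ((n - 1) choose (k - 1))" by simp
    ultimately show ?thesis using Suc by linarith
  next
    case False
    then obtain q r where q: "n - j = Suc q" "k = Suc r" by (metis not0_implies_Suc)
    then have "(n - j) choose k = (q choose r) + (q choose k)" by simp
    moreover have "(q choose r) \<le> ((n - 1) choose (k - 1))"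
      using q by (simp add: binomial_right_mono)
    moreover have "n - Suc j = q" using q(1) by simp
    ultimately show ?thesis using Suc by simp
  qed
qed simp

text \<open>The refilling error below costs 2 k^2 / n times the squared mean; this absorbs it into
  the power of 6 in the theorem.\<close>

lemma two_square_le_six_power: "2 * k\<^sup>2 \<le> (6::nat) ^ k"
proof (induction k)
  case (Suc k)
  show ?case
  proof (cases "k = 0")
    case False
    then have "2 * (Suc k)\<^sup>2 \<le> 6 * (2 * k\<^sup>2)"
    proof -
      have "Suc k \<le> 2 * k" using False by simp
      then have "(Suc k)\<^sup>2 \<le> (2 * k)\<^sup>2" by (rule power_mono) simp
      then show ?thesis by (simp add: power_mult_distrib)
    qed
    also have "\<dots> \<le> 6 * 6 ^ k" using Suc by simp
    finally show ?thesis by simp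
  qed simp
qed simp

text \<open>1 - \<open>ffact_ratio n k\<close> is the proportion of the k-subsets of an n-set that
  meet a fixed k-subset. A union bound over the k elements of the latter gives k^2 / n.\<close>

lemma one_minus_ffact_ratio_le:
  assumes k: "1 \<le> k" "k \<le> n" and t: "0 < t" "t \<le> real n"
  shows "2 * (1 - ffact_ratio n k) \<le> 6 ^ k * fact k / t"
proof -
  let ?C = "real (n choose k)"
  have C: "0 < ?C" using k by simp
  have n: "0 < n" using k by simp
  have "Suc (k - 1) = k" using k(1) by simp
  from binomial_absorption[of "k - 1" n, unfolded this]
  have "n * ((n - 1) choose (k - 1)) = k * (n choose k)" by (rule sym)
  then have "real (n * ((n - 1) choose (k - 1))) = real (k * (n choose k))" by (simp only:)
  then have ab: "real n * real ((n - 1) choose (k - 1)) = real k * ?C" by (simp only: of_nat_mult)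
  have "?C \<le> real ((n - k) choose k) + real k * real ((n - 1) choose (k - 1))"
    using of_nat_mono[OF binomial_diff_le[of n k k], where 'a=real] by (simp only: of_nat_mult of_nat_add)
  then have "?C * (1 - ffact_ratio n k) \<le> real k * real ((n - 1) choose (k - 1))"
    unfolding binomial_eq_ffact_ratio[OF k(1)] by (simp add: algebra_simps)
  also have "\<dots> = ?C * ((real k)\<^sup>2 / real n)"
  proof -
    have "real ((n - 1) choose (k - 1)) = real k * ?C / real n"
      using ab n by (simp only: eq_divide_eq mult.commute[of _ "real n"]) simp
    then show ?thesis by (simp only: power2_eq_square times_divide_eq_right mult.assoc mult.left_commute mult.commute)
  qed
  finally have "1 - ffact_ratio n k \<le> (real k)\<^sup>2 / real n" by (rule mult_left_le_imp_le[OF _ C])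
  then have "2 * (1 - ffact_ratio n k) \<le> 2 * (real k)\<^sup>2 / real n" by simp
  also have "\<dots> \<le> 6 ^ k / real n"
    using of_nat_mono[OF two_square_le_six_power[of k], where 'a=real] by (intro divide_right_mono) simp_all
  also have "\<dots> \<le> 6 ^ k * fact k / real n" by (intro divide_right_mono) (simp_all add: fact_ge_1)
  also have "\<dots> \<le> 6 ^ k * fact k / t" using t by (intro divide_left_mono) auto
  finally show ?thesis .
qed

section \<open>Size bias and second moment for n points of a probability measure\<close>

context ustat begin

text \<open>With total mass 1, k extra coordinates integrate to 1. So n - k points can be realised
  as the last ones of n points, which couples the two counts on one space.\<close>

lemma J_drop:
  fixes \<psi> :: "nat \<Rightarrow> ennreal"
  assumes "mass = 1" "k \<le> n"
  shows "J (n - k) \<psi> = (\<integral>\<^sup>+x. \<psi> (ucount k H {k..<n} x) \<partial>PL {..<n})"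
proof -
  have "(\<integral>\<^sup>+x. \<psi> (ucount k H {k..<n} x) \<partial>PL {..<n}) = (\<integral>\<^sup>+x. \<psi> (ucount k H {k..<n} (restrict x {k..<n})) \<partial>PL {..<n})"
    by (intro nn_integral_cong arg_cong[where f=\<psi>] ucount_cong) simp
  also have "\<dots> = (\<integral>\<^sup>+x. \<psi> (ucount k H {k..<n} x) \<partial>PL {k..<n}) * mass ^ card ({..<n} - {k..<n})"
    by (rule nn_integral_PL_subset) auto
  also have "(\<integral>\<^sup>+x. \<psi> (ucount k H {k..<n} x) \<partial>PL {k..<n}) = J (n - k) \<psi>"
    using nn_integral_ucount_image[where \<psi>=\<psi> and m=k and n="n - k"] assms(2) by simp
  finally show ?thesis using assms(1) by simp
qed

text \<open>For mass 1, the expected number of hits that use at least one of the first k points: the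
  price of passing between n - k and n points.\<close>

definition loss :: "nat \<Rightarrow> ennreal" where
  "loss n = (\<integral>\<^sup>+x. of_nat (ucount k H {..<n} x - ucount k H {k..<n} x) \<partial>PL {..<n})"

lemma loss:
  assumes "mass = 1" "k \<le> n"
  shows loss_eq: "J n of_nat = J (n - k) of_nat + loss n"
    and loss_le: "(\<And>i. \<psi> i \<le> 2) \<Longrightarrow> J n \<psi> \<le> J (n - k) \<psi> + 2 * loss n"
    and loss_ge: "(\<And>i. \<psi> i \<le> 2) \<Longrightarrow> J (n - k) \<psi> \<le> J n \<psi> + 2 * loss n"
proof -
  let ?s = "\<lambda>x. ucount k H {..<n} x" and ?v = "\<lambda>x. ucount k H {k..<n} x"
  have [measurable]: "?s \<in> PL {..<n} \<rightarrow>\<^sub>M count_space UNIV" "?v \<in> PL {..<n} \<rightarrow>\<^sub>M count_space UNIV"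
    by (intro measurable_ucount_PL; auto)+
  have vs: "?v x \<le> ?s x" for x
    unfolding ucount_def by (intro card_mono finite_hits) (auto simp: hits_def)
  have dist: "(\<integral>\<^sup>+x. \<psi> x + 2 * of_nat (?s x - ?v x) \<partial>PL {..<n}) = (\<integral>\<^sup>+x. \<psi> x \<partial>PL {..<n}) + 2 * loss n"
    if [measurable]: "\<psi> \<in> borel_measurable (PL {..<n})" for \<psi> :: "_ \<Rightarrow> ennreal"
    unfolding loss_def by (subst nn_integral_add) (auto simp: nn_integral_cmult)
  show "J n of_nat = J (n - k) of_nat + loss n"
  proof -
    have "J n of_nat = (\<integral>\<^sup>+x. of_nat (?v x) + of_nat (?s x - ?v x) \<partial>PL {..<n})"
      unfolding J_def by (intro nn_integral_cong) (simp only: of_nat_add[symmetric] le_add_diff_inverse[OF vs])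
    also have "\<dots> = J (n - k) of_nat + loss n"
      unfolding J_drop[OF assms] loss_def by (rule nn_integral_add) measurable
    finally show ?thesis .
  qed
  show "J n \<psi> \<le> J (n - k) \<psi> + 2 * loss n" if \<psi>: "\<And>i. \<psi> i \<le> 2" for \<psi>
  proof -
    have "J n \<psi> \<le> (\<integral>\<^sup>+x. \<psi> (?v x) + 2 * of_nat (?s x - ?v x) \<partial>PL {..<n})"
      unfolding J_def by (intro nn_integral_mono bounded_by_two_close(1) \<psi> vs)
    also have "\<dots> = J (n - k) \<psi> + 2 * loss n" unfolding J_drop[OF assms] by (rule dist) measurable
    finally show ?thesis .
  qed
  show "J (n - k) \<psi> \<le> J n \<psi> + 2 * loss n" if \<psi>: "\<And>i. \<psi> i \<le> 2" for \<psi>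
  proof -
    have "J (n - k) \<psi> \<le> (\<integral>\<^sup>+x. \<psi> (?s x) + 2 * of_nat (?s x - ?v x) \<partial>PL {..<n})"
      unfolding J_drop[OF assms] by (intro nn_integral_mono bounded_by_two_close(2) \<psi> vs)
    also have "\<dots> = J n \<psi> + 2 * loss n" unfolding J_def by (rule dist) measurable
    finally show ?thesis .
  qed
qed

text \<open>Removing a hit leaves n - k points, whereas the bound needs the law of the count for n
  points. The coupling replaces one by the other and adds the mean times \<open>loss\<close> to the
  error; for n < k the mean is 0 and nothing has to be replaced.\<close>

lemma binomial_size_bias:
  fixes \<phi> :: "nat \<Rightarrow> ennreal" and n :: nat
  assumes m1: "mass = 1" and \<phi>: "\<And>i. \<phi> i \<le> 2"
  defines "D \<equiv> excess n + J n of_nat * loss n"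
  shows "J n (\<lambda>s. of_nat s * \<phi> s) \<le> J n of_nat * J n (\<lambda>s. \<phi> (Suc s)) + 2 * D"
    and "J n of_nat * J n (\<lambda>s. \<phi> (Suc s)) \<le> J n (\<lambda>s. of_nat s * \<phi> s) + 2 * D"
    and "J n (\<lambda>s. of_nat s * of_nat s) = J n of_nat * J (n - k) (\<lambda>s. of_nat (Suc s)) + excess n"
proof -
  have mean: "J n of_nat = of_nat (n choose k) * hitprob" by (simp add: J_of_nat m1)
  have le: "J n (\<lambda>s. of_nat s * \<phi> s) \<le> J n of_nat * J (n - k) (\<lambda>s. \<phi> (Suc s)) + 2 * excess n"
    using size_bias_le[of \<phi> n, OF \<phi>] unfolding mean by (simp only: mult.assoc)
  have ge: "J n of_nat * J (n - k) (\<lambda>s. \<phi> (Suc s)) \<le> J n (\<lambda>s. of_nat s * \<phi> s) + 2 * excess n"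
    using size_bias_ge[of \<phi> n, OF \<phi>] unfolding mean by (simp only: mult.assoc)
  show "J n (\<lambda>s. of_nat s * of_nat s) = J n of_nat * J (n - k) (\<lambda>s. of_nat (Suc s)) + excess n"
    using size_bias_eq[of "\<lambda>_. 0" n] unfolding mean by (simp only: mult.assoc zero_le)
  have cross: "J n of_nat * J (n - k) (\<lambda>s. \<phi> (Suc s)) \<le> J n of_nat * J n (\<lambda>s. \<phi> (Suc s)) + 2 * (J n of_nat * loss n) \<and>
    J n of_nat * J n (\<lambda>s. \<phi> (Suc s)) \<le> J n of_nat * J (n - k) (\<lambda>s. \<phi> (Suc s)) + 2 * (J n of_nat * loss n)"
  proof (cases "k \<le> n")
    case True
    have d: "J n of_nat * a + 2 * (J n of_nat * loss n) = J n of_nat * (a + 2 * loss n)" for a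
      by (simp only: distrib_left mult.left_commute)
    show ?thesis unfolding d
      by (intro conjI mult_left_mono loss_le[OF m1 True] loss_ge[OF m1 True] \<phi>) simp_all
  next
    case False
    then have "n choose k = 0" by simp
    then have "J n of_nat = 0" unfolding mean by (simp only: of_nat_0 mult_zero_left)
    then show ?thesis by (simp only: mult_zero_left mult_zero_right add_0_left order_refl simp_thms)
  qed
  have 2: "2 * D = 2 * (J n of_nat * loss n) + 2 * excess n" unfolding D_def by (simp only: distrib_left add.commute)
  show "J n (\<lambda>s. of_nat s * \<phi> s) \<le> J n of_nat * J n (\<lambda>s. \<phi> (Suc s)) + 2 * D"
    unfolding 2 add.assoc[symmetric] by (rule order_trans[OF le add_right_mono[OF conjunct1[OF cross]]])
  have "J n of_nat * J n (\<lambda>s. \<phi> (Suc s)) \<le> (J n (\<lambda>s. of_nat s * \<phi> s) + 2 * excess n) + 2 * (J n of_nat * loss n)"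
    by (rule order_trans[OF conjunct2[OF cross] add_right_mono[OF ge]])
  also have "\<dots> = J n (\<lambda>s. of_nat s * \<phi> s) + 2 * D" unfolding 2 by (simp only: add.assoc add.commute[of "2 * excess n"])
  finally show "J n of_nat * J n (\<lambda>s. \<phi> (Suc s)) \<le> J n (\<lambda>s. of_nat s * \<phi> s) + 2 * D" .
qed

text \<open>Overlap 0 contributes exactly the product of the means for n and n - k points. For the
  intermediate overlaps the binomial coefficients are bounded by powers of n over factorials, and
  n^(2k-l) is precisely the factor that turns the overlap of a probability into that of n times
  it.\<close>

lemma binomial_second_moment_le:
  assumes m1: "mass = 1" and R: "\<And>l. 1 \<le> l \<Longrightarrow> l < k \<Longrightarrow> of_nat (n ^ (2*k - l)) * overlap k H L l \<le> R"
  shows "J n (\<lambda>s. of_nat s * of_nat s) \<le> J n of_nat * J (n - k) of_nat + J n of_nat + ennreal (2 ^ k / fact k) * R"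
proof -
  let ?g = "\<lambda>l. of_nat ((n choose k) * (k choose l) * ((n - k) choose (k - l))) * overlap k H L l"
  have "J n (\<lambda>s. of_nat s * of_nat s) = (\<Sum>l\<le>k. ?g l)"
    unfolding second_moment m1 by (simp only: power_one mult_1_right)
  then have eq: "J n (\<lambda>s. of_nat s * of_nat s) = ?g 0 + ?g k + (\<Sum>l\<in>{1..<k}. ?g l)"
    by (rule trans[OF _ sum_atMost_split_ends[OF k]])
  have g0: "?g 0 = J n of_nat * J (n - k) of_nat"
    unfolding J_of_nat m1 overlap_0
    by (simp only: power_one mult_1_right binomial_n_0 diff_zero of_nat_mult power2_eq_square mult.assoc mult.left_commute)
  have gk: "?g k = J n of_nat"
    unfolding J_of_nat m1 overlap_k by (simp only: power_one mult_1_right binomial_n_n binomial_n_0 diff_self_eq_0)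
  have "(\<Sum>l\<in>{1..<k}. ?g l) \<le> (\<Sum>l\<in>{1..<k}. ennreal (real (k choose l) / (fact k * fact (k - l))) * (of_nat (n ^ (2*k - l)) * overlap k H L l))"
  proof (rule sum_mono)
    fix l assume l: "l \<in> {1..<k}"
    have "real (n choose k) \<le> real n ^ k / fact k"
      using of_nat_mono[OF binomial_fact_pow[of n k], where 'a=real] by (simp add: pos_le_divide_eq)
    moreover have "real ((n - k) choose (k - l)) \<le> real n ^ (k - l) / fact (k - l)"
    proof -
      have "((n - k) choose (k - l)) * fact (k - l) \<le> n ^ (k - l)"
        by (rule order_trans[OF binomial_fact_pow power_mono]) simp_all
      from of_nat_mono[OF this, where 'a=real] show ?thesis by (simp add: pos_le_divide_eq)
    qed
    ultimately have "real (n choose k) * real ((n - k) choose (k - l)) \<le> (real n ^ k / fact k) * (real n ^ (k - l) / fact (k - l))"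
      by (intro mult_mono) auto
    also have "\<dots> = real n ^ (2*k - l) / (fact k * fact (k - l))"
    proof -
      have "2 * k - l = k + (k - l)" using l by auto
      then show ?thesis by (simp add: power_add)
    qed
    finally have "real (k choose l) * (real (n choose k) * real ((n - k) choose (k - l)))
      \<le> real (k choose l) * (real n ^ (2*k - l) / (fact k * fact (k - l)))"
      by (rule mult_left_mono) simp
    also have "\<dots> = real (k choose l) / (fact k * fact (k - l)) * real (n ^ (2*k - l))" by simp
    also have "real (k choose l) * (real (n choose k) * real ((n - k) choose (k - l))) = real ((n choose k) * (k choose l) * ((n - k) choose (k - l)))"
      by (simp only: of_nat_mult mult.assoc mult.left_commute)
    finally have "real ((n choose k) * (k choose l) * ((n - k) choose (k - l))) \<le> real (k choose l) / (fact k * fact (k - l)) * real (n ^ (2*k - l))" .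
    then have "of_nat ((n choose k) * (k choose l) * ((n - k) choose (k - l))) \<le> ennreal (real (k choose l) / (fact k * fact (k - l))) * of_nat (n ^ (2*k - l))"
      unfolding ennreal_of_nat_eq_real_of_nat by (subst ennreal_mult[symmetric]) (auto intro: ennreal_leI)
    then show "?g l \<le> ennreal (real (k choose l) / (fact k * fact (k - l))) * (of_nat (n ^ (2*k - l)) * overlap k H L l)"
      unfolding mult.assoc[symmetric] by (rule mult_right_mono) simp
  qed
  also have "\<dots> \<le> ennreal (2 ^ k / fact k) * R" by (rule sum_overlap_le) (rule R)
  finally show ?thesis unfolding eq g0 gk by (rule add_left_mono)
qed

end

section \<open>Rescaling a distribution to an intensity measure\<close>

lemma PiM_scale_measure:
  assumes Q: "sigma_finite_measure Q" and c: "c < \<infinity>" and I: "finite I" and sc: "sigma_finite_measure (scale_measure c Q)"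
  shows "PiM I (\<lambda>_. scale_measure c Q) = scale_measure (c ^ card I) (PiM I (\<lambda>_. Q))"
proof -
  interpret Q: sigma_finite_measure Q by fact
  interpret PQ: product_sigma_finite "\<lambda>_. Q" ..
  interpret PS: product_sigma_finite "\<lambda>_. scale_measure c Q" by (rule product_sigma_finite.intro) (rule sc)
  show ?thesis
  proof (rule PS.PiM_eqI[OF I, symmetric])
    show "sets (scale_measure (c ^ card I) (PiM I (\<lambda>_. Q))) = sets (PiM I (\<lambda>_. scale_measure c Q))"
      by simp (rule sets_PiM_cong, simp_all)
    fix E assume "\<And>i. i \<in> I \<Longrightarrow> E i \<in> sets (scale_measure c Q)"
    then have E: "\<And>i. i \<in> I \<Longrightarrow> E i \<in> sets Q" by simp
    show "emeasure (scale_measure (c ^ card I) (PiM I (\<lambda>_. Q))) (PiE I E) = (\<Prod>i\<in>I. emeasure (scale_measure c Q) (E i))"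
      by (simp add: PQ.emeasure_PiM[OF I E] prod.distrib)
  qed
qed

text \<open>The l outer coordinates count once and the k - l inner ones twice because of the square:
  l + 2 (k - l) = 2k - l.\<close>

lemma overlap_scale_measure:
  assumes Q: "sigma_finite_measure Q" and c: "c < \<infinity>" and sc: "sigma_finite_measure (scale_measure c Q)"
    and l: "l \<le> k" and H: "H \<in> sets (PiM {..<k} (\<lambda>_. Q))"
  shows "overlap k H (scale_measure c Q) l = c ^ (2*k - l) * overlap k H Q l"
proof -
  note P = PiM_scale_measure[OF Q c _ sc]
  have "overlap k H (scale_measure c Q) l = c ^ l * (\<integral>\<^sup>+x. (\<integral>\<^sup>+y. indicator H (join_tuple k l x y) \<partial>scale_measure (c ^ (k - l)) (PiM {..<k-l} (\<lambda>_. Q)))\<^sup>2 \<partial>PiM {..<l} (\<lambda>_. Q))"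
    unfolding overlap_def P[OF finite_lessThan] card_lessThan
  proof (rule nn_integral_scale_measure)
    show "(\<lambda>x. (\<integral>\<^sup>+y. indicator H (join_tuple k l x y) \<partial>scale_measure (c ^ (k - l)) (PiM {..<k-l} (\<lambda>_. Q)))\<^sup>2) \<in> borel_measurable (PiM {..<l} (\<lambda>_. Q))"
    proof -
      have "(\<lambda>x. (c ^ (k - l) * (\<integral>\<^sup>+y. indicator H (join_tuple k l x y) \<partial>PiM {..<k-l} (\<lambda>_. Q)))\<^sup>2) \<in> borel_measurable (PiM {..<l} (\<lambda>_. Q))"
        unfolding power2_eq_square using measurable_overlap_inner(1)[OF Q l H] by (intro borel_measurable_times_ennreal) auto
      then show ?thesis
        by (rule measurable_cong[THEN iffD1, rotated]) (simp add: nn_integral_scale_measure[OF measurable_overlap_inner(2)[OF Q l H]])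
    qed
  qed
  also have "\<dots> = c ^ l * (\<integral>\<^sup>+x. (c ^ (k - l))\<^sup>2 * (\<integral>\<^sup>+y. indicator H (join_tuple k l x y) \<partial>PiM {..<k-l} (\<lambda>_. Q))\<^sup>2 \<partial>PiM {..<l} (\<lambda>_. Q))"
    by (intro arg_cong2[where f="(*)"] refl nn_integral_cong)
       (simp add: nn_integral_scale_measure[OF measurable_overlap_inner(2)[OF Q l H]] power_mult_distrib)
  also have "\<dots> = c ^ l * ((c ^ (k - l))\<^sup>2 * overlap k H Q l)"
    unfolding overlap_def
    by (intro arg_cong2[where f="(*)"] refl nn_integral_cmult)
       (unfold power2_eq_square, intro borel_measurable_times_ennreal measurable_overlap_inner(1)[OF Q l H])
  also have "\<dots> = c ^ (2*k - l) * overlap k H Q l"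
  proof -
    have "2 * k - l = l + (k - l) * 2" using l by simp
    then show ?thesis by (simp add: power_add power_mult mult.assoc)
  qed
  finally show ?thesis .
qed

text \<open>Independence and identical distribution make the law of the first n points the n-fold
  product of \<open>Q\<close>, so expectations of functions of the count are values of
  \<open>U.J n\<close>. Both errors, \<open>excess\<close> and mean times \<open>loss\<close>, can
  then be solved for in terms of \<open>m\<close>, \<open>m2\<close> and \<rho>.\<close>

lemma (in prob_space) binomial_bounds:
  fixes X :: "'a \<Rightarrow> nat \<Rightarrow> 'b" and Q :: "'b measure"
  assumes k: "1 \<le> k" and n: "1 \<le> n" and sym: "sym_set k H" and H: "H \<in> sets (PiM {..<k} (\<lambda>_. Q))"
    and Q: "prob_space Q" and indep: "indep_vars (\<lambda>_. Q) (\<lambda>i \<omega>. X \<omega> i) {..<n}"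
    and distr: "\<And>i. i < n \<Longrightarrow> distr M Q (\<lambda>\<omega>. X \<omega> i) = Q"
    and t: "0 < t" "t \<le> real n"
    and int2: "integrable M (\<lambda>\<omega>. (real (ucount k H {..<n} (X \<omega>)))\<^sup>2)"
  defines "m \<equiv> expectation (\<lambda>\<omega>. real (ucount k H {..<n} (X \<omega>)))"
    and "m2 \<equiv> expectation (\<lambda>\<omega>. (real (ucount k H {..<n} (X \<omega>)))\<^sup>2)"
    and "\<rho> \<equiv> ffact_ratio n k"
  shows "(\<And>i. 0 \<le> \<phi> i) \<Longrightarrow> (\<And>i. \<phi> i \<le> 2) \<Longrightarrow>
      \<bar>expectation (\<lambda>\<omega>. real (ucount k H {..<n} (X \<omega>)) * \<phi> (ucount k H {..<n} (X \<omega>))) - m * expectation (\<lambda>\<omega>. \<phi> (Suc (ucount k H {..<n} (X \<omega>))))\<bar>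
        \<le> 2 * (m2 - m - \<rho> * m\<^sup>2) + 6 ^ k * fact k / t * m\<^sup>2"
    and "0 \<le> r \<Longrightarrow> (\<And>l. 1 \<le> l \<Longrightarrow> l < k \<Longrightarrow> overlap k H (scale_measure (ennreal (real n)) Q) l \<le> ennreal r) \<Longrightarrow>
      m2 \<le> m + \<rho> * m\<^sup>2 + 2 ^ k / fact k * r"
proof -
  interpret Q: prob_space Q by fact
  interpret U: ustat Q k H by unfold_locales (use k sym H in auto)
  let ?s = "\<lambda>\<omega>. ucount k H {..<n} (X \<omega>)"
  have X[measurable]: "(\<lambda>\<omega>. X \<omega> i) \<in> M \<rightarrow>\<^sub>M Q" if "i < n" for i
    using indep that by (auto simp: indep_vars_def)
  have [measurable]: "?s \<in> M \<rightarrow>\<^sub>M count_space UNIV"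
    by (rule measurable_ucount[OF _ sym H]) (use X in auto)
  have m1: "U.mass = 1" by (simp add: U.mass_def Q.emeasure_space_1)
  have law: "distr M (PiM {..<n} (\<lambda>_. Q)) (\<lambda>\<omega>. \<lambda>i\<in>{..<n}. X \<omega> i) = PiM {..<n} (\<lambda>_. Q)"
  proof -
    have "{..<n} \<noteq> {}" using n by (auto simp: lessThan_empty_iff)
    then have "distr M (PiM {..<n} (\<lambda>_. Q)) (\<lambda>\<omega>. \<lambda>i\<in>{..<n}. X \<omega> i) = PiM {..<n} (\<lambda>i. distr M Q (\<lambda>\<omega>. X \<omega> i))"
      using indep X by (subst (asm) indep_vars_iff_distr_eq_PiM') auto
    also have "\<dots> = PiM {..<n} (\<lambda>_. Q)" by (rule PiM_cong) (use distr in auto)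
    finally show ?thesis .
  qed
  have func: "(\<integral>\<^sup>+\<omega>. \<phi> (?s \<omega>) \<partial>M) = U.J n \<phi>" for \<phi> :: "nat \<Rightarrow> ennreal"
  proof -
    have "U.J n \<phi> = (\<integral>\<^sup>+x. \<phi> (ucount k H {..<n} x) \<partial>distr M (PiM {..<n} (\<lambda>_. Q)) (\<lambda>\<omega>. \<lambda>i\<in>{..<n}. X \<omega> i))"
      unfolding U.J_def law ..
    also have "\<dots> = (\<integral>\<^sup>+\<omega>. \<phi> (ucount k H {..<n} (\<lambda>i\<in>{..<n}. X \<omega> i)) \<partial>M)"
    proof (rule nn_integral_distr)
      show "(\<lambda>\<omega>. \<lambda>i\<in>{..<n}. X \<omega> i) \<in> M \<rightarrow>\<^sub>M PiM {..<n} (\<lambda>_. Q)"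
        by (rule measurable_restrict) (use X in auto)
      have "(\<lambda>x. ucount k H {..<n} x) \<in> PiM {..<n} (\<lambda>_. Q) \<rightarrow>\<^sub>M count_space UNIV"
        by (rule U.measurable_ucount_PL) auto
      then show "(\<lambda>x. \<phi> (ucount k H {..<n} x)) \<in> borel_measurable (distr M (PiM {..<n} (\<lambda>_. Q)) (\<lambda>\<omega>. \<lambda>i\<in>{..<n}. X \<omega> i))"
        unfolding measurable_distr_eq1 by (rule measurable_compose) simp
    qed
    also have "\<dots> = (\<integral>\<^sup>+\<omega>. \<phi> (?s \<omega>) \<partial>M)"
      by (intro nn_integral_cong arg_cong[where f=\<phi>] ucount_cong) simp
    finally show ?thesis ..
  qed
  have sq: "real i \<le> (real i)\<^sup>2" for i by (cases i) (simp_all add: power2_eq_square)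
  have int1: "integrable M (\<lambda>\<omega>. real (?s \<omega>))"
    by (rule Bochner_Integration.integrable_bound[OF int2]) (use sq in auto)
  have nn: "0 \<le> m" "0 \<le> m2" by (simp_all add: m_def m2_def)
  have rho: "real ((n - k) choose k) = \<rho> * real (n choose k)"
    unfolding \<rho>_def by (rule binomial_eq_ffact_ratio[OF k])
  have rho0: "0 \<le> \<rho>" unfolding \<rho>_def ffact_ratio_def by (auto intro!: divide_nonneg_nonneg prod_nonneg)
  have e1: "U.J n of_nat = ennreal m"
    unfolding func[symmetric] m_def using nn_integral_eq_integral[OF int1] by (simp add: ennreal_of_nat_eq_real_of_nat)
  have e2: "U.J n (\<lambda>s. of_nat s * of_nat s) = ennreal m2"
    unfolding func[symmetric] m2_def using nn_integral_eq_integral[OF int2]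
    by (simp add: ennreal_of_nat_eq_real_of_nat ennreal_mult[symmetric] power2_eq_square)
  have e3: "U.J (n - k) of_nat = ennreal (\<rho> * m)"
  proof -
    have "U.J (n - k) of_nat = ennreal (\<rho> * real (n choose k)) * U.hitprob"
      unfolding U.J_of_nat m1 rho[symmetric] by (simp add: ennreal_of_nat_eq_real_of_nat)
    also have "\<dots> = ennreal \<rho> * U.J n of_nat"
      unfolding U.J_of_nat m1 using rho0 by (simp add: ennreal_of_nat_eq_real_of_nat ennreal_mult mult.assoc)
    finally show ?thesis unfolding e1 using nn rho0 by (simp add: ennreal_mult)
  qed
  have e4: "U.J (n - k) (\<lambda>s. of_nat (Suc s)) = ennreal (1 + \<rho> * m)"
  proof -
    have "U.J (n - k) (\<lambda>s. of_nat (Suc s)) = U.J (n - k) (\<lambda>_. 1) + U.J (n - k) of_nat"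
      unfolding U.J_def of_nat_Suc by (rule nn_integral_add) auto
    then show ?thesis unfolding e3 using nn rho0 by (simp add: U.J_const m1 ennreal_plus)
  qed
  have eq: "ennreal m2 = ennreal (m * (1 + \<rho> * m)) + U.excess n"
    using U.binomial_size_bias(3)[OF m1, of "\<lambda>_. 0" n] nn rho0 unfolding e1 e2 e4 by (simp add: ennreal_mult)
  have ex: "U.excess n < \<infinity>"
  proof -
    have "U.excess n \<noteq> top"
    proof
      assume "U.excess n = top"
      then have "ennreal m2 = top" using eq by simp
      then show False by simp
    qed
    then show ?thesis by (simp add: less_top)
  qed
  define e where "e = enn2real (U.excess n)"
  have ee: "U.excess n = ennreal e" "0 \<le> e" using ex by (simp_all add: e_def)
  have "ennreal m2 = ennreal (m * (1 + \<rho> * m) + e)" unfolding eq ee(1) using nn rho0 ee(2) by (simp add: ennreal_plus)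
  then have ev: "m2 = m * (1 + \<rho> * m) + e" using nn rho0 ee(2) by (subst (asm) ennreal_inj) auto
  define D where "D = U.excess n + U.J n of_nat * U.loss n"
  \<comment> \<open>\<open>e\<close> equals m2 - m - \<rho> m^2 by \<open>ev\<close>, and
    \<open>loss\<close> equals m - \<rho> m when k \<le> n. The last conjunct turns the resulting
    m^2 (1 - \<rho>) into the term with 6^k k! / t.\<close>
  have D: "D = ennreal (e + m * (m - \<rho> * m)) \<and> 0 \<le> e + m * (m - \<rho> * m) \<and> 2 * (m * (m - \<rho> * m)) \<le> 6 ^ k * fact k / t * m\<^sup>2"
  proof (cases "k \<le> n")
    case True
    have le: "ennreal m = ennreal (\<rho> * m) + U.loss n" using U.loss_eq[OF m1 True] unfolding e1 e3 .
    then have "ennreal (\<rho> * m) \<le> ennreal m" by simp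
    then have lm: "\<rho> * m \<le> m" using nn by (subst (asm) ennreal_le_iff) auto
    have "U.loss n = ennreal m - ennreal (\<rho> * m)" unfolding le by simp
    also have "\<dots> = ennreal (m - \<rho> * m)" using nn rho0 by (simp add: ennreal_minus)
    finally have "D = ennreal e + ennreal m * ennreal (m - \<rho> * m)" unfolding D_def e1 ee(1) by simp
    also have "\<dots> = ennreal (e + m * (m - \<rho> * m))" using nn lm ee(2) by (simp add: ennreal_plus ennreal_mult)
    finally have "D = ennreal (e + m * (m - \<rho> * m))" .
    moreover have "0 \<le> e + m * (m - \<rho> * m)" using nn lm ee(2) by simp
    moreover have "2 * (m * (m - \<rho> * m)) = (2 * (1 - \<rho>)) * m\<^sup>2" by (simp add: power2_eq_square algebra_simps)
    moreover have "(2 * (1 - \<rho>)) * m\<^sup>2 \<le> 6 ^ k * fact k / t * m\<^sup>2"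
      unfolding \<rho>_def by (intro mult_right_mono one_minus_ffact_ratio_le k True t) simp
    ultimately show ?thesis by simp
  next
    case False
    then have "n choose k = 0" by simp
    then have "U.J n of_nat = 0" unfolding U.J_of_nat by (simp only: of_nat_0 mult_zero_left)
    then have "m = 0" using e1 nn by simp
    then show ?thesis unfolding D_def \<open>U.J n of_nat = 0\<close> using ee by simp
  qed
  show "\<bar>expectation (\<lambda>\<omega>. real (?s \<omega>) * \<phi> (?s \<omega>)) - m * expectation (\<lambda>\<omega>. \<phi> (Suc (?s \<omega>)))\<bar> \<le> 2 * (m2 - m - \<rho> * m\<^sup>2) + 6 ^ k * fact k / t * m\<^sup>2"
    if \<phi>: "\<And>i. 0 \<le> \<phi> i" "\<And>i. \<phi> i \<le> 2"
  proof -
    have "\<bar>expectation (\<lambda>\<omega>. real (?s \<omega>) * \<phi> (?s \<omega>)) - m * expectation (\<lambda>\<omega>. \<phi> (Suc (?s \<omega>)))\<bar> \<le> 2 * enn2real D"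
      unfolding m_def
    proof (rule size_bias_real[OF _ int1 _ _ _ \<phi>])
      show "D < \<infinity>" using D by simp
      fix \<psi> :: "nat \<Rightarrow> ennreal" assume \<psi>: "\<And>i. \<psi> i \<le> 2"
      show "(\<integral>\<^sup>+\<omega>. of_nat (?s \<omega>) * \<psi> (?s \<omega>) \<partial>M) \<le> (\<integral>\<^sup>+\<omega>. of_nat (?s \<omega>) \<partial>M) * (\<integral>\<^sup>+\<omega>. \<psi> (Suc (?s \<omega>)) \<partial>M) + 2 * D"
        unfolding func[of of_nat] func[of "\<lambda>s. of_nat s * \<psi> s"] func[of "\<lambda>s. \<psi> (Suc s)"] D_def
        by (rule U.binomial_size_bias(1)[OF m1 \<psi>])
      show "(\<integral>\<^sup>+\<omega>. of_nat (?s \<omega>) \<partial>M) * (\<integral>\<^sup>+\<omega>. \<psi> (Suc (?s \<omega>)) \<partial>M) \<le> (\<integral>\<^sup>+\<omega>. of_nat (?s \<omega>) * \<psi> (?s \<omega>) \<partial>M) + 2 * D"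
        unfolding func[of of_nat] func[of "\<lambda>s. of_nat s * \<psi> s"] func[of "\<lambda>s. \<psi> (Suc s)"] D_def
        by (rule U.binomial_size_bias(2)[OF m1 \<psi>])
    qed simp
    also have "2 * enn2real D = 2 * e + 2 * (m * (m - \<rho> * m))" using D by simp
    also have "\<dots> \<le> 2 * e + 6 ^ k * fact k / t * m\<^sup>2" using D by simp
    also have "e = m2 - m - \<rho> * m\<^sup>2" using ev by (simp add: power2_eq_square algebra_simps)
    finally show ?thesis .
  qed
  show "m2 \<le> m + \<rho> * m\<^sup>2 + 2 ^ k / fact k * r"
    if r: "0 \<le> r" and I: "\<And>l. 1 \<le> l \<Longrightarrow> l < k \<Longrightarrow> overlap k H (scale_measure (ennreal (real n)) Q) l \<le> ennreal r"
  proof -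
    have sc: "sigma_finite_measure (scale_measure (ennreal (real n)) Q)"
    proof -
      have "finite_measure (scale_measure (ennreal (real n)) Q)"
        by (rule finite_measureI) (simp add: space_scale_measure Q.emeasure_space_1)
      then show ?thesis by (rule finite_measure.axioms)
    qed
    have "of_nat (n ^ (2*k - l)) * overlap k H Q l \<le> ennreal r" if l: "1 \<le> l" "l < k" for l
    proof -
      have "overlap k H (scale_measure (ennreal (real n)) Q) l = ennreal (real n) ^ (2*k - l) * overlap k H Q l"
        using l by (intro overlap_scale_measure Q.sigma_finite_measure_axioms sc H) auto
      moreover have "ennreal (real n) ^ (2*k - l) = of_nat (n ^ (2*k - l))"
        by (simp add: ennreal_of_nat_eq_real_of_nat ennreal_power)
      ultimately show ?thesis using I[OF l] by simp
    qed
    from U.binomial_second_moment_le[OF m1 this]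
    have "ennreal m2 \<le> ennreal m * ennreal (\<rho> * m) + ennreal m + ennreal (2 ^ k / fact k) * ennreal r"
      unfolding e1 e2 e3 .
    also have "\<dots> = ennreal (m * (\<rho> * m) + m + 2 ^ k / fact k * r)"
    proof -
      have "ennreal (2 ^ k / fact k) * ennreal r = ennreal (2 ^ k / fact k * r)"
        by (rule ennreal_mult[symmetric]) (use r in auto)
      then show ?thesis using nn rho0 r by (simp add: ennreal_plus ennreal_mult)
    qed
    finally have "m2 \<le> m * (\<rho> * m) + m + 2 ^ k / fact k * r" using nn rho0 r by (subst (asm) ennreal_le_iff) auto
    then show ?thesis by (simp add: power2_eq_square algebra_simps)
  qed
qed

lemma sigma_finite_scale_measure:
  assumes "sigma_finite_measure K" "c < \<infinity>"
  shows "sigma_finite_measure (scale_measure c K)"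
proof -
  interpret K: sigma_finite_measure K by fact
  obtain A where A: "countable A" "A \<subseteq> sets K" "\<Union>A = space K" "\<And>a. a \<in> A \<Longrightarrow> emeasure K a \<noteq> \<infinity>"
    using K.sigma_finite_countable by blast
  show ?thesis
  proof (rule sigma_finite_measure.intro, intro exI conjI ballI)
    show "countable A" by (rule A(1))
    show "A \<subseteq> sets (scale_measure c K)" using A(2) by simp
    show "\<Union>A = space (scale_measure c K)" using A(3) by (simp add: space_scale_measure)
    fix a assume "a \<in> A"
    then show "emeasure (scale_measure c K) a \<noteq> \<infinity>"
      using A(4)[of a] assms(2) by (simp add: ennreal_mult_eq_top_iff)
  qed
qed

text \<open>Both laws live on the naturals, so a test function matters only through its restriction
  to them, which is 1-Lipschitz there; the Stein bound is uniform in it and survives the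
  supremum.\<close>

lemma (in prob_space) dW_le:
  fixes s :: "'a \<Rightarrow> nat"
  assumes s[measurable]: "s \<in> M \<rightarrow>\<^sub>M count_space UNIV" and int_s: "integrable M (\<lambda>\<omega>. real (s \<omega>))"
    and D: "\<And>\<phi>. (\<And>n. 0 \<le> \<phi> n) \<Longrightarrow> (\<And>n. \<phi> n \<le> 2) \<Longrightarrow>
      \<bar>expectation (\<lambda>\<omega>. real (s \<omega>) * \<phi> (s \<omega>)) - expectation (\<lambda>\<omega>. real (s \<omega>)) * expectation (\<lambda>\<omega>. \<phi> (Suc (s \<omega>)))\<bar> \<le> D"
    and lam: "0 \<le> lam"
  shows "dW (distr M borel (\<lambda>\<omega>. real (s \<omega>))) (distr (measure_pmf (po lam)) borel real)
    \<le> ereal (\<bar>expectation (\<lambda>\<omega>. real (s \<omega>)) - lam\<bar> + D)"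
  unfolding dW_def
proof (rule SUP_least)
  fix h :: "real \<Rightarrow> real" assume "h \<in> {h. 1-lipschitz_on UNIV h}"
  then have h: "1-lipschitz_on UNIV h" by simp
  have hb[measurable]: "h \<in> borel_measurable borel"
    by (rule borel_measurable_continuous_onI[OF lipschitz_on_continuous_on[OF h]])
  have "\<bar>h (real i) - h (real j)\<bar> \<le> \<bar>real i - real j\<bar>" for i j
    using lipschitz_onD[OF h, of "real i" "real j"] by (simp add: dist_real_def)
  from stein_bound[OF s int_s D this lam]
  have "\<bar>expectation (\<lambda>\<omega>. h (real (s \<omega>))) - measure_pmf.expectation (po lam) (\<lambda>n. h (real n))\<bar> \<le> \<bar>expectation (\<lambda>\<omega>. real (s \<omega>)) - lam\<bar> + D"
    by blast
  moreover have "integral\<^sup>L (distr M borel (\<lambda>\<omega>. real (s \<omega>))) h = expectation (\<lambda>\<omega>. h (real (s \<omega>)))"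
    by (rule integral_distr) measurable
  moreover have "integral\<^sup>L (distr (measure_pmf (po lam)) borel real) h = measure_pmf.expectation (po lam) (\<lambda>n. h (real n))"
    by (rule integral_distr) (simp_all add: hb)
  ultimately show "ereal \<bar>integral\<^sup>L (distr M borel (\<lambda>\<omega>. real (s \<omega>))) h - integral\<^sup>L (distr (measure_pmf (po lam)) borel real) h\<bar>
    \<le> ereal (\<bar>expectation (\<lambda>\<omega>. real (s \<omega>)) - lam\<bar> + D)" by simp
qed

section \<open>Translation into the notions of the theorem\<close>

definition hitset :: "nat \<Rightarrow> ((nat \<Rightarrow> 'a::topological_space) \<Rightarrow> 'b) \<Rightarrow> 'b set \<Rightarrow> (nat \<Rightarrow> 'a) set" where
  "hitset k f B = {x \<in> {..<k} \<rightarrow>\<^sub>E UNIV. f x \<in> B}"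

lemma hitset_sets:
  assumes "f \<in> PiM {..<k} (\<lambda>_. borel) \<rightarrow>\<^sub>M borel" "B \<in> sets borel"
  shows "hitset k f B \<in> sets (PiM {..<k} (\<lambda>_. borel))"
proof -
  have "hitset k f B = f -` B \<inter> space (PiM {..<k} (\<lambda>_. borel))" by (auto simp: hitset_def space_PiM)
  then show ?thesis using measurable_sets[OF assms] by simp
qed

lemma hitset_sym:
  assumes "symmetric_map k f"
  shows "sym_set k (hitset k f B)"
  unfolding sym_set_def
proof (intro allI impI)
  fix x :: "nat \<Rightarrow> 'a" and \<sigma> assume \<sigma>: "\<sigma> permutes {..<k}" and x: "(\<lambda>j\<in>{..<k}. x j) \<in> hitset k f B"
  let ?y = "restrict x {..<k}"
  have "f (\<lambda>j\<in>{..<k}. ?y (\<sigma> j)) = f ?y"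
    using assms \<sigma> unfolding symmetric_map_def by (metis UNIV_I restrict_PiE_iff)
  moreover have "(\<lambda>j\<in>{..<k}. ?y (\<sigma> j)) = (\<lambda>j\<in>{..<k}. x (\<sigma> j))"
    by (rule restrict_ext) (use permutes_in_image[OF \<sigma>] in simp)
  ultimately show "(\<lambda>j\<in>{..<k}. x (\<sigma> j)) \<in> hitset k f B" using x by (simp add: hitset_def)
qed

lemma overlap_le_r_term:
  assumes l: "1 \<le> l" "l < k"
  shows "overlap k (hitset k f B) L l \<le> r_term k f B L"
proof -
  have ind: "indicator (hitset k f B) (join_tuple k l x y) = (indicator B (f (join_tuple k l x y)) :: ennreal)" for x y
    by (simp add: indicator_def hitset_def join_tuple_def)
  have "overlap k (hitset k f B) L l \<le> Max ((\<lambda>l. \<integral>\<^sup>+ x. (\<integral>\<^sup>+ y. indicator B (f (join_tuple k l x y)) \<partial>(PiM {..<k-l} (\<lambda>_. L)))\<^sup>2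
                    \<partial>(PiM {..<l} (\<lambda>_. L))) ` {1..k-1})"
    unfolding overlap_def ind by (rule Max_ge) (use l in auto)
  then show ?thesis using l by (simp add: r_term_def)
qed

text \<open>The division by k! cancels against the k! orderings of each hit. The second equation
  holds at every \<omega>: with infinitely many hits both sides are 0.\<close>

lemma Sstat_eq:
  assumes "symmetric_map k f"
  shows "Sstat k f B \<kappa> X \<omega> = (if finite (hits k (hitset k f B) (pts \<kappa> X UNIV \<omega>) (X \<omega>))
      then ennreal (real (ucount k (hitset k f B) (pts \<kappa> X UNIV \<omega>) (X \<omega>))) else \<infinity>)"
    and "Sreal k f B \<kappa> X \<omega> = real (ucount k (hitset k f B) (pts \<kappa> X UNIV \<omega>) (X \<omega>))"
proof -
  have T: "hit_tuples k f B \<kappa> X \<omega> = {i \<in> {..<k} \<rightarrow>\<^sub>E pts \<kappa> X UNIV \<omega>. inj_on i {..<k} \<and> (\<lambda>j\<in>{..<k}. X \<omega> (i j)) \<in> hitset k f B}"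
    by (simp add: hit_tuples_def pts_def hitset_def)
  show S: "Sstat k f B \<kappa> X \<omega> = (if finite (hits k (hitset k f B) (pts \<kappa> X UNIV \<omega>) (X \<omega>))
      then ennreal (real (ucount k (hitset k f B) (pts \<kappa> X UNIV \<omega>) (X \<omega>))) else \<infinity>)"
    unfolding Sstat_def T card_inj_tuples[OF hitset_sym[OF assms]] by simp
  show "Sreal k f B \<kappa> X \<omega> = real (ucount k (hitset k f B) (pts \<kappa> X UNIV \<omega>) (X \<omega>))"
    unfolding Sreal_def S by (simp add: ucount_def)
qed

text \<open>\<open>Sstat\<close> is \<infinity> wherever there are infinitely many hits, so a finite
  second moment excludes this almost surely and \<open>Sstat\<close> agrees with the integer count.
  First moments follow because n \<le> n^2 for integers.\<close>

lemma ustat_integrable: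
  fixes X :: "'w \<Rightarrow> nat \<Rightarrow> 'a::topological_space" and f :: "(nat \<Rightarrow> 'a) \<Rightarrow> 'b::topological_space"
  assumes pp: "point_process M \<kappa> X" and f: "f \<in> PiM {..<k} (\<lambda>_. borel) \<rightarrow>\<^sub>M borel" and sym: "symmetric_map k f"
    and B: "B \<in> sets borel" and S2: "(\<integral>\<^sup>+ \<omega>. (Sstat k f B \<kappa> X \<omega>)\<^sup>2 \<partial>M) < \<infinity>"
  defines "s \<equiv> \<lambda>\<omega>. ucount k (hitset k f B) (pts \<kappa> X UNIV \<omega>) (X \<omega>)"
  shows "s \<in> M \<rightarrow>\<^sub>M count_space UNIV"
    and "AE \<omega> in M. finite (hits k (hitset k f B) (pts \<kappa> X UNIV \<omega>) (X \<omega>))"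
    and "integrable M (\<lambda>\<omega>. (real (s \<omega>))\<^sup>2)"
    and "integrable M (\<lambda>\<omega>. real (s \<omega>))"
proof -
  note HS = hitset_sym[OF sym, of B] hitset_sets[OF f B]
  have mX: "(\<lambda>\<omega>. X \<omega> i) \<in> M \<rightarrow>\<^sub>M borel" for i using pp unfolding point_process_def by blast
  have "\<kappa> \<in> M \<rightarrow>\<^sub>M count_space UNIV" using pp unfolding point_process_def by blast
  then have "Measurable.pred M (\<lambda>\<omega>. enat j < \<kappa> \<omega>)" for j by (rule measurable_compose) simp
  then have mP: "Measurable.pred M (\<lambda>\<omega>. j \<in> pts \<kappa> X UNIV \<omega>)" for j by (simp add: pts_def)
  show s[measurable]: "s \<in> M \<rightarrow>\<^sub>M count_space UNIV"
    unfolding s_def by (rule measurable_ucount_random[OF HS mX mP])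
  have fin[measurable]: "Measurable.pred M (\<lambda>\<omega>. finite (hits k (hitset k f B) (pts \<kappa> X UNIV \<omega>) (X \<omega>)))"
    by (rule measurable_finite_hits[OF HS mX mP])
  have [measurable]: "(\<lambda>\<omega>. (Sstat k f B \<kappa> X \<omega>)\<^sup>2) \<in> borel_measurable M"
    unfolding Sstat_eq(1)[OF sym] power2_eq_square using s[unfolded s_def] by measurable
  have "AE \<omega> in M. (Sstat k f B \<kappa> X \<omega>)\<^sup>2 \<noteq> \<infinity>"
    by (rule nn_integral_PInf_AE) (use S2 in auto)
  then show AEfin: "AE \<omega> in M. finite (hits k (hitset k f B) (pts \<kappa> X UNIV \<omega>) (X \<omega>))"
    by eventually_elim (auto simp: Sstat_eq(1)[OF sym] power2_eq_square split: if_splits)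
  show i2: "integrable M (\<lambda>\<omega>. (real (s \<omega>))\<^sup>2)"
  proof (rule integrableI_nonneg)
    have "(\<integral>\<^sup>+\<omega>. ennreal ((real (s \<omega>))\<^sup>2) \<partial>M) = (\<integral>\<^sup>+ \<omega>. (Sstat k f B \<kappa> X \<omega>)\<^sup>2 \<partial>M)"
      by (rule nn_integral_cong_AE, use AEfin in eventually_elim) (simp add: Sstat_eq(1)[OF sym] s_def ennreal_power)
    then show "(\<integral>\<^sup>+\<omega>. ennreal ((real (s \<omega>))\<^sup>2) \<partial>M) < \<infinity>" using S2 by simp
  qed auto
  have "real i \<le> (real i)\<^sup>2" for i by (cases i) (simp_all add: power2_eq_square)
  then show "integrable M (\<lambda>\<omega>. real (s \<omega>))"
    by (intro Bochner_Integration.integrable_bound[OF i2]) auto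
qed

text \<open>The overlap maximum may be infinite, in which case the right side is \<infinity> and the
  bound is trivial; only the finite case needs the second-moment estimate. The exponent k + 1 joins
  2^k with the factor 2 of the Stein bound.\<close>

lemma ereal_bound_r_term:
  assumes "\<And>r'. 0 \<le> r' \<Longrightarrow> r = ennreal r' \<Longrightarrow> c \<le> 2 ^ k / fact k * r'"
  shows "ereal (a + 2 * c) \<le> ereal a + ereal (2 ^ (k + 1) / fact k) * enn2ereal r"
proof (cases r)
  case (real r')
  then have "a + 2 * c \<le> a + 2 ^ (k + 1) / fact k * r'" using assms[of r'] by simp
  then show ?thesis using real by (simp add: enn2ereal_ennreal)
next
  case top
  then show ?thesis by simp
qed

theorem theorem7p1:
  fixes M :: "'w measure" and \<kappa> :: "'w \<Rightarrow> enat" and X :: "'w \<Rightarrow> nat \<Rightarrow> 'a::topological_space"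
    and f :: "(nat \<Rightarrow> 'a) \<Rightarrow> 'b::topological_space" and B :: "'b set"
    and K K1 :: "'a measure" and t lam :: real and k :: nat
  assumes "lcscH TYPE('a)" and "lcscH TYPE('b)"
    and "k \<ge> 1" and "t \<ge> 1"
    and "f \<in> PiM {..<k} (\<lambda>_. borel) \<rightarrow>\<^sub>M borel" and "symmetric_map k f"
    and "B \<in> sets borel"
    and "lam \<ge> 0"
    and "(\<integral>\<^sup>+ \<omega>. (Sstat k f B \<kappa> X \<omega>)\<^sup>2 \<partial>M) < \<infinity>"
  shows
   "(sigma_finite_measure K \<and> sets K = sets borel \<and>
       poisson_process M \<kappa> X (scale_measure (ennreal t) K) \<longrightarrow>
     (let S = Sreal k f B \<kappa> X; ES = integral\<^sup>L M S; ES2 = integral\<^sup>L M (\<lambda>\<omega>. (S \<omega>)\<^sup>2) in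
       dW (distr M borel S) (distr (measure_pmf (po lam)) borel real)
         \<le> ereal (\<bar>ES - lam\<bar> + 2 * (ES2 - ES - ES\<^sup>2)) \<and>
       ereal (\<bar>ES - lam\<bar> + 2 * (ES2 - ES - ES\<^sup>2))
         \<le> ereal \<bar>ES - lam\<bar> + ereal (2 ^ (k + 1) / fact k)
             * enn2ereal (r_term k f B (scale_measure (ennreal t) K))))
   \<and>
   (prob_space K1 \<and> sets K1 = sets borel \<and>
       binomial_process M \<kappa> X (nat \<lceil>t\<rceil>) K1 \<longrightarrow>
     (let S = Sreal k f B \<kappa> X; ES = integral\<^sup>L M S; ES2 = integral\<^sup>L M (\<lambda>\<omega>. (S \<omega>)\<^sup>2) in
       dW (distr M borel S) (distr (measure_pmf (po lam)) borel real)
         \<le> ereal (\<bar>ES - lam\<bar> + 2 * (ES2 - ES - ffact_ratio (nat \<lceil>t\<rceil>) k * ES\<^sup>2)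
                   + 6 ^ k * fact k / t * ES\<^sup>2) \<and>
       ereal (\<bar>ES - lam\<bar> + 2 * (ES2 - ES - ffact_ratio (nat \<lceil>t\<rceil>) k * ES\<^sup>2)
                   + 6 ^ k * fact k / t * ES\<^sup>2)
         \<le> ereal \<bar>ES - lam\<bar> + ereal (2 ^ (k + 1) / fact k)
             * enn2ereal (r_term k f B (scale_measure (ennreal (real (nat \<lceil>t\<rceil>))) K1))
           + ereal (6 ^ k * fact k / t * ES\<^sup>2)))"
proof -
  let ?H = "hitset k f B"
  let ?s = "\<lambda>\<omega>. ucount k ?H (pts \<kappa> X UNIV \<omega>) (X \<omega>)"
  note HS = hitset_sym[OF assms(6), of B] hitset_sets[OF assms(5,7)]
  have S: "Sreal k f B \<kappa> X = (\<lambda>\<omega>. real (?s \<omega>))" by (rule ext) (rule Sstat_eq(2)[OF assms(6)])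
  let ?m = "integral\<^sup>L M (\<lambda>\<omega>. real (?s \<omega>))" and ?m2 = "integral\<^sup>L M (\<lambda>\<omega>. (real (?s \<omega>))\<^sup>2)"
  have P: "dW (distr M borel (\<lambda>\<omega>. real (?s \<omega>))) (distr (measure_pmf (po lam)) borel real)
         \<le> ereal (\<bar>?m - lam\<bar> + 2 * (?m2 - ?m - ?m\<^sup>2)) \<and>
       ereal (\<bar>?m - lam\<bar> + 2 * (?m2 - ?m - ?m\<^sup>2))
         \<le> ereal \<bar>?m - lam\<bar> + ereal (2 ^ (k + 1) / fact k)
             * enn2ereal (r_term k f B (scale_measure (ennreal t) K))"
    if sf: "sigma_finite_measure K" and sK: "sets K = sets borel" and pp: "poisson_process M \<kappa> X (scale_measure (ennreal t) K)"
  proof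
    let ?L = "scale_measure (ennreal t) K"
    have pt: "point_process M \<kappa> X" using pp unfolding poisson_process_def by blast
    then have M: "prob_space M" unfolding point_process_def by blast
    interpret prob_space M by (rule M)
    interpret poisson_stat M \<kappa> X ?L k ?H
      by unfold_locales (use pp sK assms(3) HS in auto)
    note int = ustat_integrable[OF pt assms(5,6,7,9)]
    note pb = poisson_bounds[OF sigma_finite_scale_measure[OF sf] int(2,3)]
    show "dW (distr M borel (\<lambda>\<omega>. real (?s \<omega>))) (distr (measure_pmf (po lam)) borel real)
         \<le> ereal (\<bar>?m - lam\<bar> + 2 * (?m2 - ?m - ?m\<^sup>2))"
      by (rule dW_le[OF int(1,4) _ assms(8)]) (rule pb(1), auto)
    show "ereal (\<bar>?m - lam\<bar> + 2 * (?m2 - ?m - ?m\<^sup>2))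
         \<le> ereal \<bar>?m - lam\<bar> + ereal (2 ^ (k + 1) / fact k) * enn2ereal (r_term k f B ?L)"
    proof (rule ereal_bound_r_term)
      fix r assume r: "0 \<le> r" "r_term k f B ?L = ennreal r"
      have "?m2 \<le> ?m\<^sup>2 + ?m + 2 ^ k / fact k * r"
      proof (rule pb(2)[OF _ r(1)])
        fix l assume "1 \<le> l" "l < k"
        then show "overlap k ?H ?L l \<le> ennreal r" unfolding r(2)[symmetric] by (rule overlap_le_r_term)
      qed simp
      then show "?m2 - ?m - ?m\<^sup>2 \<le> 2 ^ k / fact k * r" by linarith
    qed
  qed
  have Bin: "dW (distr M borel (\<lambda>\<omega>. real (?s \<omega>))) (distr (measure_pmf (po lam)) borel real)
         \<le> ereal (\<bar>?m - lam\<bar> + 2 * (?m2 - ?m - ffact_ratio (nat \<lceil>t\<rceil>) k * ?m\<^sup>2)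
                   + 6 ^ k * fact k / t * ?m\<^sup>2) \<and>
       ereal (\<bar>?m - lam\<bar> + 2 * (?m2 - ?m - ffact_ratio (nat \<lceil>t\<rceil>) k * ?m\<^sup>2)
                   + 6 ^ k * fact k / t * ?m\<^sup>2)
         \<le> ereal \<bar>?m - lam\<bar> + ereal (2 ^ (k + 1) / fact k)
             * enn2ereal (r_term k f B (scale_measure (ennreal (real (nat \<lceil>t\<rceil>))) K1))
           + ereal (6 ^ k * fact k / t * ?m\<^sup>2)"
    if Q: "prob_space K1" and sQ: "sets K1 = sets borel" and bp: "binomial_process M \<kappa> X (nat \<lceil>t\<rceil>) K1"
  proof
    let ?n = "nat \<lceil>t\<rceil>"
    let ?L = "scale_measure (ennreal (real ?n)) K1"
    have pt: "point_process M \<kappa> X" and kap: "\<And>\<omega>. \<omega> \<in> space M \<Longrightarrow> \<kappa> \<omega> = enat ?n"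
      and ind: "prob_space.indep_vars M (\<lambda>_. K1) (\<lambda>i \<omega>. X \<omega> i) {..<?n}"
      and dis: "\<And>i. i < ?n \<Longrightarrow> distr M K1 (\<lambda>\<omega>. X \<omega> i) = K1"
      using bp unfolding binomial_process_def by blast+
    then have M: "prob_space M" unfolding point_process_def by blast
    interpret prob_space M by (rule M)
    \<comment> \<open>The inequality t \<le> \<lceil>t\<rceil> is what allows the error of order 1 /
      \<lceil>t\<rceil> to be stated with 1 / t.\<close>
    have n: "1 \<le> ?n" "0 < t" "t \<le> real ?n" using assms(4) by linarith+
    \<comment> \<open>The number of points is known to be n only on \<open>space M\<close>, so the
      two counts agree there and integrals are rewritten by congruence.\<close>
    have s: "?s \<omega> = ucount k ?H {..<?n} (X \<omega>)" if "\<omega> \<in> space M" for \<omega>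
      using kap[OF that] by (simp add: pts_def lessThan_def)
    have cong: "integral\<^sup>L M (\<lambda>\<omega>. F (?s \<omega>)) = integral\<^sup>L M (\<lambda>\<omega>. F (ucount k ?H {..<?n} (X \<omega>)))" for F :: "nat \<Rightarrow> real"
      by (rule Bochner_Integration.integral_cong) (use s in auto)
    note int = ustat_integrable[OF pt assms(5,6,7,9)]
    have HQ: "?H \<in> sets (PiM {..<k} (\<lambda>_. K1))"
      using HS(2) sets_PiM_cong[of "{..<k}" "{..<k}" "\<lambda>_. K1" "\<lambda>_. borel"] sQ by simp
    have int2: "integrable M (\<lambda>\<omega>. (real (ucount k ?H {..<?n} (X \<omega>)))\<^sup>2)"
      using int(3) by (rule Bochner_Integration.integrable_cong[THEN iffD1, rotated -1]) (use s in auto)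
    note bb = binomial_bounds[OF assms(3) n(1) HS(1) HQ Q ind dis n(2,3) int2, folded cong[of "\<lambda>i. (real i)\<^sup>2"] cong[of real]]
    have "dW (distr M borel (\<lambda>\<omega>. real (?s \<omega>))) (distr (measure_pmf (po lam)) borel real)
         \<le> ereal (\<bar>?m - lam\<bar> + (2 * (?m2 - ?m - ffact_ratio ?n k * ?m\<^sup>2) + 6 ^ k * fact k / t * ?m\<^sup>2))"
    proof (rule dW_le[OF int(1,4) _ assms(8)])
      fix \<phi> :: "nat \<Rightarrow> real" assume \<phi>: "\<And>n. 0 \<le> \<phi> n" "\<And>n. \<phi> n \<le> 2"
      show "\<bar>integral\<^sup>L M (\<lambda>\<omega>. real (?s \<omega>) * \<phi> (?s \<omega>)) - ?m * integral\<^sup>L M (\<lambda>\<omega>. \<phi> (Suc (?s \<omega>)))\<bar>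
        \<le> 2 * (?m2 - ?m - ffact_ratio ?n k * ?m\<^sup>2) + 6 ^ k * fact k / t * ?m\<^sup>2"
        using bb(1)[OF _ \<phi>] unfolding cong[of "\<lambda>i. real i * \<phi> i"] cong[of "\<lambda>i. \<phi> (Suc i)"] by simp
    qed
    then show "dW (distr M borel (\<lambda>\<omega>. real (?s \<omega>))) (distr (measure_pmf (po lam)) borel real)
         \<le> ereal (\<bar>?m - lam\<bar> + 2 * (?m2 - ?m - ffact_ratio ?n k * ?m\<^sup>2) + 6 ^ k * fact k / t * ?m\<^sup>2)"
      by (simp only: add.assoc)
    have "ereal (\<bar>?m - lam\<bar> + 2 * (?m2 - ?m - ffact_ratio ?n k * ?m\<^sup>2))
         \<le> ereal \<bar>?m - lam\<bar> + ereal (2 ^ (k + 1) / fact k) * enn2ereal (r_term k f B ?L)"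
    proof (rule ereal_bound_r_term)
      fix r assume r: "0 \<le> r" "r_term k f B ?L = ennreal r"
      have "?m2 \<le> ?m + ffact_ratio ?n k * ?m\<^sup>2 + 2 ^ k / fact k * r"
      proof (rule bb(2)[OF _ r(1)])
        fix l assume "1 \<le> l" "l < k"
        then show "overlap k ?H ?L l \<le> ennreal r" unfolding r(2)[symmetric] by (rule overlap_le_r_term)
      qed simp
      then show "?m2 - ?m - ffact_ratio ?n k * ?m\<^sup>2 \<le> 2 ^ k / fact k * r" by linarith
    qed
    then show "ereal (\<bar>?m - lam\<bar> + 2 * (?m2 - ?m - ffact_ratio ?n k * ?m\<^sup>2) + 6 ^ k * fact k / t * ?m\<^sup>2)
         \<le> ereal \<bar>?m - lam\<bar> + ereal (2 ^ (k + 1) / fact k) * enn2ereal (r_term k f B ?L)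
           + ereal (6 ^ k * fact k / t * ?m\<^sup>2)"
      unfolding plus_ereal.simps(1)[symmetric] by (rule add_right_mono)
  qed
  show ?thesis unfolding S Let_def using P Bin by blast
qed

end
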